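(* Given $u_0\in H^{1/2}_+(\mathbb S^1)$, there exists a unique solution $u\in C(\mathbb R,H^{1/2}_+(\mathbb S^1))$ of $$i\partial_tu=\Pi(|u|^2u)$$ such that $u(0)=u_0$. For every $T>0$, the mapping $u_0\in H^{1/2}_+\mapsto u\in C([-T,T],H^{1/2}_+)$ is continuous. Moreover, if $u_0\in H^s_+(\mathbb S^1)$ for some $s>\frac12$, then $u\in C(\mathbb R,H^s_+(\mathbb S^1))$.
   Context: $\mathbb S^1$ is the unit circle in $\mathbb C$. For a space $E$ of distributions on $\mathbb S^1$, $E_+$ denotes the subspace of those $u\in E$ with Fourier coefficients $\hat u(k)=0$ for all $k<0$; $L^2_+$ is the Hardy space and $H^s_+=(H^s(\mathbb S^1))_+$ with $H^s$ the Sobolev space. $\Pi:L^2(\mathbb S^1)\to L^2_+(\mathbb S^1)$ is the orthogonal projector, $\Pi(\sum_{k\in\mathbb Z}\hat u(k)e^{ik\theta})=\sum_{k\ge0}\hat u(k)e^{ik\theta}$. Since $H^{1/2}(\mathbb S^1)\subset L^p$ for all $p<\infty$, $|u|^2u\in L^2$ for $u\in H^{1/2}_+$; the equation is understood in the sense of distributions (equivalently $u(t)=u_0-i\int_0^t\Pi(|u|^2u)\,dt'$). *)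

theory Defs
  imports "HOL-Probability.Probability"
begin

section \<open>The Hilbert space of square-integrable functions on the unit circle\<close>

text \<open>Normalised arc length on the unit circle, as a Borel measure on the complex plane.\<close>

definition circle_measure :: "complex measure" where
  "circle_measure = distr (uniform_measure lborel {0..2*pi}) borel cis"

lemma cis_borel [measurable]: "cis \<in> borel_measurable borel"
  by (intro borel_measurable_continuous_onI continuous_intros)

lemma cnj_borel [measurable]: "cnj \<in> borel_measurable borel"
  by (intro borel_measurable_continuous_onI continuous_intros)

lemma sets_circle_measure [simp, measurable_cong]: "sets circle_measure = sets borel"
  by (simp add: circle_measure_def)

lemma space_circle_measure [simp]: "space circle_measure = UNIV"
  by (simp add: circle_measure_def)

interpretation circle_measure: prob_space circle_measure
proof -
  have "prob_space (uniform_measure lborel {0..2*pi})"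
    by (rule prob_space_uniform_measure) auto
  moreover have "cis \<in> measurable (uniform_measure lborel {0..2*pi}) borel"
    by measurable
  ultimately show "prob_space circle_measure"
    unfolding circle_measure_def by (rule prob_space.prob_space_distr)
qed

lemma AE_circle_norm: "AE z in circle_measure. cmod z = 1"
  unfolding circle_measure_def by (subst AE_distr_iff) auto

definition square_integrable :: "(complex \<Rightarrow> complex) \<Rightarrow> bool" where
  "square_integrable f \<longleftrightarrow>
     f \<in> borel_measurable borel \<and> integrable circle_measure (\<lambda>z. (cmod (f z))\<^sup>2)"

definition l2_rel :: "(complex \<Rightarrow> complex) \<Rightarrow> (complex \<Rightarrow> complex) \<Rightarrow> bool" where
  "l2_rel f g \<longleftrightarrow> square_integrable f \<and> square_integrable g \<and> (AE z in circle_measure. f z = g z)"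

lemma square_integrable_bounded:
  assumes [measurable]: "f \<in> borel_measurable borel"
    and "AE z in circle_measure. cmod (f z) \<le> B"
  shows "square_integrable f"
  unfolding square_integrable_def
proof
  show "integrable circle_measure (\<lambda>z. (cmod (f z))\<^sup>2)"
    by (rule circle_measure.integrable_const_bound[where B = "B\<^sup>2"])
      (use assms(2) in \<open>auto elim!: eventually_mono intro!: power_mono\<close>)
qed fact

lemma square_integrable_zero: "square_integrable (\<lambda>_. 0)"
  by (simp add: square_integrable_def)

lemma square_integrable_mult:
  "square_integrable f \<Longrightarrow> square_integrable (\<lambda>z. c * f z)"
  by (auto simp: square_integrable_def norm_mult power_mult_distrib)

lemma square_integrable_add:
  assumes f: "square_integrable f" and g: "square_integrable g"
  shows "square_integrable (\<lambda>z. f z + g z)"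
proof -
  have [measurable]: "f \<in> borel_measurable borel" "g \<in> borel_measurable borel"
    using f g by (auto simp: square_integrable_def)
  have *: "(cmod (a + b))\<^sup>2 \<le> 2 * (cmod a)\<^sup>2 + 2 * (cmod b)\<^sup>2" for a b
  proof -
    have "(cmod (a + b))\<^sup>2 \<le> (cmod a + cmod b)\<^sup>2"
      by (intro power_mono norm_triangle_ineq) auto
    also have "\<dots> \<le> 2 * (cmod a)\<^sup>2 + 2 * (cmod b)\<^sup>2"
      using sum_squares_bound[of "cmod a" "cmod b"] by (simp add: power2_sum)
    finally show ?thesis .
  qed
  have "integrable circle_measure (\<lambda>z. 2 * (cmod (f z))\<^sup>2 + 2 * (cmod (g z))\<^sup>2)"
    using f g by (auto simp: square_integrable_def)
  then have "integrable circle_measure (\<lambda>z. (cmod (f z + g z))\<^sup>2)"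
    by (rule Bochner_Integration.integrable_bound) (use * in auto)
  then show ?thesis by (simp add: square_integrable_def)
qed

lemma integrable_mult_square_integrable:
  assumes f: "square_integrable f" and g: "square_integrable g"
  shows "integrable circle_measure (\<lambda>z. f z * g z)"
proof -
  have [measurable]: "f \<in> borel_measurable borel" "g \<in> borel_measurable borel"
    using f g by (auto simp: square_integrable_def)
  have *: "cmod (a * b) \<le> (cmod a)\<^sup>2 + (cmod b)\<^sup>2" for a b
  proof -
    have "0 \<le> cmod a * cmod b" by simp
    then show ?thesis
      using sum_squares_bound[of "cmod a" "cmod b"] unfolding norm_mult by linarith
  qed
  have "integrable circle_measure (\<lambda>z. (cmod (f z))\<^sup>2 + (cmod (g z))\<^sup>2)"
    using f g by (auto simp: square_integrable_def)
  then show ?thesis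
    by (rule Bochner_Integration.integrable_bound) (use * in auto)
qed

lemma square_integrable_cnj: "square_integrable f \<Longrightarrow> square_integrable (\<lambda>z. cnj (f z))"
  by (auto simp: square_integrable_def)

lemma integrable_inner_square_integrable:
  assumes f: "square_integrable f" and g: "square_integrable g"
  shows "integrable circle_measure (\<lambda>z. f z \<bullet> g z)"
proof -
  have "integrable circle_measure (\<lambda>z. Re (f z * cnj (g z)))"
    by (intro integrable_Re integrable_mult_square_integrable square_integrable_cnj f g)
  then show ?thesis
    by (simp add: inner_complex_def)
qed

text \<open>The elements of L2 are classes of functions modulo equality almost everywhere; only the
  values on the unit circle matter.\<close>

quotient_type l2_circle = "complex \<Rightarrow> complex" / partial: l2_rel
proof (rule part_equivpI)
  show "\<exists>f. l2_rel f f"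
    by (rule exI[of _ "\<lambda>_. 0"]) (simp add: l2_rel_def square_integrable_zero)
  show "symp l2_rel"
    by (auto simp: symp_def l2_rel_def)
  show "transp l2_rel"
    by (auto simp: transp_def l2_rel_def)
qed

text \<open>The underlying real inner product is \<open>Re \<langle>f, g\<rangle>\<close>, so the norm is the usual L2 norm for the
  normalised arc length.\<close>

instantiation l2_circle :: real_inner
begin

lift_definition zero_l2_circle :: l2_circle is "\<lambda>_. 0"
  by (simp add: l2_rel_def square_integrable_zero)

lift_definition plus_l2_circle :: "l2_circle \<Rightarrow> l2_circle \<Rightarrow> l2_circle" is "\<lambda>f g z. f z + g z"
  by (auto simp: l2_rel_def intro: square_integrable_add)

lift_definition uminus_l2_circle :: "l2_circle \<Rightarrow> l2_circle" is "\<lambda>f z. - f z"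
  using square_integrable_mult[of _ "-1"] by (auto simp: l2_rel_def)

lift_definition scaleR_l2_circle :: "real \<Rightarrow> l2_circle \<Rightarrow> l2_circle" is "\<lambda>r f z. r *\<^sub>R f z"
  using square_integrable_mult by (auto simp: l2_rel_def scaleR_conv_of_real)

lift_definition inner_l2_circle :: "l2_circle \<Rightarrow> l2_circle \<Rightarrow> real"
  is "\<lambda>f g. LINT z|circle_measure. f z \<bullet> g z"
  by (intro integral_cong_AE) (auto simp: l2_rel_def square_integrable_def)

definition "(f :: l2_circle) - g = f + - g"
definition "norm (f :: l2_circle) = sqrt (f \<bullet> f)"
definition "dist (f :: l2_circle) g = norm (f - g)"
definition "sgn (f :: l2_circle) = scaleR (inverse (norm f)) f"
definition [code del]:
  "(uniformity :: (l2_circle \<times> l2_circle) filter) = (INF e\<in>{0<..}. principal {(x, y). dist x y < e})"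
definition [code del]:
  "open (U :: l2_circle set) \<longleftrightarrow> (\<forall>x\<in>U. eventually (\<lambda>(x', y). x' = x \<longrightarrow> y \<in> U) uniformity)"

instance
proof
  fix f g h :: l2_circle and a b :: real
  show "f + g + h = f + (g + h)"
    by transfer (auto simp: l2_rel_def add.assoc intro!: square_integrable_add)
  show "f + g = g + f"
    by transfer (auto simp: l2_rel_def add.commute intro!: square_integrable_add)
  show "0 + f = f"
    by transfer (auto simp: l2_rel_def)
  show "- f + f = 0"
    by transfer (auto simp: l2_rel_def square_integrable_zero)
  show "f - g = f + - g"
    by (simp add: minus_l2_circle_def)
  show "a *\<^sub>R (f + g) = a *\<^sub>R f + a *\<^sub>R g"
    by transfer (auto simp: l2_rel_def scaleR_conv_of_real distrib_left distrib_right
        intro!: square_integrable_add square_integrable_mult)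
  show "(a + b) *\<^sub>R f = a *\<^sub>R f + b *\<^sub>R f"
    by transfer (auto simp: l2_rel_def scaleR_conv_of_real distrib_left distrib_right
        intro!: square_integrable_add square_integrable_mult)
  show "a *\<^sub>R b *\<^sub>R f = (a * b) *\<^sub>R f"
    by transfer (auto simp: l2_rel_def scaleR_conv_of_real mult.assoc
        intro!: square_integrable_mult)
  show "1 *\<^sub>R f = f"
    by transfer (auto simp: l2_rel_def)
  show "dist f g = norm (f - g)" "sgn f = inverse (norm f) *\<^sub>R f" "norm f = sqrt (f \<bullet> f)"
    by (simp_all add: dist_l2_circle_def sgn_l2_circle_def norm_l2_circle_def)
  show "(uniformity :: (l2_circle \<times> l2_circle) filter)
      = (INF e\<in>{0<..}. principal {(x, y). dist x y < e})"
    by (rule uniformity_l2_circle_def)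
  show "open U \<longleftrightarrow> (\<forall>x\<in>U. eventually (\<lambda>(x', y). x' = x \<longrightarrow> y \<in> U) uniformity)"
    for U :: "l2_circle set"
    by (rule open_l2_circle_def)
  show "f \<bullet> g = g \<bullet> f"
    by transfer (simp add: inner_commute)
  show "(f + g) \<bullet> h = f \<bullet> h + g \<bullet> h"
    by transfer (auto simp: l2_rel_def inner_add_left
        intro!: Bochner_Integration.integral_add integrable_inner_square_integrable)
  show "(a *\<^sub>R f) \<bullet> g = a * (f \<bullet> g)"
    by transfer simp
  show "0 \<le> f \<bullet> f"
    by transfer simp
  show "f \<bullet> f = 0 \<longleftrightarrow> f = 0"
    by transfer (auto simp: l2_rel_def square_integrable_zero integral_nonneg_eq_0_iff_AE
        integrable_inner_square_integrable)
qed

end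

text \<open>Multiplication by complex scalars; \<open>l2_circle\<close> is only a real vector space as a type.\<close>

lift_definition cscale :: "complex \<Rightarrow> l2_circle \<Rightarrow> l2_circle" is "\<lambda>c f z. c * f z"
  by (auto simp: l2_rel_def intro: square_integrable_mult)


section \<open>Fourier series and the orthogonal projector\<close>

text \<open>The character with value \<open>exp (i k \<theta>)\<close> at \<open>exp (i \<theta>)\<close>.\<close>

lemma powi_borel [measurable]: "(\<lambda>z::complex. z powi k) \<in> borel_measurable borel"
proof (cases "k \<ge> 0")
  case True
  then show ?thesis by (simp add: power_int_def)
next
  case False
  then show ?thesis by (simp add: power_int_def)
qed

lemma square_integrable_powi: "square_integrable (\<lambda>z. z powi k)"
  by (rule square_integrable_bounded[where B = 1])
    (use AE_circle_norm in \<open>auto simp: norm_power_int\<close>)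

lift_definition character :: "int \<Rightarrow> l2_circle" is "\<lambda>k z. z powi k"
  by (simp add: l2_rel_def square_integrable_powi)

lift_definition fourier_coeff :: "l2_circle \<Rightarrow> int \<Rightarrow> complex"
  is "\<lambda>f k. LINT z|circle_measure. f z * cnj (z powi k)"
proof -
  fix f g assume "l2_rel f g"
  then show "(\<lambda>k. LINT z|circle_measure. f z * cnj (z powi k))
      = (\<lambda>k. LINT z|circle_measure. g z * cnj (z powi k))"
    by (intro ext integral_cong_AE) (auto simp: l2_rel_def square_integrable_def)
qed

text \<open>The series converges unconditionally in the L2 norm.\<close>

definition szego_projector :: "l2_circle \<Rightarrow> l2_circle" where
  "szego_projector u = (\<Sum>\<^sub>\<infinity>k\<in>{0..}. cscale (fourier_coeff u k) (character k))"

text \<open>The nonlinearity \<open>|u|\<^sup>2 u\<close>. It is square-integrable for every \<open>u\<close> in \<open>H\<^sup>1\<^sup>/\<^sup>2\<close>, by the Sobolev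
  embedding into \<open>L\<^sup>6\<close>; the value 0 on all other elements of L2 is a dummy.\<close>

lift_definition cubic :: "l2_circle \<Rightarrow> l2_circle"
  is "\<lambda>u. let v = (\<lambda>z. complex_of_real ((cmod (u z))\<^sup>2) * u z) in if square_integrable v then v else (\<lambda>_. 0)"
proof -
  fix f g assume fg: "l2_rel f g"
  let ?v = "\<lambda>f z. complex_of_real ((cmod (f z))\<^sup>2) * f z"
  have [measurable]: "f \<in> borel_measurable borel" "g \<in> borel_measurable borel"
    using fg by (auto simp: l2_rel_def square_integrable_def)
  have eq: "AE z in circle_measure. ?v f z = ?v g z"
    using fg by (auto simp: l2_rel_def)
  have "integrable circle_measure (\<lambda>z. (cmod (?v f z))\<^sup>2)
      \<longleftrightarrow> integrable circle_measure (\<lambda>z. (cmod (?v g z))\<^sup>2)"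
    by (rule integrable_cong_AE) (use eq in auto)
  then have "square_integrable (?v f) \<longleftrightarrow> square_integrable (?v g)"
    by (simp add: square_integrable_def)
  with eq show "l2_rel (let v = ?v f in if square_integrable v then v else (\<lambda>_. 0))
      (let v = ?v g in if square_integrable v then v else (\<lambda>_. 0))"
    by (auto simp: l2_rel_def square_integrable_zero)
qed

section \<open>Injectivity of the Fourier transform\<close>

lemma integrable_mult_continuous:
  fixes g :: "complex \<Rightarrow> complex"
  assumes p: "continuous_on UNIV p" and g: "integrable circle_measure g"
  shows "integrable circle_measure (\<lambda>z. complex_of_real (p z) * g z)"
proof -
  have [measurable]: "p \<in> borel_measurable borel"
    by (rule borel_measurable_continuous_onI) fact
  have [measurable]: "g \<in> borel_measurable borel"
    using borel_measurable_integrable[OF g] by simp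
  have "compact (p ` sphere 0 1)"
    by (intro compact_continuous_image continuous_on_subset[OF p]) auto
  then have "bounded (p ` sphere 0 1)"
    by (rule compact_imp_bounded)
  then obtain B where B: "\<And>z. z \<in> sphere 0 1 \<Longrightarrow> \<bar>p z\<bar> \<le> B"
    unfolding bounded_iff by (metis imageI real_norm_def)
  have "integrable circle_measure (\<lambda>z. B * cmod (g z))"
    using g by auto
  then show ?thesis
  proof (rule Bochner_Integration.integrable_bound)
    show "AE z in circle_measure. cmod (complex_of_real (p z) * g z) \<le> norm (B * cmod (g z))"
      using AE_circle_norm
    proof (eventually_elim)
      case (elim z)
      then have "\<bar>p z\<bar> \<le> B" using B[of z] by simp
      then show ?case
        by (auto simp: norm_mult abs_mult intro!: mult_right_mono)
    qed
  qed measurable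
qed

definition annihilating :: "(complex \<Rightarrow> complex) \<Rightarrow> bool" where
  "annihilating g \<longleftrightarrow> integrable circle_measure g \<and>
     (\<forall>k::int. (LINT z|circle_measure. g z * z powi k) = 0)"

lemma integrable_mult_powi:
  fixes g :: "complex \<Rightarrow> complex"
  assumes g: "integrable circle_measure g"
  shows "integrable circle_measure (\<lambda>z. g z * z powi k)"
proof -
  have [measurable]: "g \<in> borel_measurable borel"
    using borel_measurable_integrable[OF g] by simp
  show ?thesis
    by (rule Bochner_Integration.integrable_bound[OF g])
      (use AE_circle_norm in \<open>auto simp: norm_mult norm_power_int\<close>)
qed

lemma cnj_eq_inverse_circle:
  assumes "cmod z = 1"
  shows "cnj z = inverse z"
proof -
  have "z * cnj z = 1"
    using assms complex_norm_square[of z] by simp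
  then show ?thesis
    by (rule inverse_unique[symmetric])
qed

lemma annihilating_polynomial:
  assumes "real_polynomial_function p" and "annihilating g"
  shows "annihilating (\<lambda>z. complex_of_real (p z) * g z)"
  using assms
proof (induction p arbitrary: g rule: real_polynomial_function.induct)
  case (linear p)
  then interpret p: bounded_linear p by simp
  have int: "integrable circle_measure g"
    using linear by (simp add: annihilating_def)
  then have [measurable]: "g \<in> borel_measurable borel"
    using borel_measurable_integrable[OF int] by simp
  have cont: "continuous_on UNIV p"
    by (simp add: linear.hyps linear_continuous_on)
  then have [measurable]: "p \<in> borel_measurable borel"
    by (rule borel_measurable_continuous_onI)
  define a where "a = Complex (p 1 / 2) (- p \<i> / 2)"
  define b where "b = Complex (p 1 / 2) (p \<i> / 2)"
  have p_eq: "complex_of_real (p z) = a * z + b * cnj z" for z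
  proof -
    have "p z = p (Re z *\<^sub>R 1 + Im z *\<^sub>R \<i>)"
      by (rule arg_cong[where f = p]) (simp add: complex_eq_iff)
    also have "\<dots> = Re z * p 1 + Im z * p \<i>"
      by (simp only: p.add p.scaleR) simp
    finally show ?thesis
      by (simp add: complex_eq_iff a_def b_def field_simps)
  qed
  have "(LINT z|circle_measure. complex_of_real (p z) * g z * z powi k) = 0" for k
  proof -
    have "(LINT z|circle_measure. complex_of_real (p z) * g z * z powi k)
        = (LINT z|circle_measure. a * (g z * z powi (k + 1)) + b * (g z * z powi (k - 1)))"
    proof (rule integral_cong_AE)
      show "AE z in circle_measure. complex_of_real (p z) * g z * z powi k
          = a * (g z * z powi (k + 1)) + b * (g z * z powi (k - 1))"
        using AE_circle_norm
      proof eventually_elim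
        case (elim z)
        then have "z \<noteq> 0" "cnj z = inverse z"
          using cnj_eq_inverse_circle by auto
        then show ?case
          by (simp add: p_eq power_int_add power_int_diff divide_inverse algebra_simps)
      qed
    qed measurable
    also have "\<dots> = 0"
      using linear.prems by (simp add: integrable_mult_powi[OF int] annihilating_def)
    finally show ?thesis .
  qed
  then show ?case
    using integrable_mult_continuous[OF cont int] by (simp add: annihilating_def)
next
  case (const c)
  then show ?case by (simp add: annihilating_def mult.assoc)
next
  case (add p q)
  have "integrable circle_measure (\<lambda>z. complex_of_real (p z) * g z)"
    "integrable circle_measure (\<lambda>z. complex_of_real (q z) * g z)"
    using add by (auto simp: annihilating_def)
  note * = this integrable_mult_powi[OF this(1)] integrable_mult_powi[OF this(2)]
  then show ?case
    using add.IH[OF add.prems] by (auto simp: annihilating_def algebra_simps)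
next
  case (mult p q)
  from mult.IH(1)[OF mult.IH(2)[OF mult.prems]] show ?case
    by (simp add: mult.assoc)
qed

lemma annihilating_continuous:
  assumes \<phi>: "continuous_on UNIV \<phi>" and g: "annihilating g"
  shows "(LINT z|circle_measure. complex_of_real (\<phi> z) * g z) = 0"
proof -
  define N where "N = (LINT z|circle_measure. cmod (g z))"
  have N: "N \<ge> 0" by (simp add: N_def)
  have int: "integrable circle_measure g"
    using g by (simp add: annihilating_def)
  have bound: "cmod (LINT z|circle_measure. complex_of_real (\<phi> z) * g z) \<le> e * N" if "e > 0" for e
  proof -
    obtain p where p: "real_polynomial_function p"
      and e: "\<And>z. z \<in> sphere 0 1 \<Longrightarrow> \<bar>\<phi> z - p z\<bar> < e"
      using Stone_Weierstrass_real_polynomial_function[of "sphere 0 1" \<phi> e] \<open>e > 0\<close> \<phi>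
      by (metis compact_sphere continuous_on_subset subset_UNIV)
    have p_cont: "continuous_on UNIV p"
      using p continuous_on_polymonial_function real_polynomial_function_eq by blast
    have "(LINT z|circle_measure. complex_of_real (p z) * g z * z powi 0) = 0"
      using annihilating_polynomial[OF p g] unfolding annihilating_def by blast
    then have p0: "(LINT z|circle_measure. complex_of_real (p z) * g z) = 0"
      by simp
    have "(LINT z|circle_measure. complex_of_real (\<phi> z) * g z)
        = (LINT z|circle_measure. complex_of_real (\<phi> z - p z) * g z)"
      using integrable_mult_continuous[OF \<phi> int] integrable_mult_continuous[OF p_cont int]
      by (simp add: left_diff_distrib p0)
    also have "cmod \<dots> \<le> (LINT z|circle_measure. cmod (complex_of_real (\<phi> z - p z) * g z))"
      by (rule integral_norm_bound)
    also have "\<dots> \<le> (LINT z|circle_measure. e * cmod (g z))"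
    proof (rule integral_mono_AE)
      show "integrable circle_measure (\<lambda>z. cmod (complex_of_real (\<phi> z - p z) * g z))"
        by (intro integrable_norm integrable_mult_continuous int continuous_intros \<phi> p_cont)
      show "integrable circle_measure (\<lambda>z. e * cmod (g z))"
        using int by auto
      show "AE z in circle_measure. cmod (complex_of_real (\<phi> z - p z) * g z) \<le> e * cmod (g z)"
        using AE_circle_norm
      proof eventually_elim
        case (elim z)
        then have "\<bar>\<phi> z - p z\<bar> \<le> e" using e[of z] by simp
        then show ?case
          unfolding norm_mult norm_of_real by (intro mult_right_mono) auto
      qed
    qed
    finally show ?thesis by (simp add: N_def)
  qed
  have "cmod (LINT z|circle_measure. complex_of_real (\<phi> z) * g z) \<le> 0"
  proof (rule field_le_epsilon)
    fix e :: real assume "e > 0"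
    have "cmod (LINT z|circle_measure. complex_of_real (\<phi> z) * g z) \<le> e / (N + 1) * N"
      using \<open>e > 0\<close> N by (intro bound) auto
    also have "\<dots> \<le> 0 + e"
      using \<open>e > 0\<close> N by (simp add: field_simps)
    finally show "cmod (LINT z|circle_measure. complex_of_real (\<phi> z) * g z) \<le> 0 + e" .
  qed
  then show ?thesis by simp
qed

lemma annihilating_closed:
  assumes C: "closed C" and g: "annihilating g"
  shows "(LINT z|circle_measure. indicator C z *\<^sub>R g z) = 0"
proof (cases "C = {}")
  case False
  have int: "integrable circle_measure g"
    using g by (simp add: annihilating_def)
  then have [measurable]: "g \<in> borel_measurable borel"
    using borel_measurable_integrable[OF int] by simp
  have [measurable]: "C \<in> sets borel" using C by auto
  define \<phi> where "\<phi> n z = max 0 (1 - real n * infdist z C)" for n and z :: complex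
  have \<phi>: "continuous_on UNIV (\<phi> n)" for n
    unfolding \<phi>_def by (intro continuous_intros)
  have [measurable]: "\<phi> n \<in> borel_measurable borel" for n
    by (rule borel_measurable_continuous_onI) (rule \<phi>)
  have lim: "(\<lambda>n. \<phi> n z) \<longlonglongrightarrow> indicator C z" for z
  proof (cases "z \<in> C")
    case True
    then show ?thesis by (simp add: \<phi>_def)
  next
    case False
    then have pos: "infdist z C > 0"
      using C \<open>C \<noteq> {}\<close> in_closed_iff_infdist_zero[of C z] infdist_nonneg[of z C] by force
    then obtain m where m: "1 < real m * infdist z C"
      using reals_Archimedean3 by blast
    have "\<phi> n z = 0" if "n \<ge> m" for n
    proof -
      have "real m * infdist z C \<le> real n * infdist z C"
        using that pos by (intro mult_right_mono) auto
      with m show ?thesis by (simp add: \<phi>_def)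
    qed
    then have "eventually (\<lambda>n. \<phi> n z = indicator C z) sequentially"
      using False by (auto simp: eventually_sequentially)
    then show ?thesis by (rule tendsto_eventually)
  qed
  have "(\<lambda>n. LINT z|circle_measure. complex_of_real (\<phi> n z) * g z)
      \<longlonglongrightarrow> (LINT z|circle_measure. indicator C z *\<^sub>R g z)"
  proof (rule integral_dominated_convergence[where w = "\<lambda>z. cmod (g z)"])
    show "integrable circle_measure (\<lambda>z. cmod (g z))" using int by simp
    show "AE z in circle_measure. (\<lambda>n. complex_of_real (\<phi> n z) * g z) \<longlonglongrightarrow> indicator C z *\<^sub>R g z"
      unfolding scaleR_conv_of_real by (intro AE_I2 tendsto_intros lim)
    show "AE z in circle_measure. cmod (complex_of_real (\<phi> n z) * g z) \<le> cmod (g z)" for n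
    proof (rule AE_I2)
      fix z
      have "\<bar>\<phi> n z\<bar> \<le> 1"
        by (auto simp: \<phi>_def infdist_nonneg)
      then show "cmod (complex_of_real (\<phi> n z) * g z) \<le> cmod (g z)"
        by (simp add: norm_mult mult_left_le_one_le)
    qed
  qed measurable
  then show ?thesis
    by (simp add: annihilating_continuous[OF \<phi> g] LIMSEQ_const_iff)
qed simp

lemma annihilating_imp_AE_zero:
  assumes g: "annihilating g"
  shows "AE z in circle_measure. g z = 0"
proof -
  have int: "integrable circle_measure g"
    using g by (simp add: annihilating_def)
  have "(LINT z|circle_measure. indicator A z *\<^sub>R g z) = 0" if "A \<in> sets circle_measure" for A
  proof -
    have A: "A \<in> sigma_sets UNIV (Collect closed)"
      using that by (simp add: borel_eq_closed)
    have meas: "A \<in> sets borel" if "A \<in> sigma_sets UNIV (Collect closed)" for A :: "complex set"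
      using that by (simp add: borel_eq_closed)
    have set_int: "integrable circle_measure (\<lambda>z. indicator A z *\<^sub>R g z)"
      if "A \<in> sets borel" for A
      using that int by (intro integrable_mult_indicator) auto
    have stable: "Int_stable (Collect (closed :: complex set \<Rightarrow> bool))"
      by (auto simp: Int_stable_def)
    have subset_Pow: "Collect (closed :: complex set \<Rightarrow> bool) \<subseteq> Pow UNIV"
      by simp
    show ?thesis
      using A
    proof (induction A rule: sigma_sets_induct_disjoint[OF stable subset_Pow, consumes 1, case_names basic empty compl union])
      case (basic A)
      then show ?case using annihilating_closed[OF _ g] by simp
    next
      case empty
      show ?case by simp
    next
      case (compl A)
      have "(LINT z|circle_measure. indicator (UNIV - A) z *\<^sub>R g z)
          = (LINT z|circle_measure. indicator UNIV z *\<^sub>R g z - indicator A z *\<^sub>R g z)"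
        by (intro Bochner_Integration.integral_cong) (auto simp: indicator_def)
      also have "\<dots> = 0"
        using set_int[OF meas[OF compl(1)]] int compl(2) annihilating_closed[OF closed_UNIV g]
        by simp
      finally show ?case .
    next
      case (union A)
      have mA: "A i \<in> sets circle_measure" for i
        using union(2) meas[of "A i"] by auto
      have "set_integrable circle_measure (\<Union>i. A i) g"
        unfolding set_integrable_def using mA by (intro set_int) auto
      then have "(LINT z:(\<Union>i. A i)|circle_measure. g z) = (\<Sum>i. LINT z:A i|circle_measure. g z)"
        using union(1) mA
        by (intro lebesgue_integral_countable_add) (auto simp: disjoint_family_on_def)
      then show ?case
        using union(3) by (simp add: set_lebesgue_integral_def)
    qed
  qed
  then show ?thesis
    by (intro circle_measure.density_zero int) (simp add: set_lebesgue_integral_def)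
qed

lemma fourier_coeff_eq_zero_imp:
  "(\<forall>k. fourier_coeff u k = 0) \<Longrightarrow> u = 0"
proof (transfer, goal_cases)
  case (1 f)
  then have f: "square_integrable f" by (simp add: l2_rel_def)
  have "(LINT z|circle_measure. f z * z powi k) = 0" for k
  proof -
    have "(LINT z|circle_measure. f z * z powi k)
        = (LINT z|circle_measure. f z * cnj (z powi (- k)))"
    proof (rule integral_cong_AE)
      show "AE z in circle_measure. f z * z powi k = f z * cnj (z powi (- k))"
        using AE_circle_norm
      proof eventually_elim
        case (elim z)
        then have "cnj z = inverse z"
          by (rule cnj_eq_inverse_circle)
        then show ?case
          by (simp add: power_int_minus power_int_inverse)
      qed
    qed (use f in \<open>auto simp: square_integrable_def\<close>)
    then show ?thesis using 1 by simp
  qed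
  moreover have "integrable circle_measure (\<lambda>z. f z * z powi 0)"
    by (intro integrable_mult_square_integrable f square_integrable_powi)
  ultimately have "annihilating f"
    by (simp add: annihilating_def)
  then show ?case
    using f by (simp add: l2_rel_def square_integrable_zero annihilating_imp_AE_zero)
qed

lemma fourier_coeff_add: "fourier_coeff (u + v) k = fourier_coeff u k + fourier_coeff v k"
proof (transfer fixing: k)
  fix f g assume "l2_rel f f" "l2_rel g g"
  then show "(LINT z|circle_measure. (f z + g z) * cnj (z powi k)) =
      (LINT z|circle_measure. f z * cnj (z powi k)) + (LINT z|circle_measure. g z * cnj (z powi k))"
    by (simp add: distrib_right l2_rel_def integrable_mult_square_integrable
        square_integrable_cnj square_integrable_powi del: complex_cnj_power_int)
qed

lemma fourier_coeff_diff: "fourier_coeff (u - v) k = fourier_coeff u k - fourier_coeff v k"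
  using fourier_coeff_add[of "u - v" v k] by simp

lemma fourier_coeff_zero [simp]: "fourier_coeff 0 k = 0"
  using fourier_coeff_diff[of 0 0 k] by simp

section \<open>Sobolev spaces\<close>

definition sobolev_term :: "real \<Rightarrow> l2_circle \<Rightarrow> int \<Rightarrow> real" where
  "sobolev_term s u k = (1 + (real_of_int k)\<^sup>2) powr s * (cmod (fourier_coeff u k))\<^sup>2"

text \<open>Only exponents \<open>s \<ge> 0\<close> are meant: then all distributions in \<open>H\<^sup>s\<close> are L2 functions. The norm
  of an element outside \<open>H\<^sup>s\<close> is a dummy 0, which is why membership requires summability.\<close>

definition sobolev_norm :: "real \<Rightarrow> l2_circle \<Rightarrow> real" where
  "sobolev_norm s u = sqrt (\<Sum>\<^sub>\<infinity>k\<in>UNIV. sobolev_term s u k)"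

definition Hs_plus_set :: "real \<Rightarrow> l2_circle set" where
  "Hs_plus_set s = {u. sobolev_term s u summable_on UNIV \<and> (\<forall>k<0. fourier_coeff u k = 0)}"

definition Hs_plus :: "real \<Rightarrow> l2_circle metric" where
  "Hs_plus s = metric (Hs_plus_set s, \<lambda>u v. sobolev_norm s (u - v))"

lemma sobolev_term_nonneg: "0 \<le> sobolev_term s u k"
  by (simp add: sobolev_term_def)

lemma sobolev_term_add_summable:
  assumes "sobolev_term s u summable_on UNIV" "sobolev_term s v summable_on UNIV"
  shows "sobolev_term s (u + v) summable_on UNIV"
proof (rule summable_on_comparison_test)
  show "(\<lambda>k. 2 * sobolev_term s u k + 2 * sobolev_term s v k) summable_on UNIV"
    using assms by (intro summable_on_add summable_on_cmult_right)
  have *: "(cmod (a + b))\<^sup>2 \<le> 2 * (cmod a)\<^sup>2 + 2 * (cmod b)\<^sup>2" for a b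
  proof -
    have "(cmod (a + b))\<^sup>2 \<le> (cmod a + cmod b)\<^sup>2"
      by (intro power_mono norm_triangle_ineq) auto
    also have "\<dots> \<le> 2 * (cmod a)\<^sup>2 + 2 * (cmod b)\<^sup>2"
      using sum_squares_bound[of "cmod a" "cmod b"] by (simp add: power2_sum)
    finally show ?thesis .
  qed
  show "sobolev_term s (u + v) k \<le> 2 * sobolev_term s u k + 2 * sobolev_term s v k" for k
    using mult_left_mono[OF *[of "fourier_coeff u k" "fourier_coeff v k"],
        of "(1 + (real_of_int k)\<^sup>2) powr s"]
    by (simp add: sobolev_term_def fourier_coeff_add algebra_simps)
qed (simp add: sobolev_term_nonneg)

lemma sobolev_term_minus: "sobolev_term s (u - v) = sobolev_term s (v - u)"
  by (simp add: sobolev_term_def fourier_coeff_diff norm_minus_commute fun_eq_iff)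

lemma sobolev_term_diff_summable:
  assumes "sobolev_term s u summable_on UNIV" "sobolev_term s v summable_on UNIV"
  shows "sobolev_term s (u - v) summable_on UNIV"
proof -
  have "sobolev_term s (0 - v) = sobolev_term s v"
    by (subst sobolev_term_minus) simp
  then show ?thesis
    using sobolev_term_add_summable[of s u "0 - v"] assms by simp
qed

lemma sobolev_norm_triangle:
  assumes u: "sobolev_term s u summable_on UNIV" and v: "sobolev_term s v summable_on UNIV"
  shows "sobolev_norm s (u + v) \<le> sobolev_norm s u + sobolev_norm s v"
proof -
  define w where "w k = sqrt ((1 + (real_of_int k)\<^sup>2) powr s)" for k
  have term_eq: "sobolev_term s u k = (w k * cmod (fourier_coeff u k))\<^sup>2" for u k
    by (simp add: sobolev_term_def w_def power_mult_distrib)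
  have part: "sqrt (\<Sum>k\<in>F. sobolev_term s u k) \<le> sobolev_norm s u"
    if "sobolev_term s u summable_on UNIV" "finite F" for u F
    unfolding sobolev_norm_def
    using that by (intro real_sqrt_le_mono finite_sum_le_infsum) (auto simp: sobolev_term_nonneg)
  have "(\<Sum>\<^sub>\<infinity>k\<in>UNIV. sobolev_term s (u + v) k) \<le> (sobolev_norm s u + sobolev_norm s v)\<^sup>2"
  proof (rule infsum_le_finite_sums)
    show "sobolev_term s (u + v) summable_on UNIV"
      by (rule sobolev_term_add_summable) fact+
    fix F :: "int set" assume F: "finite F"
    have "sqrt (\<Sum>k\<in>F. sobolev_term s (u + v) k)
        = L2_set (\<lambda>k. w k * cmod (fourier_coeff (u + v) k)) F"
      by (simp add: L2_set_def term_eq)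
    also have "\<dots> \<le> L2_set (\<lambda>k. w k * cmod (fourier_coeff u k) + w k * cmod (fourier_coeff v k)) F"
    proof (rule L2_set_mono)
      fix k
      have "w k * cmod (fourier_coeff (u + v) k)
          \<le> w k * (cmod (fourier_coeff u k) + cmod (fourier_coeff v k))"
        unfolding fourier_coeff_add
        by (intro mult_left_mono norm_triangle_ineq) (simp add: w_def)
      then show "w k * cmod (fourier_coeff (u + v) k)
          \<le> w k * cmod (fourier_coeff u k) + w k * cmod (fourier_coeff v k)"
        by (simp add: distrib_left)
    qed (simp add: w_def)
    also have "\<dots> \<le> L2_set (\<lambda>k. w k * cmod (fourier_coeff u k)) F
        + L2_set (\<lambda>k. w k * cmod (fourier_coeff v k)) F"
      by (rule L2_set_triangle_ineq)
    also have "\<dots> \<le> sobolev_norm s u + sobolev_norm s v"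
      using part[OF u F] part[OF v F] by (simp add: L2_set_def term_eq)
    finally show "(\<Sum>k\<in>F. sobolev_term s (u + v) k) \<le> (sobolev_norm s u + sobolev_norm s v)\<^sup>2"
      by (rule sqrt_le_D)
  qed
  then show ?thesis
    unfolding sobolev_norm_def[of s "u + v"]
    by (intro real_le_lsqrt) (auto simp: sobolev_norm_def infsum_nonneg sobolev_term_nonneg)
qed

lemma Metric_space_Hs_plus: "Metric_space (Hs_plus_set s) (\<lambda>u v. sobolev_norm s (u - v))"
proof
  fix u v w
  show "0 \<le> sobolev_norm s (u - v)"
    by (simp add: sobolev_norm_def infsum_nonneg sobolev_term_nonneg)
  show "sobolev_norm s (u - v) = sobolev_norm s (v - u)"
    by (simp add: sobolev_norm_def sobolev_term_minus[of s u v])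
  assume "u \<in> Hs_plus_set s" and "v \<in> Hs_plus_set s"
  then have uv: "sobolev_term s u summable_on UNIV" "sobolev_term s v summable_on UNIV"
    by (auto simp: Hs_plus_set_def)
  note sum = sobolev_term_diff_summable[OF this]
  show "sobolev_norm s (u - v) = 0 \<longleftrightarrow> u = v"
  proof
    assume "sobolev_norm s (u - v) = 0"
    then have "(\<Sum>\<^sub>\<infinity>k\<in>UNIV. sobolev_term s (u - v) k) \<le> 0"
      by (simp add: sobolev_norm_def)
    then have "sobolev_term s (u - v) k = 0" for k
      using sum by (intro nonneg_infsum_le_0D[where A = UNIV and f = "sobolev_term s (u - v)"])
        (auto simp: sobolev_term_nonneg)
    moreover have "(1 + (real_of_int k)\<^sup>2) powr s \<noteq> 0" for k
      by (simp add: add_nonneg_eq_0_iff)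
    ultimately have "fourier_coeff (u - v) k = 0" for k
      by (auto simp: sobolev_term_def)
    then have "u - v = 0"
      by (intro fourier_coeff_eq_zero_imp) blast
    then show "u = v" by simp
  next
    assume "u = v"
    then show "sobolev_norm s (u - v) = 0"
      by (simp add: sobolev_norm_def sobolev_term_def)
  qed
  assume "w \<in> Hs_plus_set s"
  then have "sobolev_term s w summable_on UNIV"
    by (auto simp: Hs_plus_set_def)
  with uv show "sobolev_norm s (u - w) \<le> sobolev_norm s (u - v) + sobolev_norm s (v - w)"
    using sobolev_norm_triangle[of s "u - v" "v - w"] sobolev_term_diff_summable
    by simp
qed

lemma mspace_Hs_plus [simp]: "mspace (Hs_plus s) = Hs_plus_set s"
  unfolding Hs_plus_def by (rule Metric_space.mspace_metric[OF Metric_space_Hs_plus])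

lemma mdist_Hs_plus [simp]: "mdist (Hs_plus s) = (\<lambda>u v. sobolev_norm s (u - v))"
  unfolding Hs_plus_def by (rule Metric_space.mdist_metric[OF Metric_space_Hs_plus])


section \<open>The cubic Szego equation\<close>

text \<open>The integral of an L2-valued curve from 0 to \<open>t\<close>, for \<open>t\<close> of either sign.\<close>

definition integral_from_0 :: "(real \<Rightarrow> l2_circle) \<Rightarrow> real \<Rightarrow> l2_circle" where
  "integral_from_0 F t = (if 0 \<le> t then integral {0..t} F else - integral {t..0} F)"

text \<open>Solutions of \<open>i \<partial>\<^sub>t u = \<Pi>(|u|\<^sup>2 u)\<close> in the sense of distributions, in integrated form. The
  integral is the norm (Riemann/Henstock) integral of L2-valued curves; for \<open>u\<close> continuous into
  \<open>H\<^sup>1\<^sup>/\<^sup>2\<close> the integrand is continuous into L2, so the integrability clause only excludes the dummy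
  value of \<open>integral\<close>.\<close>

definition szego_solution :: "(real \<Rightarrow> l2_circle) \<Rightarrow> bool" where
  "szego_solution u \<longleftrightarrow>
     continuous_map euclideanreal (mtopology_of (Hs_plus (1/2))) u \<and>
     (\<forall>a b. (\<lambda>t. szego_projector (cubic (u t))) integrable_on {a..b}) \<and>
     (\<forall>t. u t = u 0 - cscale \<i> (integral_from_0 (\<lambda>t. szego_projector (cubic (u t))) t))"

text \<open>The solution curve with initial value \<open>u0\<close>, meaningful once unique solvability is known.\<close>

definition szego_flow :: "l2_circle \<Rightarrow> real \<Rightarrow> l2_circle" where
  "szego_flow u0 = (THE u. szego_solution u \<and> u 0 = u0)"

end

theory Submission
  imports Defs
begin

text \<open>On the Fourier side all estimates are estimates for trilinear convolutions of the absolute values of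
  Fourier coefficients. Split the factors at frequency \<open>R\<close>: for \<open>u\<close> bounded in \<open>H\<^sup>1\<^sup>/\<^sup>2\<close> the low frequencies have
  Wiener norm of order \<open>sqrt (ln R)\<close>, and the high frequencies contribute a negative power of \<open>R\<close>. Choosing
  \<open>R\<close> as a power of the inverse of the L2 distance shows that \<open>u \<mapsto> \<Pi>(|u|\<^sup>2 u)\<close> is log-Lipschitz for the L2 norm on
  bounded subsets of \<open>H\<^sup>1\<^sup>/\<^sup>2\<close>. Osgood's inequality then yields uniqueness, stability in L2, and convergence of the
  Galerkin approximations, which conserve mass and momentum and hence an \<open>H\<^sup>1\<^sup>/\<^sup>2\<close> norm. The limit can only lose
  energy, and running the equation backwards shows that it loses none; this upgrades L2 convergence to
  convergence in \<open>H\<^sup>1\<^sup>/\<^sup>2\<close>, both in time and in the initial value. For \<open>s > 1/2\<close> a tame estimate and the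
  Brezis--Gallouet inequality bound the \<open>H\<^sup>s\<close> norm of the approximations on compact time intervals, so the
  nonlinearity is bounded in \<open>H\<^sup>s\<close> along the solution, which is therefore Lipschitz in time with values in \<open>H\<^sup>s\<close>.\<close>

section \<open>Completeness of L2 and Fourier series\<close>

text \<open>The space \<open>H^(1/2)\<close> just fails to embed into the bounded functions, so a
  Picard iteration in the energy space has no Lipschitz estimate to start from; differences are
  therefore measured in L2 only. The logarithmic loss is affordable because the term is cubic: one
  factor carries the difference in L2 and each of the two others costs \<open>sqrt (ln R)\<close>,
  which together make one power of \<open>ln R\<close>, the borderline case of Osgood's criterion.
  Conservation of an \<open>H^(1/2)\<close> norm rests on the absence of negative frequencies. For
  \<open>k \<ge> 0\<close> the weight \<open>jap k = 1 + \<bar>k\<bar>\<close> is affine in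
  \<open>k\<close>, so the weighted sum of squares is exactly mass plus momentum. All estimates use
  this weight; it is compared with the weight \<open>1 + k^2\<close> of the Sobolev norms only
  afterwards. The factor \<open>c\<close> in the evolution is \<open>- \<i>\<close> for the equation
  and \<open>\<i>\<close> for its time reversal, so that evolutions have to be constructed for
  nonnegative times only.\<close>

lemma l2_rel_refl [simp]: "l2_rel f f \<longleftrightarrow> square_integrable f"
  by (auto simp: l2_rel_def)

lemma l2_circle_cases:
  obtains f where "square_integrable f" "x = abs_l2_circle f"
  by (induction x rule: l2_circle.abs_induct) auto

lemma square_integrable_diff:
  assumes "square_integrable f" "square_integrable g"
  shows "square_integrable (\<lambda>z. f z - g z)"
  using square_integrable_add[OF assms(1) square_integrable_mult[OF assms(2), of "-1"]] by simp

lemma norm_abs_l2_circle: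
  assumes "square_integrable f"
  shows "(norm (abs_l2_circle f))\<^sup>2 = (LINT z|circle_measure. (cmod (f z))\<^sup>2)"
  using assms inner_l2_circle.abs_eq[of f f]
  by (simp add: power2_norm_eq_inner eq_onp_def)

lemma abs_l2_circle_diff:
  assumes "square_integrable f" "square_integrable g"
  shows "abs_l2_circle f - abs_l2_circle g = abs_l2_circle (\<lambda>z. f z - g z)"
proof -
  have g': "square_integrable (\<lambda>z. - g z)"
    using square_integrable_mult[OF assms(2), of "-1"] by simp
  have "- abs_l2_circle g = abs_l2_circle (\<lambda>z. - g z)"
    using uminus_l2_circle.abs_eq[of g] assms by (simp add: eq_onp_def)
  moreover have "abs_l2_circle f + abs_l2_circle (\<lambda>z. - g z) = abs_l2_circle (\<lambda>z. f z + - g z)"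
    using plus_l2_circle.abs_eq[of f "\<lambda>z. - g z"] assms g' by (simp add: eq_onp_def)
  ultimately show ?thesis by (simp add: minus_l2_circle_def)
qed

lemma norm_abs_l2_circle_diff:
  assumes "square_integrable f" "square_integrable g"
  shows "(norm (abs_l2_circle f - abs_l2_circle g))\<^sup>2
    = (LINT z|circle_measure. (cmod (f z - g z))\<^sup>2)"
  unfolding abs_l2_circle_diff[OF assms]
  by (rule norm_abs_l2_circle[OF square_integrable_diff[OF assms]])

text \<open>Convergence in L2 is L1 convergence of the squared distance to 0, which has an almost
  everywhere convergent subsequence. This is what identifies an abstract L2 limit with a pointwise
  one.\<close>

lemma l2_circle_AE_subseq:
  assumes F: "\<And>n. square_integrable (F n)" and f: "square_integrable f"
    and lim: "(\<lambda>n. abs_l2_circle (F n)) \<longlonglongrightarrow> abs_l2_circle f"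
  shows "\<exists>r::nat \<Rightarrow> nat. strict_mono r \<and> (AE z in circle_measure. (\<lambda>n. F (r n) z) \<longlonglongrightarrow> f z)"
proof -
  have "\<exists>r::nat \<Rightarrow> nat. strict_mono r \<and>
      (AE z in circle_measure. (\<lambda>n. (cmod (F (r n) z - f z))\<^sup>2) \<longlonglongrightarrow> 0)"
  proof (rule tendsto_L1_AE_subseq)
    show "integrable circle_measure (\<lambda>z. (cmod (F n z - f z))\<^sup>2)" for n
      using square_integrable_diff[OF F f] by (simp add: square_integrable_def)
    have "(\<lambda>n. (norm (abs_l2_circle (F n) - abs_l2_circle f))\<^sup>2) \<longlonglongrightarrow> 0"
      using tendsto_power[OF tendsto_norm_zero[OF LIM_zero[OF lim]], of 2] by simp
    then show "(\<lambda>n. LINT z|circle_measure. norm ((cmod (F n z - f z))\<^sup>2)) \<longlonglongrightarrow> 0"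
      by (simp add: norm_abs_l2_circle_diff[OF F f])
  qed
  moreover have "(\<lambda>n. F (r n) z) \<longlonglongrightarrow> f z" if "(\<lambda>n. (cmod (F (r n) z - f z))\<^sup>2) \<longlonglongrightarrow> 0" for r z
  proof -
    have "(\<lambda>n. sqrt ((cmod (F (r n) z - f z))\<^sup>2)) \<longlonglongrightarrow> sqrt 0"
      using that by (rule tendsto_real_sqrt)
    then show ?thesis
      by (simp add: tendsto_norm_zero_iff LIM_zero_iff)
  qed
  ultimately show ?thesis
    by (metis (mono_tags, lifting) eventually_mono)
qed

text \<open>Pointwise \<open>d n z \<le> (1/2)^n + 2^n * (d n z)^2\<close>, so the bound on the
  squares gives summable L1 bounds without Hoelder's inequality. The sum of all increments then has
  finite integral, is finite almost everywhere, and the telescoping series converges absolutely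
  there.\<close>

lemma rapid_Cauchy_AE_convergent:
  assumes F: "\<And>n. square_integrable (F n)"
    and bound: "\<And>n. (LINT z|circle_measure. (cmod (F (Suc n) z - F n z))\<^sup>2) \<le> ((1/2)^n)\<^sup>2"
  shows "AE z in circle_measure. convergent (\<lambda>n. F n z)"
proof -
  define d where "d n z = cmod (F (Suc n) z - F n z)" for n z
  have [measurable]: "F n \<in> borel_measurable borel" for n
    using F by (simp add: square_integrable_def)
  have [measurable]: "d n \<in> borel_measurable borel" for n
    unfolding d_def by measurable
  have d0: "0 \<le> d n z" for n z
    by (simp add: d_def)
  have int2: "integrable circle_measure (\<lambda>z. (d n z)\<^sup>2)" for n
    using square_integrable_diff[OF F F, of "Suc n" n] by (simp add: d_def square_integrable_def)
  have pw: "d n z \<le> (1/2)^n + 2^n * (d n z)\<^sup>2" for n z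
  proof (cases "d n z \<le> (1/2)^n")
    case True
    then show ?thesis by (rule order_trans) simp
  next
    case False
    then have "1 \<le> 2^n * d n z"
      by (simp add: field_simps)
    then have "1 * d n z \<le> (2^n * d n z) * d n z"
      by (intro mult_right_mono d0)
    also have "\<dots> = 2^n * (d n z)\<^sup>2"
      by (simp add: power2_eq_square)
    finally show ?thesis
      by (simp add: add_increasing)
  qed
  have "(\<integral>\<^sup>+z. ennreal (d n z) \<partial>circle_measure) \<le> ennreal (2 * (1/2)^n)" for n
  proof -
    have "(\<integral>\<^sup>+z. ennreal (d n z) \<partial>circle_measure)
        \<le> (\<integral>\<^sup>+z. ennreal ((1/2)^n + 2^n * (d n z)\<^sup>2) \<partial>circle_measure)"
      by (intro nn_integral_mono ennreal_leI pw)
    also have "\<dots> = ennreal (LINT z|circle_measure. (1/2)^n + 2^n * (d n z)\<^sup>2)"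
      using int2 by (intro nn_integral_eq_integral) auto
    also have "(LINT z|circle_measure. (1/2)^n + 2^n * (d n z)\<^sup>2)
        = (1/2)^n + 2^n * (LINT z|circle_measure. (d n z)\<^sup>2)"
      using int2 by (simp add: circle_measure.prob_space[simplified])
    also have "\<dots> \<le> (1/2)^n + 2^n * ((1/2)^n)\<^sup>2"
      using bound[of n] by (simp add: d_def)
    also have "\<dots> = 2 * (1/2)^n"
      by (simp add: power2_eq_square power_mult_distrib[symmetric] flip: mult.assoc)
    finally show ?thesis by (simp add: ennreal_leI)
  qed
  then have "(\<Sum>n. \<integral>\<^sup>+z. ennreal (d n z) \<partial>circle_measure) \<le> (\<Sum>n. ennreal (2 * (1/2)^n))"
    by (intro suminf_le) auto
  also have "\<dots> < \<infinity>"
    by (subst suminf_ennreal2) (auto intro!: summable_mult summable_geometric)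
  finally have "(\<integral>\<^sup>+z. (\<Sum>n. ennreal (d n z)) \<partial>circle_measure) \<noteq> \<infinity>"
    by (subst nn_integral_suminf) auto
  then have "AE z in circle_measure. (\<Sum>n. ennreal (d n z)) \<noteq> \<infinity>"
    by (intro nn_integral_PInf_AE) auto
  then show ?thesis
  proof eventually_elim
    case (elim z)
    then have "summable (\<lambda>n. d n z)"
      using d0 by (intro summable_suminf_not_top) auto
    then have "summable (\<lambda>n. F (Suc n) z - F n z)"
      unfolding d_def by (rule summable_norm_cancel)
    then have "convergent (\<lambda>n. \<Sum>i<n. F (Suc i) z - F i z)"
      by (simp add: summable_iff_convergent)
    then have "convergent (\<lambda>n. F n z - F 0 z)"
      by (simp only: sum_lessThan_telescope[of "\<lambda>n. F n z"])
    then have "convergent (\<lambda>n. F n z - F 0 z + F 0 z)"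
      by (intro convergent_add convergent_const)
    then show ?case by simp
  qed
qed

text \<open>A subsequence with increments below \<open>(1/2)^n\<close> converges almost everywhere;
  Fatou's lemma shows that its pointwise limit is square integrable and L2-close to the late
  members. Completeness is what makes continuous L2-valued curves integrable and Picard's fixed
  point available.\<close>

instance l2_circle :: banach
proof
  fix X :: "nat \<Rightarrow> l2_circle"
  assume X: "Cauchy X"
  obtain r :: "nat \<Rightarrow> nat" where r: "strict_mono r"
    and rapid: "\<And>n. norm (X (r (Suc n)) - X (r n)) < (1/2)^n"
  proof -
    have "\<exists>r::nat \<Rightarrow> nat. \<forall>n. (r n < r (Suc n)) \<and> (\<forall>i\<ge>r n. \<forall>j\<ge>r n. norm (X i - X j) < (1/2)^n)"
    proof -
      have ex: "\<exists>m>k. \<forall>i\<ge>m. \<forall>j\<ge>m. norm (X i - X j) < (1/2)^n" for k n :: nat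
      proof -
        obtain M where "\<forall>i\<ge>M. \<forall>j\<ge>M. norm (X i - X j) < (1/2)^n"
          using CauchyD[OF X, of "(1/2)^n"] by auto
        then show ?thesis by (intro exI[of _ "max (Suc k) M"]) auto
      qed
      define P where "P n m \<longleftrightarrow> (\<forall>i\<ge>m. \<forall>j\<ge>m. norm (X i - X j) < (1/2)^n)" for n m :: nat
      have P: "\<exists>m>k. P n m" for k n
        using ex by (simp add: P_def)
      have "\<exists>f. \<forall>n. P n (f n) \<and> f n < f (Suc n)"
        by (rule dependent_nat_choice) (use P in blast)+
      then show ?thesis by (auto simp: P_def)
    qed
    then obtain r :: "nat \<Rightarrow> nat" where r: "\<And>n. r n < r (Suc n)"
      and c: "\<And>n i j. i \<ge> r n \<Longrightarrow> j \<ge> r n \<Longrightarrow> norm (X i - X j) < (1/2)^n"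
      by blast
    show ?thesis
    proof
      show "strict_mono r" using r by (simp add: strict_mono_Suc_iff)
      show "norm (X (r (Suc n)) - X (r n)) < (1/2)^n" for n
        using r[of n] by (intro c) auto
    qed
  qed
  have "\<exists>F. \<forall>n. square_integrable (F n) \<and> X (r n) = abs_l2_circle (F n)"
    by (intro choice) (metis l2_circle_cases)
  then obtain F where F: "\<And>n. square_integrable (F n)" and XF: "\<And>n. X (r n) = abs_l2_circle (F n)"
    by blast
  have [measurable]: "F n \<in> borel_measurable borel" for n
    using F by (simp add: square_integrable_def)
  have normF: "(LINT z|circle_measure. (cmod (F m z - F n z))\<^sup>2) = (norm (X (r m) - X (r n)))\<^sup>2" for m n
    by (simp add: XF norm_abs_l2_circle_diff F)
  have conv: "AE z in circle_measure. convergent (\<lambda>n. F n z)"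
    by (rule rapid_Cauchy_AE_convergent[OF F])
      (auto simp: normF intro!: power_mono less_imp_le[OF rapid])
  define f where "f z = lim (\<lambda>n. F n z)" for z
  have [measurable]: "f \<in> borel_measurable borel"
    unfolding f_def by measurable
  have close: "\<exists>N. \<forall>n\<ge>N. square_integrable f \<and> norm (abs_l2_circle f - X (r n)) \<le> e"
    if "e > 0" for e
  proof -
    obtain N where N: "\<And>m n. m \<ge> N \<Longrightarrow> n \<ge> N \<Longrightarrow> norm (X m - X n) < e"
      using CauchyD[OF X \<open>e > 0\<close>] by auto
    have "square_integrable f \<and> norm (abs_l2_circle f - X (r n)) \<le> e" if n: "n \<ge> N" for n
    proof -
      have "(\<integral>\<^sup>+z. ennreal ((cmod (f z - F n z))\<^sup>2) \<partial>circle_measure)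
          = (\<integral>\<^sup>+z. liminf (\<lambda>m. ennreal ((cmod (F m z - F n z))\<^sup>2)) \<partial>circle_measure)"
      proof (rule nn_integral_cong_AE, use conv in eventually_elim)
        case (elim z)
        then have "(\<lambda>m. F m z) \<longlonglongrightarrow> f z"
          by (simp add: f_def convergent_LIMSEQ_iff)
        then have "(\<lambda>m. ennreal ((cmod (F m z - F n z))\<^sup>2)) \<longlonglongrightarrow> ennreal ((cmod (f z - F n z))\<^sup>2)"
          by (intro tendsto_intros tendsto_ennrealI)
        then show ?case
          by (intro lim_imp_Liminf[symmetric]) auto
      qed
      also have "\<dots> \<le> liminf (\<lambda>m. \<integral>\<^sup>+z. ennreal ((cmod (F m z - F n z))\<^sup>2) \<partial>circle_measure)"
        by (rule nn_integral_liminf) measurable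
      also have "\<dots> \<le> limsup (\<lambda>m. \<integral>\<^sup>+z. ennreal ((cmod (F m z - F n z))\<^sup>2) \<partial>circle_measure)"
        by (rule Liminf_le_Limsup) simp
      also have "\<dots> \<le> ennreal (e\<^sup>2)"
      proof (rule Limsup_bounded)
        show "\<forall>\<^sub>F m in sequentially.
            (\<integral>\<^sup>+z. ennreal ((cmod (F m z - F n z))\<^sup>2) \<partial>circle_measure) \<le> ennreal (e\<^sup>2)"
          using eventually_ge_at_top[of N]
        proof eventually_elim
          case (elim m)
          have "(\<integral>\<^sup>+z. ennreal ((cmod (F m z - F n z))\<^sup>2) \<partial>circle_measure)
              = ennreal (LINT z|circle_measure. (cmod (F m z - F n z))\<^sup>2)"
            using square_integrable_diff[OF F F, of m n]
            by (intro nn_integral_eq_integral) (auto simp: square_integrable_def)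
          also have "\<dots> \<le> ennreal (e\<^sup>2)"
            unfolding normF using elim n seq_suble[OF r, of m] seq_suble[OF r, of n]
            by (intro ennreal_leI power_mono less_imp_le[OF N]) auto
          finally show ?case .
        qed
      qed
      finally have le: "(\<integral>\<^sup>+z. ennreal ((cmod (f z - F n z))\<^sup>2) \<partial>circle_measure) \<le> ennreal (e\<^sup>2)" .
      then have "integrable circle_measure (\<lambda>z. (cmod (f z - F n z))\<^sup>2)"
        by (intro integrableI_bounded) (auto simp: order_le_less_trans)
      then have df: "square_integrable (\<lambda>z. f z - F n z)"
        by (simp add: square_integrable_def)
      then have f: "square_integrable f"
        using square_integrable_add[OF df F[of n]] by simp
      have "(norm (abs_l2_circle f - X (r n)))\<^sup>2 \<le> e\<^sup>2"
        unfolding XF norm_abs_l2_circle_diff[OF f F]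
        using le df by (subst (asm) nn_integral_eq_integral) (auto simp: square_integrable_def)
      then show ?thesis
        using f \<open>e > 0\<close> by (auto intro: power2_le_imp_le)
    qed
    then show ?thesis by blast
  qed
  have "(X \<circ> r) \<longlonglongrightarrow> abs_l2_circle f"
  proof (rule LIMSEQ_I)
    fix e :: real assume "e > 0"
    then obtain N where "\<forall>n\<ge>N. norm (abs_l2_circle f - X (r n)) \<le> e / 2"
      using close[of "e/2"] by auto
    then show "\<exists>no. \<forall>n\<ge>no. norm ((X \<circ> r) n - abs_l2_circle f) < e"
      using \<open>e > 0\<close> by (intro exI[of _ N]) (force simp: norm_minus_commute)
  qed
  then show "convergent X"
    using Cauchy_converges_subseq[OF X r] by (auto simp: convergent_def)
qed

section \<open>Complex scalars and the coefficient functionals on L2\<close>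

lemma fourier_coeff_eqI: "(\<And>k. fourier_coeff u k = fourier_coeff v k) \<Longrightarrow> u = v"
  using fourier_coeff_eq_zero_imp[of "u - v"] by (simp add: fourier_coeff_diff)

lemma fourier_coeff_cscale [simp]: "fourier_coeff (cscale c u) k = c * fourier_coeff u k"
  by transfer (simp add: mult.assoc)

text \<open>As the Fourier transform is injective, the laws of complex scalars reduce to identities
  between coefficients; this avoids arguments on representatives.\<close>

lemma cscale_add_left: "cscale (a + b) u = cscale a u + cscale b u"
  by (rule fourier_coeff_eqI) (simp add: fourier_coeff_add algebra_simps)

lemma cscale_add_right: "cscale c (u + v) = cscale c u + cscale c v"
  by (rule fourier_coeff_eqI) (simp add: fourier_coeff_add algebra_simps)

lemma cscale_diff_right: "cscale c (u - v) = cscale c u - cscale c v"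
  by (rule fourier_coeff_eqI) (simp add: fourier_coeff_diff algebra_simps)

lemma cscale_cscale [simp]: "cscale a (cscale b u) = cscale (a * b) u"
  by (rule fourier_coeff_eqI) (simp add: algebra_simps)

lemma cscale_0_left [simp]: "cscale 0 u = 0"
  by (rule fourier_coeff_eqI) simp

lemma cscale_0_right [simp]: "cscale c 0 = 0"
  by (rule fourier_coeff_eqI) simp

lemma cscale_1 [simp]: "cscale 1 u = u"
  by (rule fourier_coeff_eqI) simp

lemma cscale_of_real: "cscale (complex_of_real r) u = r *\<^sub>R u"
  by transfer (auto simp: scaleR_conv_of_real intro: square_integrable_mult)

lemma fourier_coeff_scaleR [simp]: "fourier_coeff (r *\<^sub>R u) k = r *\<^sub>R fourier_coeff u k"
  by (simp flip: cscale_of_real add: scaleR_conv_of_real)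

lemma cscale_minus: "cscale (- c) u = - cscale c u"
  using cscale_add_left[of c "- c" u] by (simp add: add_eq_0_iff)

lemma fourier_coeff_minus [simp]: "fourier_coeff (- u) k = - fourier_coeff u k"
  using fourier_coeff_diff[of 0 u k] by simp

lemma fourier_coeff_sum: "fourier_coeff (\<Sum>i\<in>I. f i) k = (\<Sum>i\<in>I. fourier_coeff (f i) k)"
  by (induction I rule: infinite_finite_induct) (auto simp: fourier_coeff_add)

lemma inner_cscale_cscale: "cscale a u \<bullet> cscale b v = cscale (cnj b * a) u \<bullet> v"
proof (transfer, goal_cases)
  case (1 a f b g)
  have "(a * f z) \<bullet> (b * g z) = (cnj b * a * f z) \<bullet> g z" for z
    by (simp add: inner_complex_def algebra_simps)
  then show ?case by (simp only:)
qed

lemma norm_cscale [simp]: "norm (cscale c u) = cmod c * norm u"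
proof -
  have "cscale c u \<bullet> cscale c u = (cmod c)\<^sup>2 * (u \<bullet> u)"
    using inner_cscale_cscale[of c u c u] cscale_of_real[of "(cmod c)\<^sup>2" u]
    by (simp add: complex_norm_square[symmetric] mult.commute)
  then show ?thesis
    by (simp add: norm_eq_sqrt_inner real_sqrt_mult)
qed

lemma bounded_linear_cscale: "bounded_linear (cscale c)"
proof (rule bounded_linear_intro)
  show "cscale c (r *\<^sub>R u) = r *\<^sub>R cscale c u" for r u
    by (simp flip: cscale_of_real add: mult.commute)
  show "norm (cscale c u) \<le> norm u * cmod c" for u
    by (simp add: mult.commute)
qed (rule cscale_add_right)

lemma Re_fourier_coeff: "Re (fourier_coeff u k) = u \<bullet> character k"
proof (transfer, goal_cases)
  case (1 f k)
  have int: "integrable circle_measure (\<lambda>z. f z * cnj (z powi k))"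
    using 1 square_integrable_powi
    by (intro integrable_mult_square_integrable square_integrable_cnj) (auto simp: l2_rel_def)
  have "Re (LINT z|circle_measure. f z * cnj (z powi k))
      = (LINT z|circle_measure. Re (f z * cnj (z powi k)))"
    using int by (rule integral_Re[symmetric])
  also have "\<dots> = (LINT z|circle_measure. f z \<bullet> (z powi k))"
  proof -
    have "Re (a * cnj b) = a \<bullet> b" for a b
      by (simp add: inner_complex_def)
    then show ?thesis by (simp only:)
  qed
  finally show ?case .
qed

lemma Im_fourier_coeff: "Im (fourier_coeff u k) = u \<bullet> cscale \<i> (character k)"
proof -
  have "Im (fourier_coeff u k) = Re (fourier_coeff (cscale (- \<i>) u) k)"
    by simp
  also have "\<dots> = u \<bullet> cscale \<i> (character k)"
    unfolding Re_fourier_coeff using inner_cscale_cscale[of 1 u \<i> "character k"] by simp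
  finally show ?thesis .
qed

text \<open>The type carries a real inner product only, so the complex functional is assembled from
  two real ones: pairing with \<open>character k\<close> gives the real part, with
  \<open>cscale \<i> (character k)\<close> the imaginary part.\<close>

lemma bounded_linear_fourier_coeff: "bounded_linear (\<lambda>u. fourier_coeff u k)"
proof -
  have "bounded_linear (\<lambda>u. complex_of_real (u \<bullet> character k)
      + complex_of_real (u \<bullet> cscale \<i> (character k)) * \<i>)"
    by (intro bounded_linear_add bounded_linear_mult_const
        bounded_linear_compose[OF bounded_linear_of_real bounded_linear_inner_left])
  also have "(\<lambda>u. complex_of_real (u \<bullet> character k)
      + complex_of_real (u \<bullet> cscale \<i> (character k)) * \<i>) = (\<lambda>u. fourier_coeff u k)"
    by (rule ext) (simp add: complex_eq_iff Re_fourier_coeff Im_fourier_coeff)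
  finally show ?thesis .
qed

lemmas tendsto_fourier_coeff = bounded_linear.tendsto[OF bounded_linear_fourier_coeff]

section \<open>Orthonormality of the characters, Bessel's inequality, Riesz-Fischer and the
  projector\<close>

lemma integral_powi_circle:
  assumes "n \<noteq> 0"
  shows "(LINT z|circle_measure. z powi n) = 0"
proof -
  have cis_powi: "cis x powi n = cis (real_of_int n * x)" for x
  proof (cases n rule: int_cases2)
    case (nonneg m)
    then show ?thesis by (simp only: power_int_of_nat Complex.DeMoivre of_int_of_nat_eq)
  next
    case (nonpos m)
    then have "cis x powi n = inverse (cis (real m * x))"
      by (simp only: power_int_minus power_int_of_nat Complex.DeMoivre)
    also have "\<dots> = cis (real_of_int n * x)"
      unfolding cis_inverse nonpos by (rule arg_cong[where f = cis]) simp
    finally show ?thesis .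
  qed
  \<comment> \<open>The antiderivative needs \<open>n \<noteq> 0\<close>; by periodicity it takes
    the same value at 0 and at \<open>2 * pi\<close>, which makes the integral vanish.\<close>
  have deriv: "((\<lambda>x. cis (real_of_int n * x) / (\<i> * of_int n)) has_vector_derivative cis (real_of_int n * x))
      (at x within S)" for x S
  proof -
    have "((\<lambda>z. exp (\<i> * of_int n * z) / (\<i> * of_int n)) has_field_derivative exp (\<i> * of_int n * z)) (at z)"
      for z
      using assms by (auto intro!: derivative_eq_intros)
    from has_vector_derivative_real_field[OF this[of "of_real x"]] show ?thesis
      by (simp add: cis_conv_exp mult.assoc)
  qed
  have "(LINT z|circle_measure. z powi n)
      = (LINT x|uniform_measure lborel {0..2*pi}. cis x powi n)"
    unfolding circle_measure_def by (subst integral_distr) auto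
  also have "\<dots> = (LINT x|lborel. (indicator {0..2*pi} x / (2 * pi)) *\<^sub>R cis (real_of_int n * x))"
  proof -
    have "uniform_measure lborel {0..2*pi}
        = density lborel (\<lambda>x. ennreal (indicator {0..2*pi} x / (2 * pi)))"
    proof -
      have "indicator {0..2*pi} x / emeasure lborel {0..2*pi} = ennreal (indicator {0..2*pi} x / (2 * pi))" for x
      proof -
        have "(1::ennreal) / ennreal (2 * pi) = ennreal (1 / (2 * pi))"
          using divide_ennreal[of 1 "2 * pi"] by simp
        then show ?thesis
          by (cases "x \<in> {0..2*pi}") simp_all
      qed
      then show ?thesis
        unfolding uniform_measure_def by (simp only:)
    qed
    then have "(LINT x|uniform_measure lborel {0..2*pi}. cis x powi n)
        = (LINT x|density lborel (\<lambda>x. ennreal (indicator {0..2*pi} x / (2 * pi))). cis (real_of_int n * x))"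
      by (simp only: cis_powi)
    also have "\<dots> = (LINT x|lborel. (indicator {0..2*pi} x / (2 * pi)) *\<^sub>R cis (real_of_int n * x))"
    proof (rule integral_density)
      show "(\<lambda>x. cis (real_of_int n * x)) \<in> borel_measurable lborel"
        by measurable
      show "(\<lambda>x::real. indicator {0..2*pi} x / (2 * pi)) \<in> borel_measurable lborel"
        by measurable
      show "AE x in lborel. 0 \<le> (indicator {0..2*pi} x / (2 * pi) :: real)"
        by (rule AE_I2) (simp split: split_indicator)
    qed
    finally show ?thesis .
  qed
  also have "\<dots> = (LINT x|lborel. (1 / (2 * pi)) *\<^sub>R (indicator {0..2*pi} x *\<^sub>R cis (real_of_int n * x)))"
    by (simp only: scaleR_scaleR times_divide_eq_left mult_1_left)
  also have "\<dots> = (1 / (2 * pi)) *\<^sub>R (LINT x|lborel. indicator {0..2*pi} x *\<^sub>R cis (real_of_int n * x))"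
    by (rule integral_scaleR_right)
  also have "(LINT x|lborel. indicator {0..2*pi} x *\<^sub>R cis (real_of_int n * x))
      = cis (real_of_int n * (2 * pi)) / (\<i> * of_int n) - cis (real_of_int n * 0) / (\<i> * of_int n)"
    by (intro integral_FTC_Icc deriv continuous_intros) auto
  also have "\<dots> = 0"
    using cis_multiple_2pi[of "of_int n"] by (simp add: mult.commute)
  finally show ?thesis by simp
qed

lemma fourier_coeff_character [simp]: "fourier_coeff (character j) k = (if j = k then 1 else 0)"
proof transfer
  fix j k :: int
  have "(LINT z|circle_measure. z powi j * cnj (z powi k)) = (LINT z|circle_measure. z powi (j - k))"
  proof (rule integral_cong_AE)
    show "AE z in circle_measure. z powi j * cnj (z powi k) = z powi (j - k)"
      using AE_circle_norm
    proof eventually_elim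
      case (elim z)
      then have "cnj z = inverse z" "z \<noteq> 0"
        using cnj_eq_inverse_circle by auto
      then show ?case
        by (simp add: power_int_diff power_int_inverse divide_inverse)
    qed
  qed measurable
  also have "\<dots> = (if j = k then 1 else 0)"
    by (auto simp: integral_powi_circle circle_measure.prob_space[simplified])
  finally show "(LINT z|circle_measure. z powi j * cnj (z powi k)) = (if j = k then 1 else 0)" .
qed

definition trig :: "int set \<Rightarrow> (int \<Rightarrow> complex) \<Rightarrow> l2_circle" where
  "trig S a = (\<Sum>k\<in>S. cscale (a k) (character k))"

lemma fourier_coeff_trig [simp]:
  assumes "finite S"
  shows "fourier_coeff (trig S a) k = (if k \<in> S then a k else 0)"
proof -
  have "fourier_coeff (trig S a) k = (\<Sum>j\<in>S. if j = k then a j else 0)"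
    by (auto simp: trig_def fourier_coeff_sum intro!: sum.cong)
  then show ?thesis using assms by simp
qed

lemma inner_trig_right: "u \<bullet> trig S a = (\<Sum>k\<in>S. Re (cnj (a k) * fourier_coeff u k))"
proof -
  have "u \<bullet> cscale c (character k) = Re (cnj c * fourier_coeff u k)" for c k
    using inner_cscale_cscale[of 1 u c "character k"] by (simp flip: Re_fourier_coeff)
  then show ?thesis
    by (simp add: trig_def inner_sum_right)
qed

lemma norm_trig:
  assumes "finite S"
  shows "(norm (trig S a))\<^sup>2 = (\<Sum>k\<in>S. (cmod (a k))\<^sup>2)"
proof -
  have "Re (cnj z * z) = (cmod z)\<^sup>2" for z
    by (simp add: cmod_power2) (simp add: power2_eq_square)
  then show ?thesis
    unfolding power2_norm_eq_inner inner_trig_right using assms by (simp add: fourier_coeff_trig)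
qed

text \<open>\<open>?p\<close> is the orthogonal projection of \<open>u\<close> to the span of the
  characters in \<open>S\<close>: since \<open>u \<bullet> ?p = ?p \<bullet> ?p\<close>, Pythagoras
  bounds the norm of \<open>?p\<close> by that of \<open>u\<close>.\<close>

lemma Bessel:
  assumes "finite S"
  shows "(\<Sum>k\<in>S. (cmod (fourier_coeff u k))\<^sup>2) \<le> (norm u)\<^sup>2"
proof -
  let ?p = "trig S (fourier_coeff u)"
  have "u \<bullet> ?p = ?p \<bullet> ?p"
    unfolding inner_trig_right using assms by simp
  then have "(norm (u - ?p))\<^sup>2 = (norm u)\<^sup>2 - (norm ?p)\<^sup>2"
    by (simp add: power2_norm_eq_inner algebra_simps inner_commute)
  then show ?thesis
    using zero_le_power2[of "norm (u - ?p)"] norm_trig[OF assms, of "fourier_coeff u"] by simp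
qed

lemma has_sum_finite_close:
  assumes "(f has_sum s) A" "e > 0"
  shows "\<exists>F. finite F \<and> F \<subseteq> A \<and>
    (\<forall>G. finite G \<and> F \<subseteq> G \<and> G \<subseteq> A \<longrightarrow> dist (sum f G) s < e)"
  unfolding eventually_finite_subsets_at_top[symmetric]
  by (rule tendstoD[OF assms(1)[unfolded has_sum_def] assms(2)])

lemma nonneg_summable_on_small_tail:
  fixes f :: "'a \<Rightarrow> real"
  assumes "f summable_on A" "\<And>x. 0 \<le> f x" "e > 0"
  shows "\<exists>F. finite F \<and> F \<subseteq> A \<and> (\<forall>G. finite G \<longrightarrow> G \<subseteq> A - F \<longrightarrow> sum f G < e)"
proof -
  obtain F where F: "finite F" "F \<subseteq> A"
    and close: "\<And>G. finite G \<Longrightarrow> F \<subseteq> G \<Longrightarrow> G \<subseteq> A \<Longrightarrow> dist (sum f G) (infsum f A) < e"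
    using has_sum_finite_close[OF has_sum_infsum[OF assms(1)] assms(3)] by metis
  have "sum f G < e" if G: "finite G" "G \<subseteq> A - F" for G
  proof -
    have "sum f (F \<union> G) = sum f F + sum f G"
      using F G by (intro sum.union_disjoint) auto
    moreover have "sum f (F \<union> G) \<le> infsum f A"
      using F G assms by (intro finite_sum_le_infsum) auto
    moreover have "infsum f A - sum f F < e"
      using close[of F] F by (simp add: dist_real_def abs_less_iff)
    ultimately show ?thesis by simp
  qed
  then show ?thesis using F by blast
qed

lemma finite_int_subset_symmetric:
  assumes "finite (F :: int set)"
  shows "\<exists>n::nat. F \<subseteq> {- int n..int n}"
proof -
  have "\<bar>k\<bar> \<le> (\<Sum>j\<in>F. \<bar>j\<bar>)" if "k \<in> F" for k
    using assms that by (intro member_le_sum) auto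
  then have "F \<subseteq> {- int (nat (\<Sum>j\<in>F. \<bar>j\<bar>))..int (nat (\<Sum>j\<in>F. \<bar>j\<bar>))}"
    by (auto simp: abs_le_iff sum_nonneg) force
  then show ?thesis by blast
qed

text \<open>The difference of two partial sums lives on frequencies outside any prescribed finite
  set, so square summability makes it small. Symmetric partial sums produce the limit
  \<open>v\<close>, continuity of the coefficients identifies it, and comparison with arbitrary
  finite partial sums gives the unconditional convergence that \<open>infsum\<close>
  requires.\<close>

lemma Riesz_Fischer:
  assumes sum: "(\<lambda>k. (cmod (a k))\<^sup>2) summable_on UNIV"
  shows "\<exists>v. (\<forall>k. fourier_coeff v k = a k) \<and>
    ((\<lambda>k. cscale (a k) (character k)) has_sum v) UNIV"
proof -
  define X where "X n = trig {- int n..int n} a" for n :: nat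
  have tail: "\<exists>F. finite F \<and> (\<forall>G. finite G \<longrightarrow> G \<inter> F = {} \<longrightarrow> norm (trig G a) < e)" if "e > 0" for e
  proof -
    have "\<exists>F. finite F \<and> F \<subseteq> UNIV \<and>
        (\<forall>G. finite G \<longrightarrow> G \<subseteq> UNIV - F \<longrightarrow> (\<Sum>k\<in>G. (cmod (a k))\<^sup>2) < e\<^sup>2)"
      by (rule nonneg_summable_on_small_tail[OF sum]) (use that in auto)
    then obtain F where "finite F"
      and F: "\<And>G. finite G \<Longrightarrow> G \<subseteq> UNIV - F \<Longrightarrow> (norm (trig G a))\<^sup>2 < e\<^sup>2"
      using norm_trig[of _ a] by metis
    show ?thesis
    proof (intro exI[of _ F] conjI allI impI)
      fix G assume "finite G" "G \<inter> F = {}"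
      then show "norm (trig G a) < e"
        using F[of G] that by (intro power2_less_imp_less[of _ e]) auto
    qed fact
  qed
  have diff: "trig S a - trig R a = trig (S - R) a - trig (R - S) a" if "finite S" "finite R" for S R
    by (rule fourier_coeff_eqI) (use that in \<open>auto simp: fourier_coeff_diff\<close>)
  have close: "\<exists>F. finite F \<and> (\<forall>S R. finite S \<longrightarrow> finite R \<longrightarrow> F \<subseteq> S \<longrightarrow> F \<subseteq> R \<longrightarrow>
      norm (trig S a - trig R a) < e)" if e: "e > 0" for e
  proof -
    obtain F where F: "finite F" "\<And>G. finite G \<Longrightarrow> G \<inter> F = {} \<Longrightarrow> norm (trig G a) < e/2"
      using tail[OF half_gt_zero[OF e]] by blast
    have "norm (trig S a - trig R a) < e" if "finite S" "finite R" "F \<subseteq> S" "F \<subseteq> R" for S R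
    proof -
      have "norm (trig S a - trig R a) \<le> norm (trig (S - R) a) + norm (trig (R - S) a)"
        unfolding diff[OF that(1,2)] by (rule norm_triangle_ineq4)
      also have "\<dots> < e/2 + e/2"
        using that by (intro add_strict_mono F(2)) auto
      finally show ?thesis by simp
    qed
    then show ?thesis using F(1) by blast
  qed
  have "Cauchy X"
  proof (rule CauchyI)
    fix e :: real assume "e > 0"
    obtain F where F: "finite F" "\<And>S R. finite S \<Longrightarrow> finite R \<Longrightarrow> F \<subseteq> S \<Longrightarrow> F \<subseteq> R \<Longrightarrow>
        norm (trig S a - trig R a) < e"
      using close[OF \<open>e > 0\<close>] by blast
    obtain N where N: "F \<subseteq> {- int N..int N}"
      using finite_int_subset_symmetric[OF F(1)] by blast
    have sub: "F \<subseteq> {- int m..int m}" if "m \<ge> N" for m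
      using N that by fastforce
    show "\<exists>M. \<forall>m\<ge>M. \<forall>n\<ge>M. norm (X m - X n) < e"
      unfolding X_def using sub by (intro exI[of _ N] allI impI F(2)) auto
  qed
  then obtain v where v: "X \<longlonglongrightarrow> v"
    using Cauchy_convergent_iff convergent_def by blast
  have "fourier_coeff v k = a k" for k
  proof -
    have "(\<lambda>n. fourier_coeff (X n) k) \<longlonglongrightarrow> fourier_coeff v k"
      by (rule tendsto_fourier_coeff[OF v])
    moreover have "\<forall>\<^sub>F n in sequentially. fourier_coeff (X n) k = a k"
      using eventually_ge_at_top[of "nat \<bar>k\<bar>"]
      by eventually_elim (auto simp: X_def)
    then have "(\<lambda>n. fourier_coeff (X n) k) \<longlonglongrightarrow> a k"
      by (rule tendsto_eventually)
    ultimately show ?thesis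
      by (rule LIMSEQ_unique)
  qed
  moreover have "((\<lambda>k. cscale (a k) (character k)) has_sum v) UNIV"
    unfolding has_sum_def
  proof (rule tendstoI)
    fix e :: real assume "e > 0"
    obtain F where F: "finite F" "\<And>S R. finite S \<Longrightarrow> finite R \<Longrightarrow> F \<subseteq> S \<Longrightarrow> F \<subseteq> R \<Longrightarrow>
        norm (trig S a - trig R a) < e / 2"
      using close[OF half_gt_zero[OF \<open>e > 0\<close>]] by blast
    obtain N where N: "F \<subseteq> {- int N..int N}"
      using finite_int_subset_symmetric[OF F(1)] by blast
    have sub: "F \<subseteq> {- int m..int m}" if "m \<ge> N" for m
      using N that by fastforce
    have dist_v: "dist (sum (\<lambda>k. cscale (a k) (character k)) G) v < e" if G: "finite G" "F \<subseteq> G" for G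
    proof -
      have "norm (trig G a - v) \<le> e / 2"
      proof (rule LIMSEQ_le_const2)
        show "(\<lambda>n. norm (trig G a - X n)) \<longlonglongrightarrow> norm (trig G a - v)"
          by (intro tendsto_intros v)
        have "norm (trig G a - X n) < e / 2" if "n \<ge> N" for n
          unfolding X_def using sub[OF that] G by (intro F(2)) auto
        then show "\<exists>N. \<forall>n\<ge>N. norm (trig G a - X n) \<le> e / 2"
          by (intro exI[of _ N]) (auto intro: less_imp_le)
      qed
      then show ?thesis
        using \<open>e > 0\<close> by (simp add: dist_norm trig_def)
    qed
    then show "\<forall>\<^sub>F G in finite_subsets_at_top UNIV. dist (sum (\<lambda>k. cscale (a k) (character k)) G) v < e"
      unfolding eventually_finite_subsets_at_top using F(1) dist_v
      by (intro exI[of _ F]) auto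
  qed
  ultimately show ?thesis by blast
qed

lemma fourier_coeff_square_summable: "(\<lambda>k. (cmod (fourier_coeff u k))\<^sup>2) summable_on A"
proof (rule nonneg_bdd_above_summable_on)
  show "bdd_above (sum (\<lambda>k. (cmod (fourier_coeff u k))\<^sup>2) ` {F. F \<subseteq> A \<and> finite F})"
    by (rule bdd_aboveI[of _ "(norm u)\<^sup>2"]) (auto intro: Bessel)
qed auto

lemma fourier_series_has_sum:
  "((\<lambda>k. cscale (fourier_coeff u k) (character k)) has_sum u) UNIV"
proof -
  obtain v where "\<forall>k. fourier_coeff v k = fourier_coeff u k"
    and "((\<lambda>k. cscale (fourier_coeff u k) (character k)) has_sum v) UNIV"
    using Riesz_Fischer[OF fourier_coeff_square_summable] by blast
  then show ?thesis
    using fourier_coeff_eqI[of v u] by simp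
qed

lemma fourier_partial_sums_tendsto:
  "(\<lambda>n. trig {- int n..int n} (fourier_coeff u)) \<longlonglongrightarrow> u"
proof (rule LIMSEQ_I)
  fix e :: real assume "e > 0"
  then obtain F where "finite F"
    and F: "\<And>G. finite G \<Longrightarrow> F \<subseteq> G \<Longrightarrow> dist (trig G (fourier_coeff u)) u < e"
    using has_sum_finite_close[OF fourier_series_has_sum[of u], of e] unfolding trig_def
    by (metis subset_UNIV)
  obtain N where N: "F \<subseteq> {- int N..int N}"
    using finite_int_subset_symmetric[OF \<open>finite F\<close>] by blast
  have "F \<subseteq> {- int m..int m}" if "m \<ge> N" for m
    using N that by fastforce
  then show "\<exists>no. \<forall>n\<ge>no. norm (trig {- int n..int n} (fourier_coeff u) - u) < e"
    using F by (intro exI[of _ N]) (auto simp: dist_norm)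
qed

text \<open>The converse of \<open>Bessel\<close>: partial Fourier sums converge in norm, so an L2
  bound may be tested on finite sets of coefficients. Most norm estimates of nonlinear terms enter
  through this rule.\<close>

lemma norm_le_fourier_coeffI:
  assumes "\<And>S. finite S \<Longrightarrow> (\<Sum>k\<in>S. (cmod (fourier_coeff u k))\<^sup>2) \<le> B\<^sup>2" "B \<ge> 0"
  shows "norm u \<le> B"
proof (rule LIMSEQ_le_const2)
  show "(\<lambda>n. norm (trig {- int n..int n} (fourier_coeff u))) \<longlonglongrightarrow> norm u"
    by (rule tendsto_norm[OF fourier_partial_sums_tendsto])
  have "norm (trig {- int n..int n} (fourier_coeff u)) \<le> B" for n
    by (rule power2_le_imp_le[OF _ assms(2)]) (simp add: norm_trig assms(1))
  then show "\<exists>N. \<forall>n\<ge>N. norm (trig {- int n..int n} (fourier_coeff u)) \<le> B"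
    by blast
qed

text \<open>\<open>infsum\<close> would be the dummy 0 if the series over \<open>{0..}\<close> did
  not converge unconditionally. \<open>Riesz_Fischer\<close> applied to the truncated coefficients
  excludes this and gives the coefficients of the sum at the same time.\<close>

lemma fourier_coeff_szego_projector [simp]:
  "fourier_coeff (szego_projector u) k = (if k \<ge> 0 then fourier_coeff u k else 0)"
proof -
  define a where "a k = (if k \<ge> 0 then fourier_coeff u k else 0)" for k :: int
  have "(\<lambda>k. (cmod (a k))\<^sup>2) summable_on UNIV"
    by (rule summable_on_comparison_test[OF fourier_coeff_square_summable[of u]]) (auto simp: a_def)
  then obtain v where v: "\<forall>k. fourier_coeff v k = a k"
    and has_sum: "((\<lambda>k. cscale (a k) (character k)) has_sum v) UNIV"
    using Riesz_Fischer by blast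
  have "((\<lambda>k. cscale (a k) (character k)) has_sum v) UNIV
      \<longleftrightarrow> ((\<lambda>k. cscale (fourier_coeff u k) (character k)) has_sum v) {0..}"
    by (rule has_sum_cong_neutral) (auto simp: a_def)
  then have "((\<lambda>k. cscale (fourier_coeff u k) (character k)) has_sum v) {0..}"
    using has_sum by blast
  then have "szego_projector u = v"
    unfolding szego_projector_def by (rule infsumI)
  then show ?thesis using v by (simp add: a_def)
qed

lemma norm_szego_projector_le: "norm (szego_projector u) \<le> norm u"
proof (rule norm_le_fourier_coeffI)
  fix S :: "int set" assume "finite S"
  have "(\<Sum>k\<in>S. (cmod (fourier_coeff (szego_projector u) k))\<^sup>2) \<le> (\<Sum>k\<in>S. (cmod (fourier_coeff u k))\<^sup>2)"
    by (intro sum_mono) auto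
  also have "\<dots> \<le> (norm u)\<^sup>2"
    by (rule Bessel[OF \<open>finite S\<close>])
  finally show "(\<Sum>k\<in>S. (cmod (fourier_coeff (szego_projector u) k))\<^sup>2) \<le> (norm u)\<^sup>2" .
qed auto

section \<open>Trilinear convolution estimates\<close>

definition jap :: "int \<Rightarrow> real" where
  "jap k = 1 + real_of_int \<bar>k\<bar>"

lemma jap_ge_1: "1 \<le> jap k"
  by (simp add: jap_def)

lemma jap_pos [simp]: "0 < jap k"
  by (simp add: jap_def add_pos_nonneg)

lemma jap_nonneg [simp]: "0 \<le> jap k"
  by (simp add: jap_def)

lemma jap_nonzero [simp]: "jap k \<noteq> 0"
  using jap_pos[of k] by linarith

text \<open>The signs \<open>p\<close>, \<open>q\<close>, \<open>r\<close> make the three slots interchangeable; the cubic term has signs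
  \<open>1\<close>, \<open>-1\<close>, \<open>1\<close> because its middle factor is conjugated.\<close>

definition fib :: "int \<Rightarrow> int \<Rightarrow> int \<Rightarrow> int set \<Rightarrow> int \<Rightarrow> (int \<times> int \<times> int) set" where
  "fib p q r S k = {(x, y, z). x \<in> S \<and> y \<in> S \<and> z \<in> S \<and> p * x + q * y + r * z = k}"

definition conv :: "int \<Rightarrow> int \<Rightarrow> int \<Rightarrow> int set \<Rightarrow> (int \<Rightarrow> real) \<Rightarrow> (int \<Rightarrow> real) \<Rightarrow> (int \<Rightarrow> real) \<Rightarrow> int \<Rightarrow> real"
  where "conv p q r S a b c k = (\<Sum>(x, y, z)\<in>fib p q r S k. a x * b y * c z)"

lemma finite_fib [simp]: "finite S \<Longrightarrow> finite (fib p q r S k)"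
  by (rule finite_subset[of _ "S \<times> S \<times> S"]) (auto simp: fib_def)

lemma conv_swap12: "conv p q r S a b c k = conv q p r S b a c k"
  unfolding conv_def
  by (rule sum.reindex_bij_witness[of _ "\<lambda>(x, y, z). (y, x, z)" "\<lambda>(x, y, z). (y, x, z)"])
    (auto simp: fib_def)

lemma conv_swap13: "conv p q r S a b c k = conv r q p S c b a k"
  unfolding conv_def
  by (rule sum.reindex_bij_witness[of _ "\<lambda>(x, y, z). (z, y, x)" "\<lambda>(x, y, z). (z, y, x)"])
    (auto simp: fib_def)

lemma conv_add2: "conv p q r S a (\<lambda>k. b k + b' k) c k = conv p q r S a b c k + conv p q r S a b' c k"
  unfolding conv_def sum.distrib[symmetric] by (rule sum.cong) (auto simp: algebra_simps)

lemma conv_add3: "conv p q r S a b (\<lambda>k. c k + c' k) k = conv p q r S a b c k + conv p q r S a b c' k"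
  unfolding conv_def sum.distrib[symmetric] by (rule sum.cong) (auto simp: algebra_simps)

text \<open>Cauchy-Schwarz within each fibre of \<open>\<kappa>\<close>: the sums of
  \<open>p\<close> are bounded fibre by fibre, while the sums of \<open>q\<close> over the disjoint
  fibres add up to at most one free sum. The convolution bounds are instances with triples of
  frequencies as \<open>X\<close> and the output frequency as \<open>\<kappa>\<close>.\<close>

lemma fibre_Cauchy_Schwarz:
  fixes \<kappa> :: "'a \<Rightarrow> 'b" and f p q :: "'a \<Rightarrow> real"
  assumes X: "finite X" and K: "finite K"
    and nonneg: "\<And>i. i \<in> X \<Longrightarrow> 0 \<le> p i" "\<And>i. i \<in> X \<Longrightarrow> 0 \<le> q i" "\<And>i. i \<in> X \<Longrightarrow> 0 \<le> f i"
    and le: "\<And>i. i \<in> X \<Longrightarrow> (f i)\<^sup>2 \<le> p i * q i"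
    and fibre: "\<And>k. k \<in> K \<Longrightarrow> (\<Sum>i | i \<in> X \<and> \<kappa> i = k. p i) \<le> B"
    and B: "0 \<le> B"
  shows "(\<Sum>k\<in>K. (\<Sum>i | i \<in> X \<and> \<kappa> i = k. f i)\<^sup>2) \<le> B * (\<Sum>i\<in>X. q i)"
proof -
  have one: "(\<Sum>i | i \<in> X \<and> \<kappa> i = k. f i)\<^sup>2 \<le> B * (\<Sum>i | i \<in> X \<and> \<kappa> i = k. q i)" if "k \<in> K" for k
  proof -
    let ?Y = "{i. i \<in> X \<and> \<kappa> i = k}"
    have "(\<Sum>i\<in>?Y. f i) \<le> (\<Sum>i\<in>?Y. sqrt (p i) * sqrt (q i))"
      by (intro sum_mono) (auto simp flip: real_sqrt_mult intro!: real_le_rsqrt le)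
    then have "(\<Sum>i\<in>?Y. f i)\<^sup>2 \<le> (\<Sum>i\<in>?Y. sqrt (p i) * sqrt (q i))\<^sup>2"
      by (intro power_mono sum_nonneg) (auto intro: nonneg)
    also have "\<dots> \<le> (\<Sum>i\<in>?Y. (sqrt (p i))\<^sup>2) * (\<Sum>i\<in>?Y. (sqrt (q i))\<^sup>2)"
      by (rule Cauchy_Schwarz_ineq_sum)
    also have "\<dots> = (\<Sum>i\<in>?Y. p i) * (\<Sum>i\<in>?Y. q i)"
      by (intro arg_cong2[where f = "(*)"] sum.cong) (auto intro: nonneg)
    also have "\<dots> \<le> B * (\<Sum>i\<in>?Y. q i)"
      using fibre[OF that] by (intro mult_right_mono sum_nonneg) (auto intro: nonneg)
    finally show ?thesis .
  qed
  have "(\<Sum>k\<in>K. (\<Sum>i | i \<in> X \<and> \<kappa> i = k. f i)\<^sup>2) \<le> (\<Sum>k\<in>K. B * (\<Sum>i | i \<in> X \<and> \<kappa> i = k. q i))"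
    by (rule sum_mono) (rule one)
  also have "\<dots> = B * (\<Sum>k\<in>K. \<Sum>i | i \<in> X \<and> \<kappa> i = k. q i)"
    by (simp add: sum_distrib_left)
  also have "(\<Sum>k\<in>K. \<Sum>i | i \<in> X \<and> \<kappa> i = k. q i) = (\<Sum>i\<in>(\<Union>k\<in>K. {i. i \<in> X \<and> \<kappa> i = k}). q i)"
    by (rule sum.UNION_disjoint[symmetric]) (use X K in auto)
  also have "\<dots> \<le> (\<Sum>i\<in>X. q i)"
    using X by (intro sum_mono2) (auto intro: nonneg)
  finally show ?thesis
    using B by (auto intro: mult_left_mono)
qed

lemma fib_eq: "fib p q r S k = {i. i \<in> S \<times> S \<times> S \<and> (case i of (x, y, z) \<Rightarrow> p * x + q * y + r * z) = k}"
  by (auto simp: fib_def)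

lemma sum_triple_product:
  fixes a b c :: "'a \<Rightarrow> real"
  shows "(\<Sum>(x, y, z)\<in>S \<times> S \<times> S. a x * b y * c z) = sum a S * sum b S * sum c S"
proof -
  have "(\<Sum>(x, y, z)\<in>S \<times> S \<times> S. a x * b y * c z) = (\<Sum>x\<in>S. \<Sum>y\<in>S. \<Sum>z\<in>S. a x * b y * c z)"
    by (simp add: sum.cartesian_product)
  also have "\<dots> = sum a S * sum b S * sum c S"
    by (simp only: sum_distrib_left[symmetric] sum_distrib_right[symmetric])
  finally show ?thesis .
qed

text \<open>\<open>\<pi>\<close> selects two of the three frequencies. They determine the third one
  on a fibre, so the fibre sum is part of a free double sum, which factorises.\<close>

lemma fib_pair_bound:
  fixes g h :: "int \<Rightarrow> real"
  assumes S: "finite S" and g: "\<And>k. 0 \<le> g k" and h: "\<And>k. 0 \<le> h k"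
    and inj: "inj_on \<pi> (fib p q r S k)" and im: "\<pi> ` fib p q r S k \<subseteq> S \<times> S"
  shows "(\<Sum>i\<in>fib p q r S k. g (fst (\<pi> i)) * h (snd (\<pi> i))) \<le> sum g S * sum h S"
proof -
  have "(\<Sum>i\<in>fib p q r S k. g (fst (\<pi> i)) * h (snd (\<pi> i)))
      = (\<Sum>j\<in>\<pi> ` fib p q r S k. g (fst j) * h (snd j))"
    by (simp add: sum.reindex[OF inj] o_def)
  also have "\<dots> \<le> (\<Sum>j\<in>S \<times> S. g (fst j) * h (snd j))"
    using S im by (intro sum_mono2) (auto intro!: mult_nonneg_nonneg g h)
  also have "\<dots> = sum g S * sum h S"
    by (simp add: sum_product sum.cartesian_product case_prod_beta)
  finally show ?thesis .
qed

lemma three_amgm: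
  fixes u v t :: real
  assumes "0 \<le> u" "0 \<le> v" "0 \<le> t"
  shows "u * v * t \<le> (u^3 + v^3 + t^3) / 3"
proof -
  have "0 \<le> (u + v + t) * ((u - v)\<^sup>2 + (v - t)\<^sup>2 + (t - u)\<^sup>2)"
    using assms by (intro mult_nonneg_nonneg) auto
  also have "\<dots> = 2 * (u^3 + v^3 + t^3 - 3 * (u * v * t))"
    by (simp add: algebra_simps power2_eq_square power3_eq_cube)
  finally show ?thesis by simp
qed

context
  fixes p q r :: int
  assumes pqr: "\<bar>p\<bar> = 1" "\<bar>q\<bar> = 1" "\<bar>r\<bar> = 1"
begin

lemma fib_determined:
  assumes "(x, y, z) \<in> fib p q r S k" "(x', y', z') \<in> fib p q r S k"
  shows "x = x' \<Longrightarrow> y = y' \<Longrightarrow> z = z'" "x = x' \<Longrightarrow> z = z' \<Longrightarrow> y = y'" "y = y' \<Longrightarrow> z = z' \<Longrightarrow> x = x'"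
proof -
  have *: "u * a = u * b \<Longrightarrow> \<bar>u\<bar> = 1 \<Longrightarrow> a = b" for u a b :: int
    by auto
  show "x = x' \<Longrightarrow> y = y' \<Longrightarrow> z = z'" "x = x' \<Longrightarrow> z = z' \<Longrightarrow> y = y'" "y = y' \<Longrightarrow> z = z' \<Longrightarrow> x = x'"
    using assms *[of r z z'] *[of q y y'] *[of p x x'] pqr by (auto simp: fib_def)
qed

lemma fib_inj:
  "inj_on (\<lambda>(x, y, z). (x, y)) (fib p q r S k)"
  "inj_on (\<lambda>(x, y, z). (x, z)) (fib p q r S k)"
  "inj_on (\<lambda>(x, y, z). (y, z)) (fib p q r S k)"
  by (rule inj_onI; clarsimp; blast dest: fib_determined)+

lemma fib_pair_bounds:
  fixes g h :: "int \<Rightarrow> real"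
  assumes S: "finite S" and g: "\<And>k. 0 \<le> g k" and h: "\<And>k. 0 \<le> h k"
  shows "(\<Sum>(x, y, z)\<in>fib p q r S k. g x * h y) \<le> sum g S * sum h S"
    "(\<Sum>(x, y, z)\<in>fib p q r S k. g x * h z) \<le> sum g S * sum h S"
    "(\<Sum>(x, y, z)\<in>fib p q r S k. g y * h z) \<le> sum g S * sum h S"
proof -
  have im: "(\<lambda>(x, y, z). (x, y)) ` fib p q r S k \<subseteq> S \<times> S"
    "(\<lambda>(x, y, z). (x, z)) ` fib p q r S k \<subseteq> S \<times> S"
    "(\<lambda>(x, y, z). (y, z)) ` fib p q r S k \<subseteq> S \<times> S"
    by (auto simp: fib_def)
  show "(\<Sum>(x, y, z)\<in>fib p q r S k. g x * h y) \<le> sum g S * sum h S"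
    "(\<Sum>(x, y, z)\<in>fib p q r S k. g x * h z) \<le> sum g S * sum h S"
    "(\<Sum>(x, y, z)\<in>fib p q r S k. g y * h z) \<le> sum g S * sum h S"
    using fib_pair_bound[where g = g and h = h, OF S g h fib_inj(1) im(1)]
      fib_pair_bound[where g = g and h = h, OF S g h fib_inj(2) im(2)]
      fib_pair_bound[where g = g and h = h, OF S g h fib_inj(3) im(3)]
    by (simp_all add: case_prod_beta)
qed

text \<open>Young's inequality for two factors in l1 and one in l2: the fibre weight
  \<open>a x * b y\<close> sums to at most the product of the l1 norms, because
  \<open>(x, y)\<close> determines \<open>z\<close>.\<close>

lemma conv_l1_l1_l2:
  assumes S: "finite S" and K: "finite K"
    and nonneg: "\<And>k. 0 \<le> a k" "\<And>k. 0 \<le> b k" "\<And>k. 0 \<le> c k"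
  shows "(\<Sum>k\<in>K. (conv p q r S a b c k)\<^sup>2) \<le> (sum a S * sum b S)\<^sup>2 * (\<Sum>k\<in>S. (c k)\<^sup>2)"
proof -
  have "(\<Sum>k\<in>K. (\<Sum>i | i \<in> S \<times> S \<times> S \<and> (case i of (x, y, z) \<Rightarrow> p * x + q * y + r * z) = k.
        case i of (x, y, z) \<Rightarrow> a x * b y * c z)\<^sup>2)
      \<le> (sum a S * sum b S) * (\<Sum>i\<in>S \<times> S \<times> S. case i of (x, y, z) \<Rightarrow> a x * b y * (c z)\<^sup>2)"
  proof (rule fibre_Cauchy_Schwarz[where p = "\<lambda>(x, y, z). a x * b y"])
    show "(\<Sum>i | i \<in> S \<times> S \<times> S \<and> (case i of (x, y, z) \<Rightarrow> p * x + q * y + r * z) = k.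
        case i of (x, y, z) \<Rightarrow> a x * b y) \<le> sum a S * sum b S" for k
      using fib_pair_bounds(1)[where g = a and h = b and k = k, OF S nonneg(1,2)]
      by (simp add: fib_eq)
    show "((case i of (x, y, z) \<Rightarrow> a x * b y * c z))\<^sup>2
        \<le> (case i of (x, y, z) \<Rightarrow> a x * b y) * (case i of (x, y, z) \<Rightarrow> a x * b y * (c z)\<^sup>2)" for i
      by (auto simp: power2_eq_square split: prod.split)
  qed (use S K nonneg in \<open>auto intro!: sum_nonneg mult_nonneg_nonneg split: prod.splits\<close>)
  then show ?thesis
    unfolding conv_def fib_eq sum_triple_product[of a b "\<lambda>z. (c z)\<^sup>2"]
    by (simp add: power2_eq_square mult_ac)
qed

text \<open>Cauchy--Schwarz with the weights \<open>g\<^sup>2\<close>, \<open>g = jap powr (- s)\<close>. On a fibre two indices determine the third,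
  so AM-GM applied to \<open>g\<^sub>x g\<^sub>y\<close>, \<open>g\<^sub>x g\<^sub>z\<close>, \<open>g\<^sub>y g\<^sub>z\<close> bounds the weights of the fibre by free double sums.\<close>

lemma conv_sobolev:
  assumes S: "finite S" and K: "finite K"
    and nonneg: "\<And>k. 0 \<le> a k" "\<And>k. 0 \<le> b k" "\<And>k. 0 \<le> c k"
    and W: "(\<Sum>k\<in>S. jap k powr (- 3 * s)) \<le> W"
  shows "(\<Sum>k\<in>K. (conv p q r S a b c k)\<^sup>2) \<le> W\<^sup>2 * (\<Sum>k\<in>S. jap k powr (2 * s) * (a k)\<^sup>2)
    * (\<Sum>k\<in>S. jap k powr (2 * s) * (b k)\<^sup>2) * (\<Sum>k\<in>S. jap k powr (2 * s) * (c k)\<^sup>2)"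
proof -
  define g where "g k = jap k powr (- s)" for k
  define A where "A a k = jap k powr (2 * s) * (a k)\<^sup>2" for a k
  have g0: "0 \<le> g k" for k
    by (simp add: g_def)
  have g3: "(g k)^3 = jap k powr (- 3 * s)" for k
    by (simp add: g_def powr_power mult.commute)
  have gA: "(g k)\<^sup>2 * A a k = (a k)\<^sup>2" for a k
    by (simp add: g_def A_def powr_power powr_minus field_simps)
  have sum_g3: "sum (\<lambda>k. (g k)^3) S \<le> W" "0 \<le> sum (\<lambda>k. (g k)^3) S"
    using W by (auto simp: g3 intro: sum_nonneg)
  then have W2: "sum (\<lambda>k. (g k)^3) S * sum (\<lambda>k. (g k)^3) S \<le> W\<^sup>2"
    unfolding power2_eq_square by (intro mult_mono) auto
  have "(\<Sum>k\<in>K. (\<Sum>i | i \<in> S \<times> S \<times> S \<and> (case i of (x, y, z) \<Rightarrow> p * x + q * y + r * z) = k.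
        case i of (x, y, z) \<Rightarrow> a x * b y * c z)\<^sup>2)
      \<le> W\<^sup>2 * (\<Sum>i\<in>S \<times> S \<times> S. case i of (x, y, z) \<Rightarrow> A a x * A b y * A c z)"
  proof (rule fibre_Cauchy_Schwarz[where p = "\<lambda>(x, y, z). (g x)\<^sup>2 * (g y)\<^sup>2 * (g z)\<^sup>2"])
    fix k
    have "(\<Sum>(x, y, z)\<in>fib p q r S k. (g x)\<^sup>2 * (g y)\<^sup>2 * (g z)\<^sup>2)
        \<le> (\<Sum>(x, y, z)\<in>fib p q r S k. (1/3) * ((g x)^3 * (g y)^3) + (1/3) * ((g x)^3 * (g z)^3)
          + (1/3) * ((g y)^3 * (g z)^3))"
    proof (rule sum_mono, clarify)
      fix x y z
      show "(g x)\<^sup>2 * (g y)\<^sup>2 * (g z)\<^sup>2 \<le> (1/3) * ((g x)^3 * (g y)^3) + (1/3) * ((g x)^3 * (g z)^3)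
          + (1/3) * ((g y)^3 * (g z)^3)"
        using three_amgm[of "g x * g y" "g x * g z" "g y * g z"] g0
        by (simp add: power_mult_distrib power2_eq_square mult_ac)
    qed
    also have "\<dots> = (1/3) * (\<Sum>(x, y, z)\<in>fib p q r S k. (g x)^3 * (g y)^3)
        + (1/3) * (\<Sum>(x, y, z)\<in>fib p q r S k. (g x)^3 * (g z)^3)
        + (1/3) * (\<Sum>(x, y, z)\<in>fib p q r S k. (g y)^3 * (g z)^3)"
      unfolding sum_distrib_left sum.distrib[symmetric] by (rule sum.cong) auto
    also have "\<dots> \<le> (1/3) * W\<^sup>2 + (1/3) * W\<^sup>2 + (1/3) * W\<^sup>2"
    proof -
      have g30: "0 \<le> (g k)^3" for k using g0 by simp
      show ?thesis
        using fib_pair_bounds[where g = "\<lambda>k. (g k)^3" and h = "\<lambda>k. (g k)^3" and k = k, OF S g30 g30] W2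
        by (intro add_mono mult_left_mono) (auto elim: order_trans)
    qed
    finally show "(\<Sum>i | i \<in> S \<times> S \<times> S \<and> (case i of (x, y, z) \<Rightarrow> p * x + q * y + r * z) = k.
        case i of (x, y, z) \<Rightarrow> (g x)\<^sup>2 * (g y)\<^sup>2 * (g z)\<^sup>2) \<le> W\<^sup>2"
      by (simp add: fib_eq)
  next
    fix i :: "int \<times> int \<times> int"
    obtain x y z where i: "i = (x, y, z)" by (cases i)
    have "(a x * b y * c z)\<^sup>2 = ((g x)\<^sup>2 * A a x) * ((g y)\<^sup>2 * A b y) * ((g z)\<^sup>2 * A c z)"
      by (simp only: gA power_mult_distrib)
    then show "(case i of (x, y, z) \<Rightarrow> a x * b y * c z)\<^sup>2 \<le>
        (case i of (x, y, z) \<Rightarrow> (g x)\<^sup>2 * (g y)\<^sup>2 * (g z)\<^sup>2) * (case i of (x, y, z) \<Rightarrow> A a x * A b y * A c z)"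
      by (simp add: i mult_ac)
  qed (use S K nonneg in \<open>auto intro!: sum_nonneg mult_nonneg_nonneg simp: A_def split: prod.splits\<close>)
  then show ?thesis
    unfolding conv_def fib_eq sum_triple_product[of "A a" "A b" "A c"]
    by (simp add: A_def mult.assoc)
qed

end

section \<open>Weighted sums over frequencies and the splitting at frequency
  \<open>R\<close>\<close>

lemma sum_int_even_le:
  fixes f :: "nat \<Rightarrow> real"
  assumes F: "finite F" and f: "\<And>n. 0 \<le> f n"
    and bound: "\<And>G. finite G \<Longrightarrow> (\<And>n. n \<in> G \<Longrightarrow> \<exists>k\<in>F. n = nat \<bar>k\<bar>) \<Longrightarrow> sum f G \<le> B"
  shows "(\<Sum>k\<in>F. f (nat \<bar>k\<bar>)) \<le> 2 * B"
proof -
  \<comment> \<open>The absolute value is injective on each half line, whence the factor 2.\<close>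
  have inj: "inj_on (\<lambda>k. nat \<bar>k\<bar>) (F \<inter> {0..})" "inj_on (\<lambda>k. nat \<bar>k\<bar>) (F \<inter> {..<0})"
    by (auto simp: inj_on_def)
  have "(\<Sum>k\<in>F. f (nat \<bar>k\<bar>)) = (\<Sum>k\<in>(F \<inter> {0..}) \<union> (F \<inter> {..<0}). f (nat \<bar>k\<bar>))"
    by (rule sum.cong) auto
  also have "\<dots> = (\<Sum>k\<in>F \<inter> {0..}. f (nat \<bar>k\<bar>)) + (\<Sum>k\<in>F \<inter> {..<0}. f (nat \<bar>k\<bar>))"
    using F by (intro sum.union_disjoint) auto
  also have "\<dots> = sum f ((\<lambda>k. nat \<bar>k\<bar>) ` (F \<inter> {0..})) + sum f ((\<lambda>k. nat \<bar>k\<bar>) ` (F \<inter> {..<0}))"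
    by (simp only: sum.reindex[OF inj(1)] sum.reindex[OF inj(2)] o_def)
  also have "\<dots> \<le> B + B"
    by (intro add_mono bound) (use F in blast)+
  finally show ?thesis by simp
qed

lemma sum_jap_powr_bounded:
  assumes "e > 1"
  obtains W where "0 \<le> W" "\<And>F. finite F \<Longrightarrow> (\<Sum>k\<in>F. jap k powr (- e)) \<le> W"
proof
  let ?f = "\<lambda>n::nat. real (Suc n) powr (- e)"
  have sm: "summable ?f"
    using assms summable_Suc_iff[of "\<lambda>n. real n powr (- e)"] by (simp add: summable_real_powr_iff)
  show "0 \<le> 2 * suminf ?f"
    using suminf_nonneg[OF sm] by simp
  fix F :: "int set" assume F: "finite F"
  have "(\<Sum>k\<in>F. jap k powr (- e)) = (\<Sum>k\<in>F. ?f (nat \<bar>k\<bar>))"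
    by (simp add: jap_def add.commute)
  also have "\<dots> \<le> 2 * suminf ?f"
  proof (rule sum_int_even_le[OF F])
    show "sum ?f G \<le> suminf ?f" if "finite G" for G
      by (rule sum_le_suminf[OF sm that]) simp
  qed simp
  finally show "(\<Sum>k\<in>F. jap k powr (- e)) \<le> 2 * suminf ?f" .
qed

text \<open>A harmonic sum counted for both signs. With \<open>N = floor R + 1 \<le> 2 * R\<close>
  and \<open>ln 2 \<le> 1\<close> each half is at most \<open>2 + ln R\<close>.\<close>

lemma sum_inverse_jap_le:
  assumes F: "finite F" and R: "1 \<le> R" and le: "\<And>k. k \<in> F \<Longrightarrow> \<bar>real_of_int k\<bar> \<le> R"
  shows "(\<Sum>k\<in>F. 1 / jap k) \<le> 4 + 2 * ln R"
proof -
  have harm: "(\<Sum>n<N. 1 / real (Suc n)) \<le> 1 + ln (real N)" if "N \<ge> 1" for N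
    using that
  proof (induction N rule: nat_induct_at_least)
    case base
    then show ?case by simp
  next
    case (Suc N)
    then have "N > 0" by simp
    \<comment> \<open>The inequality \<open>ln x \<le> x - 1\<close> at
      \<open>x = N / (N + 1)\<close> gives \<open>1 / (N + 1) \<le> ln (N + 1) - ln N\<close>, which
      telescopes.\<close>
    have "ln (real N / real (Suc N)) \<le> real N / real (Suc N) - 1"
      using \<open>N > 0\<close> by (intro ln_le_minus_one) auto
    also have "real N / real (Suc N) - 1 = - (1 / real (Suc N))"
      by (simp add: field_simps)
    finally have "1 / real (Suc N) \<le> ln (real (Suc N)) - ln (real N)"
      using \<open>N > 0\<close> by (simp add: ln_div)
    then show ?case using Suc.IH by simp
  qed
  have "(\<Sum>k\<in>F. 1 / jap k) = (\<Sum>k\<in>F. 1 / real (Suc (nat \<bar>k\<bar>)))"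
    by (simp add: jap_def)
  also have "\<dots> \<le> 2 * (2 + ln R)"
  proof (rule sum_int_even_le[OF F])
    fix G :: "nat set" assume G: "finite G" "\<And>n. n \<in> G \<Longrightarrow> \<exists>k\<in>F. n = nat \<bar>k\<bar>"
    let ?N = "Suc (nat \<lfloor>R\<rfloor>)"
    have "n < ?N" if n: "n \<in> G" for n
    proof -
      obtain k where "k \<in> F" "n = nat \<bar>k\<bar>" using G(2)[OF n] by blast
      then have "real n \<le> R" using le[of k] by simp
      then show ?thesis by (simp add: le_nat_floor less_Suc_eq_le)
    qed
    then have "(\<Sum>n\<in>G. 1 / real (Suc n)) \<le> (\<Sum>n<?N. 1 / real (Suc n))"
      by (intro sum_mono2) auto
    also have "\<dots> \<le> 1 + ln (real ?N)"
      by (rule harm) simp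
    finally have sum_le: "(\<Sum>n\<in>G. 1 / real (Suc n)) \<le> 1 + ln (real ?N)" .
    have "real ?N \<le> 2 * R"
    proof -
      have "real (nat \<lfloor>R\<rfloor>) \<le> R" using R by linarith
      then show ?thesis unfolding of_nat_Suc using R by linarith
    qed
    moreover have "0 < real ?N"
      by (simp only: of_nat_0_less_iff zero_less_Suc)
    ultimately have "ln (real ?N) \<le> ln (2 * R)"
      using R by (intro iffD2[OF ln_le_cancel_iff]) linarith+
    also have "ln (2 * R) = ln 2 + ln R"
      using R by (simp add: ln_mult)
    also have "ln 2 \<le> (1::real)"
      using ln_le_minus_one[of 2] by simp
    finally show "(\<Sum>n\<in>G. 1 / real (Suc n)) \<le> 2 + ln R"
      using sum_le by linarith
  qed auto
  finally show ?thesis by simp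
qed

text \<open>Cauchy-Schwarz against \<open>1 / jap\<close>: an \<open>H^(1/2)\<close> bound misses
  summability of the coefficients by a logarithm only, and up to frequency \<open>R\<close> the
  price is the square root of a harmonic sum.\<close>

lemma sum_low_le:
  fixes a :: "int \<Rightarrow> real"
  assumes S: "finite S" and R: "1 \<le> R" and a: "\<And>k. 0 \<le> a k"
    and H: "(\<Sum>k\<in>S. jap k * (a k)\<^sup>2) \<le> M\<^sup>2" and M: "0 \<le> M"
  shows "(\<Sum>k\<in>S. if \<bar>real_of_int k\<bar> \<le> R then a k else 0) \<le> sqrt (4 + 2 * ln R) * M"
proof -
  let ?F = "{k \<in> S. \<bar>real_of_int k\<bar> \<le> R}"
  have lnR: "0 \<le> ln R" using R by simp
  have "(\<Sum>k\<in>S. if \<bar>real_of_int k\<bar> \<le> R then a k else 0) = (\<Sum>k\<in>?F. (1 / sqrt (jap k)) * (sqrt (jap k) * a k))"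
    using S by (simp add: sum.inter_filter)
  also have "\<dots> \<le> sqrt ((\<Sum>k\<in>?F. (1 / sqrt (jap k))\<^sup>2) * (\<Sum>k\<in>?F. (sqrt (jap k) * a k)\<^sup>2))"
    by (intro real_le_rsqrt Cauchy_Schwarz_ineq_sum)
  also have "\<dots> \<le> sqrt ((4 + 2 * ln R) * M\<^sup>2)"
  proof (rule real_sqrt_le_mono, rule mult_mono)
    have "(\<Sum>k\<in>?F. (1 / sqrt (jap k))\<^sup>2) = (\<Sum>k\<in>?F. 1 / jap k)"
      by (rule sum.cong) (simp_all add: power_divide)
    also have "\<dots> \<le> 4 + 2 * ln R"
      by (rule sum_inverse_jap_le[OF _ R]) (use S in auto)
    finally show "(\<Sum>k\<in>?F. (1 / sqrt (jap k))\<^sup>2) \<le> 4 + 2 * ln R" .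
    have "(\<Sum>k\<in>?F. (sqrt (jap k) * a k)\<^sup>2) = (\<Sum>k\<in>?F. jap k * (a k)\<^sup>2)"
      by (rule sum.cong) (simp_all add: power_mult_distrib)
    also have "\<dots> \<le> (\<Sum>k\<in>S. jap k * (a k)\<^sup>2)"
      using S by (intro sum_mono2) auto
    finally show "(\<Sum>k\<in>?F. (sqrt (jap k) * a k)\<^sup>2) \<le> M\<^sup>2"
      using H by linarith
    show "0 \<le> 4 + 2 * ln R" using lnR by simp
    show "0 \<le> (\<Sum>k\<in>?F. (sqrt (jap k) * a k)\<^sup>2)" by (rule sum_nonneg) simp
  qed
  also have "\<dots> = sqrt (4 + 2 * ln R) * M"
    using M by (simp add: real_sqrt_mult)
  finally show ?thesis .
qed

text \<open>The exponent 5/12 may be any number between 1/3, where \<open>jap powr (- 3 * s)\<close> becomes summable, and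
  1/2, where the gain \<open>R powr (-1/12)\<close> over \<open>H\<^sup>1\<^sup>/\<^sup>2\<close> disappears.\<close>

lemma sum_high_le:
  fixes a :: "int \<Rightarrow> real"
  assumes R: "1 \<le> R" and H: "(\<Sum>k\<in>S. jap k * (a k)\<^sup>2) \<le> B"
  shows "(\<Sum>k\<in>S. jap k powr (2 * (5/12)) * (if \<bar>real_of_int k\<bar> \<le> R then 0 else a k)\<^sup>2) \<le> R powr (-1/6) * B"
proof -
  have "(\<Sum>k\<in>S. jap k powr (2 * (5/12)) * (if \<bar>real_of_int k\<bar> \<le> R then 0 else a k)\<^sup>2)
      \<le> (\<Sum>k\<in>S. R powr (-1/6) * (jap k * (a k)\<^sup>2))"
  proof (rule sum_mono)
    fix k
    show "jap k powr (2 * (5/12)) * (if \<bar>real_of_int k\<bar> \<le> R then 0 else a k)\<^sup>2 \<le> R powr (-1/6) * (jap k * (a k)\<^sup>2)"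
    proof (cases "\<bar>real_of_int k\<bar> \<le> R")
      case True
      then show ?thesis by simp
    next
      case False
      have "jap k powr (2 * (5/12)) = jap k powr (-1/6) * jap k powr 1"
        unfolding powr_add[symmetric] by simp
      also have "\<dots> \<le> R powr (-1/6) * jap k"
        using R False by (intro mult_mono powr_mono2') (auto simp: jap_def)
      finally show ?thesis
        using False by (simp add: mult_right_mono flip: mult.assoc)
    qed
  qed
  also have "\<dots> = R powr (-1/6) * (\<Sum>k\<in>S. jap k * (a k)\<^sup>2)"
    by (simp add: sum_distrib_left)
  also have "\<dots> \<le> R powr (-1/6) * B"
    by (intro mult_left_mono H) simp
  finally show ?thesis .
qed

lemma sum_jap_powr_le:
  fixes a :: "int \<Rightarrow> real"
  assumes H: "(\<Sum>k\<in>S. jap k * (a k)\<^sup>2) \<le> B" and b: "\<And>k. 0 \<le> b k" "\<And>k. b k \<le> a k"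
  shows "(\<Sum>k\<in>S. jap k powr (2 * (5/12)) * (b k)\<^sup>2) \<le> B"
proof -
  have "(\<Sum>k\<in>S. jap k powr (2 * (5/12)) * (b k)\<^sup>2) \<le> (\<Sum>k\<in>S. jap k * (a k)\<^sup>2)"
  proof (intro sum_mono mult_mono power_mono)
    show "jap k powr (2 * (5/12)) \<le> jap k" for k
      using powr_mono[of "2 * (5/12)" 1 "jap k"] jap_ge_1[of k] by simp
  qed (use b in auto)
  then show ?thesis using H by simp
qed

text \<open>\<open>\<omega>\<close> stands for the difference of two functions with bound
  \<open>M\<close>, hence its bound \<open>2 * M\<close>; \<open>y\<close> bounds its l2 norm. If
  both other factors are low, they go into l1 and \<open>\<omega>\<close> into l2, at the cost
  \<open>(4 + 2 * ln R) * M^2\<close>. If one of them is high, \<open>conv_sobolev\<close> with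
  exponent 5/12 gains \<open>R powr (-1/12)\<close>, and only the \<open>H^(1/2)\<close> bound of
  \<open>\<omega>\<close> is used.\<close>

lemma conv_low_high:
  fixes \<omega> \<alpha> \<beta> :: "int \<Rightarrow> real"
  assumes pqr: "\<bar>p\<bar> = 1" "\<bar>q\<bar> = 1" "\<bar>r\<bar> = 1" and S: "finite S" and K: "finite K"
    and nonneg: "\<And>k. 0 \<le> \<omega> k" "\<And>k. 0 \<le> \<alpha> k" "\<And>k. 0 \<le> \<beta> k"
    and W: "(\<Sum>k\<in>S. jap k powr (- 3 * (5/12))) \<le> W" and W0: "0 \<le> W"
    and H: "(\<Sum>k\<in>S. jap k * (\<omega> k)\<^sup>2) \<le> (2 * M)\<^sup>2" "(\<Sum>k\<in>S. jap k * (\<alpha> k)\<^sup>2) \<le> M\<^sup>2"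
      "(\<Sum>k\<in>S. jap k * (\<beta> k)\<^sup>2) \<le> M\<^sup>2"
    and M: "0 \<le> M" and R: "1 \<le> R" and y: "(\<Sum>k\<in>S. (\<omega> k)\<^sup>2) \<le> y\<^sup>2" "0 \<le> y"
  shows "L2_set (conv p q r S \<omega> \<alpha> \<beta>) K \<le> (4 + 2 * ln R) * M\<^sup>2 * y + 4 * W * M^3 * R powr (-1/12)"
proof -
  define lo where "lo f k = (if \<bar>real_of_int k\<bar> \<le> R then f k else 0)" for f :: "int \<Rightarrow> real" and k
  define hi where "hi f k = (if \<bar>real_of_int k\<bar> \<le> R then 0 else f k)" for f :: "int \<Rightarrow> real" and k
  have split: "f = (\<lambda>k. lo f k + hi f k)" for f
    by (auto simp: lo_def hi_def fun_eq_iff)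
  have lo0: "0 \<le> lo f k" "lo f k \<le> f k" "0 \<le> hi f k" "hi f k \<le> f k" if "\<And>k. 0 \<le> f k" for f k
    using that by (auto simp: lo_def hi_def)
  let ?L = "4 + 2 * ln R" and ?e = "2 * W * M^3 * R powr (-1/12)"
  have L0: "0 \<le> ?L" using R by simp
  have e0: "0 \<le> ?e" using W0 M by simp
  have R6: "R powr (-1/6) = (R powr (-1/12))\<^sup>2"
    using R by (simp add: powr_power)
  have t1: "L2_set (conv p q r S \<omega> (lo \<alpha>) (lo \<beta>)) K \<le> ?L * M\<^sup>2 * y"
    unfolding L2_set_def
  proof (rule real_le_lsqrt)
    have "(\<Sum>k\<in>K. (conv p q r S \<omega> (lo \<alpha>) (lo \<beta>) k)\<^sup>2)
        \<le> (sum (lo \<beta>) S * sum (lo \<alpha>) S)\<^sup>2 * (\<Sum>k\<in>S. (\<omega> k)\<^sup>2)"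
      unfolding conv_swap13[of p q r] using lo0 nonneg
      by (intro conv_l1_l1_l2 pqr S K) auto
    also have "\<dots> \<le> ((sqrt ?L * M) * (sqrt ?L * M))\<^sup>2 * y\<^sup>2"
    proof (intro mult_mono power_mono y)
      show "sum (lo \<beta>) S \<le> sqrt ?L * M" "sum (lo \<alpha>) S \<le> sqrt ?L * M"
        unfolding lo_def by (rule sum_low_le[OF S R _ _ M]; fact)+
    qed (use lo0 nonneg M L0 in \<open>auto intro!: sum_nonneg mult_nonneg_nonneg\<close>)
    also have "(sqrt ?L * M) * (sqrt ?L * M) = ?L * M\<^sup>2"
      using L0 by (simp add: power2_eq_square)
    finally show "(\<Sum>k\<in>K. (conv p q r S \<omega> (lo \<alpha>) (lo \<beta>) k)\<^sup>2) \<le> (?L * M\<^sup>2 * y)\<^sup>2"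
      by (simp add: power_mult_distrib)
  qed (use L0 M y in \<open>auto intro!: sum_nonneg mult_nonneg_nonneg\<close>)
  have sob: "L2_set (conv p q r S \<omega> f g) K \<le> ?e"
    if f0: "\<And>k. 0 \<le> f k" and g0: "\<And>k. 0 \<le> g k"
      and fg: "(\<Sum>k\<in>S. jap k powr (2 * (5/12)) * (f k)\<^sup>2) * (\<Sum>k\<in>S. jap k powr (2 * (5/12)) * (g k)\<^sup>2)
        \<le> M\<^sup>2 * (R powr (-1/6) * M\<^sup>2)" for f g
    unfolding L2_set_def
  proof (rule real_le_lsqrt)
    have "(\<Sum>k\<in>K. (conv p q r S \<omega> f g k)\<^sup>2)
        \<le> W\<^sup>2 * (\<Sum>k\<in>S. jap k powr (2 * (5/12)) * (\<omega> k)\<^sup>2)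
          * (\<Sum>k\<in>S. jap k powr (2 * (5/12)) * (f k)\<^sup>2) * (\<Sum>k\<in>S. jap k powr (2 * (5/12)) * (g k)\<^sup>2)"
      using f0 g0 nonneg by (intro conv_sobolev pqr S K W) auto
    also have "\<dots> = W\<^sup>2 * (\<Sum>k\<in>S. jap k powr (2 * (5/12)) * (\<omega> k)\<^sup>2)
          * ((\<Sum>k\<in>S. jap k powr (2 * (5/12)) * (f k)\<^sup>2) * (\<Sum>k\<in>S. jap k powr (2 * (5/12)) * (g k)\<^sup>2))"
      by (simp only: mult.assoc)
    also have "\<dots> \<le> W\<^sup>2 * (2 * M)\<^sup>2 * (M\<^sup>2 * (R powr (-1/6) * M\<^sup>2))"
      by (intro mult_mono fg sum_jap_powr_le[OF H(1)]) (auto intro!: sum_nonneg mult_nonneg_nonneg nonneg)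
    also have "\<dots> = ?e\<^sup>2"
      unfolding R6 by (simp add: power_mult_distrib power2_eq_square power3_eq_cube mult_ac)
    finally show "(\<Sum>k\<in>K. (conv p q r S \<omega> f g k)\<^sup>2) \<le> ?e\<^sup>2" .
  qed (use e0 in \<open>auto intro!: sum_nonneg\<close>)
  have t2: "L2_set (conv p q r S \<omega> (lo \<alpha>) (hi \<beta>)) K \<le> ?e"
  proof (rule sob)
    show "(\<Sum>k\<in>S. jap k powr (2 * (5/12)) * (lo \<alpha> k)\<^sup>2) * (\<Sum>k\<in>S. jap k powr (2 * (5/12)) * (hi \<beta> k)\<^sup>2)
        \<le> M\<^sup>2 * (R powr (-1/6) * M\<^sup>2)"
      using lo0[of \<alpha>, OF nonneg(2)]
      by (intro mult_mono sum_jap_powr_le[OF H(2)] sum_high_le[OF R H(3), folded hi_def])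
        (auto intro!: sum_nonneg mult_nonneg_nonneg)
  qed (use lo0 nonneg in auto)
  have t3: "L2_set (conv p q r S \<omega> (hi \<alpha>) \<beta>) K \<le> ?e"
  proof (rule sob)
    have "(\<Sum>k\<in>S. jap k powr (2 * (5/12)) * (\<beta> k)\<^sup>2) * (\<Sum>k\<in>S. jap k powr (2 * (5/12)) * (hi \<alpha> k)\<^sup>2)
        \<le> M\<^sup>2 * (R powr (-1/6) * M\<^sup>2)"
      using nonneg(3)
      by (intro mult_mono sum_jap_powr_le[OF H(3)] sum_high_le[OF R H(2), folded hi_def])
        (auto intro!: sum_nonneg mult_nonneg_nonneg)
    then show "(\<Sum>k\<in>S. jap k powr (2 * (5/12)) * (hi \<alpha> k)\<^sup>2) * (\<Sum>k\<in>S. jap k powr (2 * (5/12)) * (\<beta> k)\<^sup>2)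
        \<le> M\<^sup>2 * (R powr (-1/6) * M\<^sup>2)"
      by (simp only: mult.commute)
  qed (use lo0 nonneg in auto)
  \<comment> \<open>Splitting \<open>\<beta>\<close> only where \<open>\<alpha>\<close> is low
    leaves three terms instead of four: low-low, and two terms with a high factor.\<close>
  have eq: "conv p q r S \<omega> \<alpha> \<beta> = (\<lambda>k. (conv p q r S \<omega> (lo \<alpha>) (lo \<beta>) k + conv p q r S \<omega> (lo \<alpha>) (hi \<beta>) k)
      + conv p q r S \<omega> (hi \<alpha>) \<beta> k)"
  proof
    fix k
    have "conv p q r S \<omega> \<alpha> \<beta> k = conv p q r S \<omega> (lo \<alpha>) \<beta> k + conv p q r S \<omega> (hi \<alpha>) \<beta> k"
      by (subst split[of \<alpha>]) (rule conv_add2)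
    also have "conv p q r S \<omega> (lo \<alpha>) \<beta> k = conv p q r S \<omega> (lo \<alpha>) (lo \<beta>) k + conv p q r S \<omega> (lo \<alpha>) (hi \<beta>) k"
      by (subst split[of \<beta>]) (rule conv_add3)
    finally show "conv p q r S \<omega> \<alpha> \<beta> k = (conv p q r S \<omega> (lo \<alpha>) (lo \<beta>) k
      + conv p q r S \<omega> (lo \<alpha>) (hi \<beta>) k) + conv p q r S \<omega> (hi \<alpha>) \<beta> k" .
  qed
  have "L2_set (conv p q r S \<omega> \<alpha> \<beta>) K
      \<le> (L2_set (conv p q r S \<omega> (lo \<alpha>) (lo \<beta>)) K + L2_set (conv p q r S \<omega> (lo \<alpha>) (hi \<beta>)) K)
        + L2_set (conv p q r S \<omega> (hi \<alpha>) \<beta>) K"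
    unfolding eq by (intro order_trans[OF L2_set_triangle_ineq] add_right_mono L2_set_triangle_ineq)
  also have "\<dots> \<le> (?L * M\<^sup>2 * y + ?e) + ?e"
    by (intro add_mono t1 t2 t3)
  finally show ?thesis by simp
qed

section \<open>Coefficients of the cubic term of a trigonometric polynomial: log-Lipschitz, tail and
  tame bounds\<close>

definition tcoeff :: "int set \<Rightarrow> (int \<Rightarrow> complex) \<Rightarrow> int \<Rightarrow> complex" where
  "tcoeff S a k = (\<Sum>(x, y, z)\<in>fib 1 (-1) 1 S k. a x * cnj (a y) * a z)"

lemma tcoeff_le_conv:
  "cmod (tcoeff S a k) \<le> conv 1 (-1) 1 S (\<lambda>k. cmod (a k)) (\<lambda>k. cmod (a k)) (\<lambda>k. cmod (a k)) k"
  unfolding tcoeff_def conv_def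
  by (rule order_trans[OF norm_sum]) (auto simp: norm_mult intro!: sum_mono)

text \<open>The factors are exchanged one at a time, so that each of the three terms carries the
  difference in exactly one slot.\<close>

lemma tcoeff_diff_le_conv:
  "cmod (tcoeff S a k - tcoeff S b k) \<le>
     (conv 1 (-1) 1 S (\<lambda>k. cmod (a k - b k)) (\<lambda>k. cmod (a k)) (\<lambda>k. cmod (a k)) k
      + conv 1 (-1) 1 S (\<lambda>k. cmod (b k)) (\<lambda>k. cmod (a k - b k)) (\<lambda>k. cmod (a k)) k)
      + conv 1 (-1) 1 S (\<lambda>k. cmod (b k)) (\<lambda>k. cmod (b k)) (\<lambda>k. cmod (a k - b k)) k"
proof -
  have pw: "cmod (a x * cnj (a y) * a z - b x * cnj (b y) * b z)
      \<le> (cmod (a x - b x) * cmod (a y) * cmod (a z) + cmod (b x) * cmod (a y - b y) * cmod (a z))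
        + cmod (b x) * cmod (b y) * cmod (a z - b z)" for x y z
  proof -
    have "a x * cnj (a y) * a z - b x * cnj (b y) * b z
        = ((a x - b x) * cnj (a y) * a z + b x * cnj (a y - b y) * a z) + b x * cnj (b y) * (a z - b z)"
      by (simp add: algebra_simps)
    then have "cmod (a x * cnj (a y) * a z - b x * cnj (b y) * b z)
        \<le> (cmod ((a x - b x) * cnj (a y) * a z) + cmod (b x * cnj (a y - b y) * a z))
          + cmod (b x * cnj (b y) * (a z - b z))"
      by (simp only:) (intro order_trans[OF norm_triangle_ineq] add_right_mono norm_triangle_ineq)
    then show ?thesis
      by (simp only: norm_mult complex_mod_cnj)
  qed
  have "cmod (tcoeff S a k - tcoeff S b k)
      \<le> (\<Sum>(x, y, z)\<in>fib 1 (-1) 1 S k. cmod (a x * cnj (a y) * a z - b x * cnj (b y) * b z))"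
    unfolding tcoeff_def sum_subtractf[symmetric]
    by (rule order_trans[OF norm_sum]) (auto intro!: sum_mono)
  also have "\<dots> \<le> (\<Sum>(x, y, z)\<in>fib 1 (-1) 1 S k. (cmod (a x - b x) * cmod (a y) * cmod (a z)
      + cmod (b x) * cmod (a y - b y) * cmod (a z)) + cmod (b x) * cmod (b y) * cmod (a z - b z))"
    by (rule sum_mono) (use pw in auto)
  also have "\<dots> = (conv 1 (-1) 1 S (\<lambda>k. cmod (a k - b k)) (\<lambda>k. cmod (a k)) (\<lambda>k. cmod (a k)) k
      + conv 1 (-1) 1 S (\<lambda>k. cmod (b k)) (\<lambda>k. cmod (a k - b k)) (\<lambda>k. cmod (a k)) k)
      + conv 1 (-1) 1 S (\<lambda>k. cmod (b k)) (\<lambda>k. cmod (b k)) (\<lambda>k. cmod (a k - b k)) k"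
    unfolding conv_def sum.distrib[symmetric] by (rule sum.cong) auto
  finally show ?thesis .
qed

text \<open>In each term the difference is moved to the first slot, where
  \<open>conv_low_high\<close> expects it, and \<open>R\<close> is then optimised. The number
  \<open>y\<close> is any upper bound of the l2 distance, not the distance itself, so that a
  majorant can be inserted later; \<open>D\<close> is an upper bound for \<open>y\<close> that keeps
  the logarithm nonnegative.\<close>

lemma tcoeff_log_Lipschitz:
  obtains C where "0 < C"
    "\<And>S K a b M D y. finite S \<Longrightarrow> finite K \<Longrightarrow> 1 \<le> M \<Longrightarrow> 1 \<le> D \<Longrightarrow> 0 < y \<Longrightarrow> y \<le> D \<Longrightarrow>
      (\<Sum>k\<in>S. jap k * (cmod (a k))\<^sup>2) \<le> M\<^sup>2 \<Longrightarrow> (\<Sum>k\<in>S. jap k * (cmod (b k))\<^sup>2) \<le> M\<^sup>2 \<Longrightarrow>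
      (\<Sum>k\<in>S. (cmod (a k - b k))\<^sup>2) \<le> y\<^sup>2 \<Longrightarrow>
      L2_set (\<lambda>k. cmod (tcoeff S a k - tcoeff S b k)) K \<le> C * M^3 * y * (1 + ln (D / y))"
proof -
  obtain W where W0: "0 \<le> W" and W: "\<And>F. finite F \<Longrightarrow> (\<Sum>k\<in>F. jap k powr (- (5/4))) \<le> W"
    using sum_jap_powr_bounded[of "5/4"] by auto
  show ?thesis
  proof
    \<comment> \<open>The 3 counts the slots that may carry the difference, 24 comes from
      \<open>2 * ln R\<close> with \<open>ln R = 12 * ln (D / y)\<close>, and \<open>4 * W\<close>
      from the high-frequency error. The exponent 5/4 in \<open>W\<close> is three times
      5/12.\<close>
    show "0 < 3 * (24 + 4 * W)" using W0 by simp
    fix S K :: "int set" and a b :: "int \<Rightarrow> complex" and M D y :: real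
    assume S: "finite S" and K: "finite K" and M: "1 \<le> M" and D: "1 \<le> D" and y: "0 < y" "y \<le> D"
      and Ha: "(\<Sum>k\<in>S. jap k * (cmod (a k))\<^sup>2) \<le> M\<^sup>2" and Hb: "(\<Sum>k\<in>S. jap k * (cmod (b k))\<^sup>2) \<le> M\<^sup>2"
      and w: "(\<Sum>k\<in>S. (cmod (a k - b k))\<^sup>2) \<le> y\<^sup>2"
    have Hw: "(\<Sum>k\<in>S. jap k * (cmod (a k - b k))\<^sup>2) \<le> (2 * M)\<^sup>2"
    proof -
      have "(cmod (a k - b k))\<^sup>2 \<le> 2 * (cmod (a k))\<^sup>2 + 2 * (cmod (b k))\<^sup>2" for k
      proof -
        have "(cmod (a k - b k))\<^sup>2 \<le> (cmod (a k) + cmod (b k))\<^sup>2"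
          by (intro power_mono norm_triangle_ineq4) auto
        also have "\<dots> \<le> 2 * (cmod (a k))\<^sup>2 + 2 * (cmod (b k))\<^sup>2"
          using sum_squares_bound[of "cmod (a k)" "cmod (b k)"] by (simp add: power2_sum)
        finally show ?thesis .
      qed
      then have "(\<Sum>k\<in>S. jap k * (cmod (a k - b k))\<^sup>2)
          \<le> (\<Sum>k\<in>S. jap k * (2 * (cmod (a k))\<^sup>2 + 2 * (cmod (b k))\<^sup>2))"
        by (intro sum_mono mult_left_mono) auto
      also have "\<dots> = 2 * (\<Sum>k\<in>S. jap k * (cmod (a k))\<^sup>2) + 2 * (\<Sum>k\<in>S. jap k * (cmod (b k))\<^sup>2)"
        by (simp add: sum_distrib_left sum.distrib algebra_simps)
      finally show ?thesis using Ha Hb by (simp add: power2_eq_square)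
    qed
    \<comment> \<open>The power 12 undoes the exponent -1/12 of the high-frequency gain, so the
      error becomes at most \<open>y\<close>, while \<open>ln R\<close> remains a multiple of
      \<open>ln (D / y)\<close>.\<close>
    define R where "R = (D / y) powr 12"
    have Dy: "1 \<le> D / y" using y by simp
    have R: "1 \<le> R" unfolding R_def using Dy by (simp add: ge_one_powr_ge_zero)
    have lnR: "ln R = 12 * ln (D / y)" unfolding R_def by (rule ln_powr)
    have R12: "R powr (-1/12) \<le> y"
    proof -
      have "R powr (-1/12) = (D / y) powr (-1)" unfolding R_def by (simp add: powr_powr)
      also have "\<dots> = y / D" using D y by (simp add: powr_minus field_simps)
      also have "\<dots> \<le> y / 1" using D y by (intro divide_left_mono) auto
      finally show ?thesis by simp
    qed
    have M3: "M\<^sup>2 \<le> M^3"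
      using M by (intro power_increasing) auto
    have ln0: "0 \<le> ln (D / y)" using Dy by simp
    let ?B = "(24 + 4 * W) * M^3 * y * (1 + ln (D / y))"
    have one: "L2_set (conv p q r S (\<lambda>k. cmod (a k - b k)) f g) K \<le> ?B"
      if pqr: "\<bar>p\<bar> = 1" "\<bar>q\<bar> = 1" "\<bar>r\<bar> = 1" and f: "\<And>k. 0 \<le> f k" "(\<Sum>k\<in>S. jap k * (f k)\<^sup>2) \<le> M\<^sup>2"
        and g: "\<And>k. 0 \<le> g k" "(\<Sum>k\<in>S. jap k * (g k)\<^sup>2) \<le> M\<^sup>2" for p q r f g
    proof -
      have "L2_set (conv p q r S (\<lambda>k. cmod (a k - b k)) f g) K
          \<le> (4 + 2 * ln R) * M\<^sup>2 * y + 4 * W * M^3 * R powr (-1/12)"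
        using M y by (intro conv_low_high pqr S K Hw f g w R W0) (auto simp: W[OF S])
      also have "\<dots> \<le> (24 + 24 * ln (D / y)) * M^3 * y + 4 * W * M^3 * (y * (1 + ln (D / y)))"
      proof (rule add_mono)
        show "(4 + 2 * ln R) * M\<^sup>2 * y \<le> (24 + 24 * ln (D / y)) * M^3 * y"
          unfolding lnR using ln0 M y M3 by (intro mult_mono) auto
        have "R powr (-1/12) \<le> y * (1 + ln (D / y))"
          using R12 y ln0 by (auto intro: order_trans simp: algebra_simps)
        then show "4 * W * M^3 * R powr (-1/12) \<le> 4 * W * M^3 * (y * (1 + ln (D / y)))"
          using W0 M by (intro mult_left_mono) auto
      qed
      also have "\<dots> = ?B"
        by (simp add: algebra_simps)
      finally show ?thesis .
    qed
    have "L2_set (\<lambda>k. cmod (tcoeff S a k - tcoeff S b k)) K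
        \<le> L2_set (\<lambda>k. (conv 1 (-1) 1 S (\<lambda>k. cmod (a k - b k)) (\<lambda>k. cmod (a k)) (\<lambda>k. cmod (a k)) k
          + conv 1 (-1) 1 S (\<lambda>k. cmod (b k)) (\<lambda>k. cmod (a k - b k)) (\<lambda>k. cmod (a k)) k)
          + conv 1 (-1) 1 S (\<lambda>k. cmod (b k)) (\<lambda>k. cmod (b k)) (\<lambda>k. cmod (a k - b k)) k) K"
      by (rule L2_set_mono) (auto intro: tcoeff_diff_le_conv)
    also have "\<dots> \<le> (L2_set (conv 1 (-1) 1 S (\<lambda>k. cmod (a k - b k)) (\<lambda>k. cmod (a k)) (\<lambda>k. cmod (a k))) K
        + L2_set (conv 1 (-1) 1 S (\<lambda>k. cmod (b k)) (\<lambda>k. cmod (a k - b k)) (\<lambda>k. cmod (a k))) K)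
        + L2_set (conv 1 (-1) 1 S (\<lambda>k. cmod (b k)) (\<lambda>k. cmod (b k)) (\<lambda>k. cmod (a k - b k))) K"
      by (intro order_trans[OF L2_set_triangle_ineq] add_right_mono L2_set_triangle_ineq)
    also have "\<dots> \<le> (?B + ?B) + ?B"
    proof (intro add_mono)
      show "L2_set (conv 1 (-1) 1 S (\<lambda>k. cmod (a k - b k)) (\<lambda>k. cmod (a k)) (\<lambda>k. cmod (a k))) K \<le> ?B"
        by (rule one) (use Ha in auto)
      show "L2_set (conv 1 (-1) 1 S (\<lambda>k. cmod (b k)) (\<lambda>k. cmod (a k - b k)) (\<lambda>k. cmod (a k))) K \<le> ?B"
        unfolding conv_swap12[of 1 "-1" 1] by (rule one) (use Ha Hb in auto)
      show "L2_set (conv 1 (-1) 1 S (\<lambda>k. cmod (b k)) (\<lambda>k. cmod (b k)) (\<lambda>k. cmod (a k - b k))) K \<le> ?B"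
      proof -
        have "conv 1 (-1) 1 S (\<lambda>k. cmod (b k)) (\<lambda>k. cmod (b k)) (\<lambda>k. cmod (a k - b k))
            = conv 1 (-1) 1 S (\<lambda>k. cmod (a k - b k)) (\<lambda>k. cmod (b k)) (\<lambda>k. cmod (b k))"
          by (rule ext) (rule conv_swap13)
        then show ?thesis
          by (rule ssubst) (rule one; use Hb in simp)
      qed
    qed
    finally show "L2_set (\<lambda>k. cmod (tcoeff S a k - tcoeff S b k)) K
        \<le> 3 * (24 + 4 * W) * M^3 * y * (1 + ln (D / y))"
      by (simp add: algebra_simps)
  qed
qed

text \<open>The output frequency is a signed sum of the inputs. The product form distributes a small
  power of the weight over all three factors, for \<open>tcoeff_tail\<close>; the sum form puts the
  full weight on one factor, for \<open>tcoeff_tame\<close>.\<close>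

lemma jap_fib:
  assumes "(x, y, z) \<in> fib 1 (-1) 1 S k"
  shows "jap k \<le> jap x * jap y * jap z" "jap k \<le> jap x + jap y + jap z"
proof -
  have k: "\<bar>k\<bar> \<le> \<bar>x\<bar> + \<bar>y\<bar> + \<bar>z\<bar>"
    using assms by (auto simp: fib_def)
  then have k': "real_of_int \<bar>k\<bar> \<le> real_of_int \<bar>x\<bar> + real_of_int \<bar>y\<bar> + real_of_int \<bar>z\<bar>"
    by (metis of_int_add of_int_le_iff)
  then show "jap k \<le> jap x + jap y + jap z"
    by (simp add: jap_def)
  have "1 + a + b + c \<le> (1 + a) * (1 + b) * (1 + c)" if "0 \<le> a" "0 \<le> b" "0 \<le> c" for a b c :: real
    using that by (simp add: algebra_simps)
  from this[of "real_of_int \<bar>x\<bar>" "real_of_int \<bar>y\<bar>" "real_of_int \<bar>z\<bar>"] k'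
  show "jap k \<le> jap x * jap y * jap z"
    by (simp add: jap_def)
qed

text \<open>The regularity 1/2 - 5/12 = 1/12 left over by \<open>conv_sobolev\<close> is moved to
  the output, since \<open>jap\<close> is submultiplicative along a fibre. The cubic term thus lies
  in \<open>H^(1/12)\<close>; this controls its L2 norm and later the error of the Galerkin
  cutoff.\<close>

lemma tcoeff_tail:
  obtains W where "0 < W"
    "\<And>S K a M. finite S \<Longrightarrow> finite K \<Longrightarrow> (\<Sum>k\<in>S. jap k * (cmod (a k))\<^sup>2) \<le> M\<^sup>2 \<Longrightarrow>
      (\<Sum>k\<in>K. jap k powr (1/6) * (cmod (tcoeff S a k))\<^sup>2) \<le> (W * M^3)\<^sup>2"
proof -
  obtain W where W0: "0 \<le> W" and W: "\<And>F. finite F \<Longrightarrow> (\<Sum>k\<in>F. jap k powr (- (5/4))) \<le> W"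
    using sum_jap_powr_bounded[of "5/4"] by auto
  show ?thesis
  proof
    show "0 < W + 1" using W0 by simp
    fix S K :: "int set" and a :: "int \<Rightarrow> complex" and M :: real
    assume S: "finite S" and K: "finite K" and H: "(\<Sum>k\<in>S. jap k * (cmod (a k))\<^sup>2) \<le> M\<^sup>2"
    define \<alpha> where "\<alpha> k = jap k powr (1/12) * cmod (a k)" for k
    have \<alpha>0: "0 \<le> \<alpha> k" for k by (simp add: \<alpha>_def)
    have le: "jap k powr (1/12) * cmod (tcoeff S a k) \<le> conv 1 (-1) 1 S \<alpha> \<alpha> \<alpha> k" for k
    proof -
      have "jap k powr (1/12) * cmod (tcoeff S a k) \<le> jap k powr (1/12) *
          conv 1 (-1) 1 S (\<lambda>k. cmod (a k)) (\<lambda>k. cmod (a k)) (\<lambda>k. cmod (a k)) k"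
        by (intro mult_left_mono tcoeff_le_conv) simp
      also have "\<dots> = (\<Sum>(x, y, z)\<in>fib 1 (-1) 1 S k. jap k powr (1/12) * (cmod (a x) * cmod (a y) * cmod (a z)))"
        unfolding conv_def sum_distrib_left by (rule sum.cong) auto
      also have "\<dots> \<le> (\<Sum>(x, y, z)\<in>fib 1 (-1) 1 S k. \<alpha> x * \<alpha> y * \<alpha> z)"
      proof (rule sum_mono, clarify)
        fix x y z assume xyz: "(x, y, z) \<in> fib 1 (-1) 1 S k"
        have "jap k powr (1/12) \<le> (jap x * jap y * jap z) powr (1/12)"
          by (intro powr_mono2 jap_fib(1)[OF xyz]) auto
        also have "\<dots> = jap x powr (1/12) * jap y powr (1/12) * jap z powr (1/12)"
          by (simp add: powr_mult)
        finally have "jap k powr (1/12) * (cmod (a x) * cmod (a y) * cmod (a z))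
            \<le> (jap x powr (1/12) * jap y powr (1/12) * jap z powr (1/12)) * (cmod (a x) * cmod (a y) * cmod (a z))"
          by (rule mult_right_mono) simp
        then show "jap k powr (1/12) * (cmod (a x) * cmod (a y) * cmod (a z)) \<le> \<alpha> x * \<alpha> y * \<alpha> z"
          by (simp add: \<alpha>_def mult_ac)
      qed
      finally show ?thesis by (simp add: conv_def)
    qed
    have \<alpha>H: "(\<Sum>k\<in>S. jap k powr (2 * (5/12)) * (\<alpha> k)\<^sup>2) = (\<Sum>k\<in>S. jap k * (cmod (a k))\<^sup>2)"
    proof (rule sum.cong[OF refl])
      fix k
      have "jap k powr (2 * (5/12)) * (jap k powr (1/12))\<^sup>2 = jap k"
        by (simp add: powr_power flip: powr_add)
      then show "jap k powr (2 * (5/12)) * (\<alpha> k)\<^sup>2 = jap k * (cmod (a k))\<^sup>2"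
        by (simp only: \<alpha>_def power_mult_distrib flip: mult.assoc)
    qed
    have "(\<Sum>k\<in>K. jap k powr (1/6) * (cmod (tcoeff S a k))\<^sup>2)
        = (\<Sum>k\<in>K. (jap k powr (1/12) * cmod (tcoeff S a k))\<^sup>2)"
      by (simp add: power_mult_distrib powr_power)
    also have "\<dots> \<le> (\<Sum>k\<in>K. (conv 1 (-1) 1 S \<alpha> \<alpha> \<alpha> k)\<^sup>2)"
      by (intro sum_mono power_mono le) simp
    also have "\<dots> \<le> W\<^sup>2 * (\<Sum>k\<in>S. jap k powr (2 * (5/12)) * (\<alpha> k)\<^sup>2)
        * (\<Sum>k\<in>S. jap k powr (2 * (5/12)) * (\<alpha> k)\<^sup>2) * (\<Sum>k\<in>S. jap k powr (2 * (5/12)) * (\<alpha> k)\<^sup>2)"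
      using W[OF S] by (intro conv_sobolev S K \<alpha>0) auto
    also have "\<dots> \<le> (W + 1)\<^sup>2 * M\<^sup>2 * M\<^sup>2 * M\<^sup>2"
      unfolding \<alpha>H using H W0
      by (intro mult_mono power_mono) (auto intro!: sum_nonneg mult_nonneg_nonneg)
    also have "\<dots> = ((W + 1) * M^3)\<^sup>2"
      by (simp add: power_mult_distrib power2_eq_square power3_eq_cube mult_ac)
    finally show "(\<Sum>k\<in>K. jap k powr (1/6) * (cmod (tcoeff S a k))\<^sup>2) \<le> ((W + 1) * M^3)\<^sup>2" .
  qed
qed

lemma powr_sum3_le:
  fixes x y z s :: real
  assumes "0 \<le> x" "0 \<le> y" "0 \<le> z" "0 \<le> s"
  shows "(x + y + z) powr s \<le> 3 powr s * (x powr s + y powr s + z powr s)"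
proof -
  define m where "m = max x (max y z)"
  have "(x + y + z) powr s \<le> (3 * m) powr s"
    using assms by (intro powr_mono2) (auto simp: m_def)
  also have "\<dots> = 3 powr s * m powr s"
    using assms by (intro powr_mult)
  also have "m powr s \<le> x powr s + y powr s + z powr s"
    by (auto simp: m_def max_def)
  finally show ?thesis by simp
qed

text \<open>The weight at the output is bounded by the sum of the weights at the inputs, so in each
  term one factor bears it and the two others stay in l1. The bound is linear in the
  \<open>H^s\<close> norm, as the logarithmic Gronwall argument requires.\<close>

lemma tcoeff_tame:
  assumes S: "finite S" and K: "finite K" and s: "0 \<le> s" and A: "(\<Sum>k\<in>S. cmod (a k)) \<le> A"
  shows "L2_set (\<lambda>k. jap k powr s * cmod (tcoeff S a k)) K
    \<le> 3 * 3 powr s * A\<^sup>2 * L2_set (\<lambda>k. jap k powr s * cmod (a k)) S"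
proof -
  define \<alpha> where "\<alpha> k = cmod (a k)" for k
  define \<beta> where "\<beta> k = jap k powr s * cmod (a k)" for k
  have nn: "0 \<le> \<alpha> k" "0 \<le> \<beta> k" for k by (auto simp: \<alpha>_def \<beta>_def)
  let ?T = "\<lambda>f g h k. 3 powr s * conv 1 (-1) 1 S f g h k"
  have le: "jap k powr s * cmod (tcoeff S a k) \<le> (?T \<beta> \<alpha> \<alpha> k + ?T \<alpha> \<beta> \<alpha> k) + ?T \<alpha> \<alpha> \<beta> k" for k
  proof -
    have "jap k powr s * cmod (tcoeff S a k) \<le> jap k powr s * conv 1 (-1) 1 S \<alpha> \<alpha> \<alpha> k"
      unfolding \<alpha>_def by (intro mult_left_mono tcoeff_le_conv) simp
    also have "\<dots> = (\<Sum>(x, y, z)\<in>fib 1 (-1) 1 S k. jap k powr s * (\<alpha> x * \<alpha> y * \<alpha> z))"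
      unfolding conv_def sum_distrib_left by (rule sum.cong) auto
    also have "\<dots> \<le> (\<Sum>(x, y, z)\<in>fib 1 (-1) 1 S k. (3 powr s * (\<beta> x * \<alpha> y * \<alpha> z)
        + 3 powr s * (\<alpha> x * \<beta> y * \<alpha> z)) + 3 powr s * (\<alpha> x * \<alpha> y * \<beta> z))"
    proof (rule sum_mono, clarify)
      fix x y z assume xyz: "(x, y, z) \<in> fib 1 (-1) 1 S k"
      have "jap k powr s \<le> (jap x + jap y + jap z) powr s"
        by (intro powr_mono2 jap_fib(2)[OF xyz] s) auto
      also have "\<dots> \<le> 3 powr s * (jap x powr s + jap y powr s + jap z powr s)"
        by (intro powr_sum3_le s) auto
      finally have "jap k powr s * (\<alpha> x * \<alpha> y * \<alpha> z)
          \<le> (3 powr s * (jap x powr s + jap y powr s + jap z powr s)) * (\<alpha> x * \<alpha> y * \<alpha> z)"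
        by (rule mult_right_mono) (use nn in simp)
      then show "jap k powr s * (\<alpha> x * \<alpha> y * \<alpha> z) \<le> (3 powr s * (\<beta> x * \<alpha> y * \<alpha> z)
          + 3 powr s * (\<alpha> x * \<beta> y * \<alpha> z)) + 3 powr s * (\<alpha> x * \<alpha> y * \<beta> z)"
        by (simp add: \<alpha>_def \<beta>_def algebra_simps)
    qed
    also have "\<dots> = (?T \<beta> \<alpha> \<alpha> k + ?T \<alpha> \<beta> \<alpha> k) + ?T \<alpha> \<alpha> \<beta> k"
      unfolding conv_def sum_distrib_left sum.distrib[symmetric] by (rule sum.cong) auto
    finally show ?thesis .
  qed
  have A0: "0 \<le> A"
    using A by (rule order_trans[rotated]) (simp add: sum_nonneg)
  let ?B = "3 powr s * (A\<^sup>2 * L2_set \<beta> S)"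
  have l1: "L2_set (conv p q r S \<alpha> \<alpha> \<beta>) K \<le> A\<^sup>2 * L2_set \<beta> S"
    if "\<bar>p\<bar> = 1" "\<bar>q\<bar> = 1" "\<bar>r\<bar> = 1" for p q r
    unfolding L2_set_def[of "conv p q r S \<alpha> \<alpha> \<beta>"]
  proof (rule real_le_lsqrt)
    have "(\<Sum>k\<in>K. (conv p q r S \<alpha> \<alpha> \<beta> k)\<^sup>2) \<le> (sum \<alpha> S * sum \<alpha> S)\<^sup>2 * (\<Sum>k\<in>S. (\<beta> k)\<^sup>2)"
      by (intro conv_l1_l1_l2 that S K nn)
    also have "\<dots> \<le> (A * A)\<^sup>2 * (\<Sum>k\<in>S. (\<beta> k)\<^sup>2)"
      using A A0 by (intro mult_right_mono power_mono mult_mono)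
        (auto simp: \<alpha>_def intro!: sum_nonneg mult_nonneg_nonneg)
    also have "\<dots> = (A\<^sup>2 * L2_set \<beta> S)\<^sup>2"
      by (simp add: L2_set_def power_mult_distrib sum_nonneg power2_eq_square)
    finally show "(\<Sum>k\<in>K. (conv p q r S \<alpha> \<alpha> \<beta> k)\<^sup>2) \<le> (A\<^sup>2 * L2_set \<beta> S)\<^sup>2" .
  qed (auto intro: sum_nonneg)
  have T: "L2_set (?T f g h) K \<le> ?B" if "L2_set (conv 1 (-1) 1 S f g h) K \<le> A\<^sup>2 * L2_set \<beta> S" for f g h
  proof -
    have "L2_set (?T f g h) K = 3 powr s * L2_set (conv 1 (-1) 1 S f g h) K"
      by (rule L2_set_right_distrib[symmetric]) simp
    then show ?thesis using that by simp
  qed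
  have "L2_set (\<lambda>k. jap k powr s * cmod (tcoeff S a k)) K
      \<le> L2_set (\<lambda>k. (?T \<beta> \<alpha> \<alpha> k + ?T \<alpha> \<beta> \<alpha> k) + ?T \<alpha> \<alpha> \<beta> k) K"
    by (rule L2_set_mono) (auto intro: le)
  also have "\<dots> \<le> (L2_set (?T \<beta> \<alpha> \<alpha>) K + L2_set (?T \<alpha> \<beta> \<alpha>) K) + L2_set (?T \<alpha> \<alpha> \<beta>) K"
    by (intro order_trans[OF L2_set_triangle_ineq] add_right_mono L2_set_triangle_ineq)
  also have "\<dots> \<le> (?B + ?B) + ?B"
  proof (intro add_mono T)
    show "L2_set (conv 1 (-1) 1 S \<alpha> \<alpha> \<beta>) K \<le> A\<^sup>2 * L2_set \<beta> S"
      by (rule l1) auto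
    show "L2_set (conv 1 (-1) 1 S \<beta> \<alpha> \<alpha>) K \<le> A\<^sup>2 * L2_set \<beta> S"
    proof -
      have "conv 1 (-1) 1 S \<beta> \<alpha> \<alpha> = conv 1 (-1) 1 S \<alpha> \<alpha> \<beta>"
        by (rule ext) (rule conv_swap13)
      then show ?thesis
        by (rule ssubst) (rule l1; simp)
    qed
    show "L2_set (conv 1 (-1) 1 S \<alpha> \<beta> \<alpha>) K \<le> A\<^sup>2 * L2_set \<beta> S"
      unfolding conv_swap12[of 1 "-1" 1] conv_swap13[of "-1" 1 1] by (rule l1) auto
  qed
  finally show ?thesis
    by (simp add: \<beta>_def[abs_def] mult_ac)
qed

section \<open>The cubic nonlinearity on \<open>H\<^sup>1\<^sup>/\<^sup>2\<close>\<close>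

lemma abs_l2_circle_add:
  assumes "square_integrable f" "square_integrable g"
  shows "abs_l2_circle (\<lambda>z. f z + g z) = abs_l2_circle f + abs_l2_circle g"
  using plus_l2_circle.abs_eq[of f g] assms by (simp add: eq_onp_def)

lemma abs_l2_circle_cscale:
  assumes "square_integrable f"
  shows "abs_l2_circle (\<lambda>z. c * f z) = cscale c (abs_l2_circle f)"
  using cscale.abs_eq[of f c] assms by (simp add: eq_onp_def)

lemma character_eq_abs: "character k = abs_l2_circle (\<lambda>z. z powi k)"
  by (simp add: character_def)

lemma square_integrable_sum:
  assumes "\<And>i. i \<in> I \<Longrightarrow> square_integrable (f i)"
  shows "square_integrable (\<lambda>z. \<Sum>i\<in>I. f i z)"
  using assms
  by (induction I rule: infinite_finite_induct) (auto intro: square_integrable_add square_integrable_zero)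

lemma abs_l2_circle_sum:
  assumes "\<And>i. i \<in> I \<Longrightarrow> square_integrable (f i)"
  shows "abs_l2_circle (\<lambda>z. \<Sum>i\<in>I. f i z) = (\<Sum>i\<in>I. abs_l2_circle (f i))"
  using assms
proof (induction I rule: infinite_finite_induct)
  case (insert i I)
  then show ?case
    by (simp add: abs_l2_circle_add square_integrable_sum)
qed (simp_all add: zero_l2_circle_def)

lemma abs_l2_circle_eqI:
  assumes "square_integrable f" "g \<in> borel_measurable borel" "AE z in circle_measure. f z = g z"
  shows "square_integrable g" "abs_l2_circle f = abs_l2_circle g"
proof -
  have [measurable]: "f \<in> borel_measurable borel" "g \<in> borel_measurable borel"
    using assms by (auto simp: square_integrable_def)
  have "integrable circle_measure (\<lambda>z. (cmod (f z))\<^sup>2) \<longleftrightarrow> integrable circle_measure (\<lambda>z. (cmod (g z))\<^sup>2)"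
    by (rule integrable_cong_AE) (use assms(3) in auto)
  then show g: "square_integrable g"
    using assms by (auto simp: square_integrable_def)
  show "abs_l2_circle f = abs_l2_circle g"
    using assms g Quotient_rel_abs[OF Quotient_l2_circle] by (auto simp: l2_rel_def)
qed

text \<open>The second hypothesis rules out the dummy value 0 of \<open>cubic\<close>.\<close>

lemma cubic_abs_l2_circle:
  assumes "square_integrable f" "square_integrable (\<lambda>z. complex_of_real ((cmod (f z))\<^sup>2) * f z)"
  shows "cubic (abs_l2_circle f) = abs_l2_circle (\<lambda>z. complex_of_real ((cmod (f z))\<^sup>2) * f z)"
  using cubic.abs_eq[of f] assms by (simp add: eq_onp_def Let_def)

definition trigf :: "int set \<Rightarrow> (int \<Rightarrow> complex) \<Rightarrow> complex \<Rightarrow> complex" where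
  "trigf S a z = (\<Sum>k\<in>S. a k * z powi k)"

lemma square_integrable_trigf: "square_integrable (trigf S a)"
  unfolding trigf_def[abs_def]
  by (intro square_integrable_sum square_integrable_mult square_integrable_powi)

lemma trig_eq_abs: "trig S a = abs_l2_circle (trigf S a)"
  unfolding trigf_def[abs_def] trig_def character_eq_abs
  by (subst abs_l2_circle_sum)
    (auto intro!: square_integrable_mult square_integrable_powi sum.cong
      simp: abs_l2_circle_cscale square_integrable_powi)

text \<open>On the unit circle conjugation is inversion, so \<open>f * cnj f * f\<close> is again a
  Laurent polynomial. Off the circle this fails; in L2 the identity is applied almost
  everywhere.\<close>

lemma cube_trigf:
  assumes "cmod z = 1"
  shows "complex_of_real ((cmod (trigf S a z))\<^sup>2) * trigf S a z
    = (\<Sum>i\<in>S \<times> S \<times> S. (case i of (x, y, t) \<Rightarrow> a x * cnj (a y) * a t) * z powi (case i of (x, y, t) \<Rightarrow> x - y + t))"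
proof -
  have z: "z \<noteq> 0" "cnj z = inverse z"
    using assms cnj_eq_inverse_circle by auto
  have cnj: "cnj (trigf S a z) = (\<Sum>k\<in>S. cnj (a k) * z powi (- k))"
    unfolding trigf_def by (simp add: z power_int_minus power_int_inverse)
  have "complex_of_real ((cmod (trigf S a z))\<^sup>2) * trigf S a z
      = trigf S a z * (cnj (trigf S a z) * trigf S a z)"
    using complex_norm_square[of "trigf S a z"] by (simp add: mult_ac)
  also have "\<dots> = (\<Sum>i\<in>S \<times> S \<times> S. case i of (x, y, t) \<Rightarrow>
      (a x * z powi x) * ((cnj (a y) * z powi (- y)) * (a t * z powi t)))"
    unfolding cnj unfolding trigf_def sum_product sum.cartesian_product[symmetric]
    by (simp only: sum_product sum_distrib_left sum_distrib_right)
  also have "\<dots> = (\<Sum>i\<in>S \<times> S \<times> S. (case i of (x, y, t) \<Rightarrow> a x * cnj (a y) * a t)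
      * z powi (case i of (x, y, t) \<Rightarrow> x - y + t))"
    by (rule sum.cong) (auto simp: z power_int_add power_int_diff power_int_minus divide_inverse mult_ac)
  finally show ?thesis .
qed

lemma cubic_trigf:
  shows "square_integrable (\<lambda>z. complex_of_real ((cmod (trigf S a z))\<^sup>2) * trigf S a z)"
    and "cubic (trig S a) = (\<Sum>i\<in>S \<times> S \<times> S. cscale (case i of (x, y, t) \<Rightarrow> a x * cnj (a y) * a t)
      (character (case i of (x, y, t) \<Rightarrow> x - y + t)))"
proof -
  let ?g = "\<lambda>z. \<Sum>i\<in>S \<times> S \<times> S. (case i of (x, y, t) \<Rightarrow> a x * cnj (a y) * a t)
    * z powi (case i of (x, y, t) \<Rightarrow> x - y + t)"
  let ?v = "\<lambda>z. complex_of_real ((cmod (trigf S a z))\<^sup>2) * trigf S a z"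
  have g: "square_integrable ?g"
    by (intro square_integrable_sum square_integrable_mult square_integrable_powi)
  have [measurable]: "trigf S a \<in> borel_measurable borel"
    using square_integrable_trigf by (simp add: square_integrable_def)
  have v: "?v \<in> borel_measurable borel"
    by measurable
  have AE: "AE z in circle_measure. ?g z = ?v z"
    using AE_circle_norm by eventually_elim (rule cube_trigf[symmetric])
  show sq: "square_integrable ?v"
    by (rule abs_l2_circle_eqI(1)[OF g v AE])
  have "cubic (trig S a) = abs_l2_circle ?v"
    unfolding trig_eq_abs by (rule cubic_abs_l2_circle[OF square_integrable_trigf sq])
  also have "\<dots> = abs_l2_circle ?g"
    by (rule abs_l2_circle_eqI(2)[OF g v AE, symmetric])
  also have "\<dots> = (\<Sum>i\<in>S \<times> S \<times> S. cscale (case i of (x, y, t) \<Rightarrow> a x * cnj (a y) * a t)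
      (character (case i of (x, y, t) \<Rightarrow> x - y + t)))"
    by (subst abs_l2_circle_sum)
      (auto intro!: square_integrable_mult square_integrable_powi
        simp: abs_l2_circle_cscale square_integrable_powi character_eq_abs)
  finally show "cubic (trig S a) = (\<Sum>i\<in>S \<times> S \<times> S. cscale (case i of (x, y, t) \<Rightarrow> a x * cnj (a y) * a t)
      (character (case i of (x, y, t) \<Rightarrow> x - y + t)))" .
qed

lemma fourier_coeff_cubic_trig:
  assumes "finite S"
  shows "fourier_coeff (cubic (trig S a)) k = tcoeff S a k"
proof -
  have "fourier_coeff (cubic (trig S a)) k = (\<Sum>i\<in>S \<times> S \<times> S.
      if (case i of (x, y, t) \<Rightarrow> x - y + t) = k then (case i of (x, y, t) \<Rightarrow> a x * cnj (a y) * a t) else 0)"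
    unfolding cubic_trigf(2) fourier_coeff_sum by (rule sum.cong) auto
  also have "\<dots> = tcoeff S a k"
    unfolding tcoeff_def fib_eq using assms by (subst sum.inter_filter[symmetric]) auto
  finally show ?thesis .
qed

text \<open>Weighted bounds are stated through finite sums: they carry no summability side condition and are
  closed under limits in L2.\<close>

definition wbound :: "(int \<Rightarrow> real) \<Rightarrow> real \<Rightarrow> l2_circle \<Rightarrow> bool" where
  "wbound w M u \<longleftrightarrow> (\<forall>S. finite S \<longrightarrow> (\<Sum>k\<in>S. w k * (cmod (fourier_coeff u k))\<^sup>2) \<le> M\<^sup>2)"

lemma wboundD: "wbound w M u \<Longrightarrow> finite S \<Longrightarrow> (\<Sum>k\<in>S. w k * (cmod (fourier_coeff u k))\<^sup>2) \<le> M\<^sup>2"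
  by (simp add: wbound_def)

lemma wbound_tendsto:
  assumes "X \<longlonglongrightarrow> x" "\<And>n. wbound w M (X n)"
  shows "wbound w M x"
  unfolding wbound_def
proof (intro allI impI)
  fix S :: "int set" assume S: "finite S"
  show "(\<Sum>k\<in>S. w k * (cmod (fourier_coeff x k))\<^sup>2) \<le> M\<^sup>2"
  proof (rule LIMSEQ_le_const2)
    show "(\<lambda>n. \<Sum>k\<in>S. w k * (cmod (fourier_coeff (X n) k))\<^sup>2) \<longlonglongrightarrow> (\<Sum>k\<in>S. w k * (cmod (fourier_coeff x k))\<^sup>2)"
      by (intro tendsto_intros tendsto_fourier_coeff assms)
    show "\<exists>N. \<forall>n\<ge>N. (\<Sum>k\<in>S. w k * (cmod (fourier_coeff (X n) k))\<^sup>2) \<le> M\<^sup>2"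
      using wboundD[OF assms(2) S] by blast
  qed
qed

lemma wbound_mono:
  assumes "wbound w M u" "\<And>k. 0 \<le> w' k" "\<And>k. w' k \<le> w k"
    "\<And>k. cmod (fourier_coeff v k) \<le> cmod (fourier_coeff u k)"
  shows "wbound w' M v"
  unfolding wbound_def
proof (intro allI impI)
  fix S :: "int set" assume S: "finite S"
  have "(\<Sum>k\<in>S. w' k * (cmod (fourier_coeff v k))\<^sup>2) \<le> (\<Sum>k\<in>S. w k * (cmod (fourier_coeff u k))\<^sup>2)"
    by (intro sum_mono mult_mono power_mono assms) (auto intro: order_trans[OF assms(2,3)])
  also have "\<dots> \<le> M\<^sup>2" by (rule wboundD[OF assms(1) S])
  finally show "(\<Sum>k\<in>S. w' k * (cmod (fourier_coeff v k))\<^sup>2) \<le> M\<^sup>2" .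
qed

lemma wbound_trig:
  assumes "wbound w M u" "\<And>k. 0 \<le> w k" "finite S"
  shows "wbound w M (trig S (fourier_coeff u))"
  by (rule wbound_mono[OF assms(1,2)]) (use assms(3) in auto)

lemma wbound_mono_bound: "wbound w M u \<Longrightarrow> \<bar>M\<bar> \<le> N \<Longrightarrow> wbound w N u"
  unfolding wbound_def using power_mono[of "\<bar>M\<bar>" N 2] by (auto intro: order_trans)

lemma wbound_imp_norm_le:
  assumes "wbound w M u" "\<And>k. 1 \<le> w k" "0 \<le> M"
  shows "norm u \<le> M"
proof (rule norm_le_fourier_coeffI)
  show "(\<Sum>k\<in>S. (cmod (fourier_coeff u k))\<^sup>2) \<le> M\<^sup>2" if "finite S" for S
    using wboundD[OF wbound_mono[OF assms(1), of "\<lambda>_. 1" u] that] assms(2) by simp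
qed fact

section \<open>From trigonometric polynomials to all of \<open>H^(1/2)\<close>\<close>

lemma tendsto_x_log: "((\<lambda>y::real. y * (1 + ln (D / y))) \<longlongrightarrow> 0) (at_right 0)" if "D > 0"
  using that by real_asymp

lemma small_x_log:
  assumes "0 < D" "0 < e"
  obtains y :: real where "0 < y" "y \<le> D" "B * (y * (1 + ln (D / y))) < e"
proof -
  have "((\<lambda>y::real. B * (y * (1 + ln (D / y)))) \<longlongrightarrow> B * 0) (at_right 0)"
    by (intro tendsto_intros tendsto_x_log assms)
  then have "\<forall>\<^sub>F y in at_right 0. B * (y * (1 + ln (D / y))) < e"
    using assms by (intro order_tendstoD(2)) auto
  moreover have "\<forall>\<^sub>F y in at_right 0. 0 < y \<and> y < D"
    using assms by (auto simp: eventually_at_right_field)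
  ultimately have "\<forall>\<^sub>F y in at_right 0. 0 < y \<and> y \<le> D \<and> B * (y * (1 + ln (D / y))) < e"
    by eventually_elim auto
  then obtain y where "0 < y" "y \<le> D" "B * (y * (1 + ln (D / y))) < e"
    using eventually_happens'[OF trivial_limit_at_right_real] by blast
  then show ?thesis by (rule that)
qed

lemma norm_cubic_trig_diff:
  obtains C where "0 < C"
    "\<And>S R a b M D y. finite S \<Longrightarrow> finite R \<Longrightarrow> 1 \<le> M \<Longrightarrow> 1 \<le> D \<Longrightarrow> 0 < y \<Longrightarrow> y \<le> D \<Longrightarrow>
      wbound jap M (trig S a) \<Longrightarrow> wbound jap M (trig R b) \<Longrightarrow> norm (trig S a - trig R b) \<le> y \<Longrightarrow>
      norm (cubic (trig S a) - cubic (trig R b)) \<le> C * M^3 * y * (1 + ln (D / y))"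
proof -
  obtain C where C0: "0 < C" and C: "\<And>S K a b M D y. finite S \<Longrightarrow> finite K \<Longrightarrow> 1 \<le> M \<Longrightarrow> 1 \<le> D \<Longrightarrow> 0 < y \<Longrightarrow> y \<le> D \<Longrightarrow>
      (\<Sum>k\<in>S. jap k * (cmod (a k))\<^sup>2) \<le> M\<^sup>2 \<Longrightarrow> (\<Sum>k\<in>S. jap k * (cmod (b k))\<^sup>2) \<le> M\<^sup>2 \<Longrightarrow>
      (\<Sum>k\<in>S. (cmod (a k - b k))\<^sup>2) \<le> y\<^sup>2 \<Longrightarrow>
      L2_set (\<lambda>k. cmod (tcoeff S a k - tcoeff S b k)) K \<le> C * M^3 * y * (1 + ln (D / y))"
    using tcoeff_log_Lipschitz by blast
  show ?thesis
  proof (rule that[OF C0])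
    fix S R :: "int set" and a b :: "int \<Rightarrow> complex" and M D y :: real
    assume S: "finite S" and R: "finite R" and M: "1 \<le> M" and D: "1 \<le> D" and y: "0 < y" "y \<le> D"
      and HS: "wbound jap M (trig S a)" and HR: "wbound jap M (trig R b)"
      and le: "norm (trig S a - trig R b) \<le> y"
    \<comment> \<open>Extension by zero brings both polynomials to one frequency set, as
      \<open>tcoeff_log_Lipschitz\<close> compares coefficients on a common set.\<close>
    define T where "T = S \<union> R"
    define a' where "a' k = (if k \<in> S then a k else 0)" for k
    define b' where "b' k = (if k \<in> R then b k else 0)" for k
    have T: "finite T" using S R by (simp add: T_def)
    have eqS: "trig S a = trig T a'"
      by (rule fourier_coeff_eqI) (use S T in \<open>auto simp: a'_def T_def\<close>)
    have eqR: "trig R b = trig T b'"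
      by (rule fourier_coeff_eqI) (use R T in \<open>auto simp: b'_def T_def\<close>)
    show "norm (cubic (trig S a) - cubic (trig R b)) \<le> C * M^3 * y * (1 + ln (D / y))"
    proof (rule norm_le_fourier_coeffI)
      have ln0: "0 \<le> ln (D / y)" using D y by simp
      then show B0: "0 \<le> C * M^3 * y * (1 + ln (D / y))"
        using C0 M y by (intro mult_nonneg_nonneg) auto
      fix K :: "int set" assume K: "finite K"
      have "L2_set (\<lambda>k. cmod (tcoeff T a' k - tcoeff T b' k)) K \<le> C * M^3 * y * (1 + ln (D / y))"
      proof (rule C[OF T K M D y])
        show "(\<Sum>k\<in>T. jap k * (cmod (a' k))\<^sup>2) \<le> M\<^sup>2"
          using wboundD[OF HS T] T by (simp add: eqS)
        show "(\<Sum>k\<in>T. jap k * (cmod (b' k))\<^sup>2) \<le> M\<^sup>2"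
          using wboundD[OF HR T] T by (simp add: eqR)
        have "(\<Sum>k\<in>T. (cmod (fourier_coeff (trig S a - trig R b) k))\<^sup>2) \<le> (norm (trig S a - trig R b))\<^sup>2"
          by (rule Bessel[OF T])
        also have "\<dots> \<le> y\<^sup>2" using le by (intro power_mono) auto
        finally show "(\<Sum>k\<in>T. (cmod (a' k - b' k))\<^sup>2) \<le> y\<^sup>2"
          using T by (simp add: eqS eqR fourier_coeff_diff)
      qed
      then show "(\<Sum>k\<in>K. (cmod (fourier_coeff (cubic (trig S a) - cubic (trig R b)) k))\<^sup>2)
          \<le> (C * M^3 * y * (1 + ln (D / y)))\<^sup>2"
        unfolding eqS eqR fourier_coeff_diff fourier_coeff_cubic_trig[OF T] L2_set_def
        by (rule sqrt_le_D)
    qed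
  qed
qed

text \<open>The cubes of the partial sums are Cauchy in L2 by the log-Lipschitz bound, and pointwise
  convergence along a subsequence identifies their limit as \<open>|u|^2 u\<close>. In particular
  this function is square integrable, so \<open>cubic u\<close> is not the dummy; this takes the
  place of the Sobolev embedding into L6.\<close>

lemma cubic_trig_tendsto:
  assumes u: "wbound jap M u"
  shows "(\<lambda>n. cubic (trig {- int n..int n} (fourier_coeff u))) \<longlonglongrightarrow> cubic u"
proof -
  define P where "P n = trig {- int n..int n} (fourier_coeff u)" for n :: nat
  define F where "F n = trigf {- int n..int n} (fourier_coeff u)" for n :: nat
  define V where "V n z = complex_of_real ((cmod (F n z))\<^sup>2) * F n z" for n z
  have PF: "P n = abs_l2_circle (F n)" for n
    by (simp add: P_def F_def trig_eq_abs)
  have sqF: "square_integrable (F n)" for n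
    unfolding F_def by (rule square_integrable_trigf)
  have sqV: "square_integrable (V n)" for n
    unfolding V_def F_def by (rule cubic_trigf(1))
  have cV: "cubic (P n) = abs_l2_circle (V n)" for n
    using sqF sqV unfolding PF V_def by (rule cubic_abs_l2_circle)
  have Plim: "P \<longlonglongrightarrow> u"
    unfolding P_def by (rule fourier_partial_sums_tendsto)
  have bound: "wbound jap (max 1 \<bar>M\<bar>) (P n)" for n
    unfolding P_def by (intro wbound_trig wbound_mono_bound[OF u]) auto
  have "Cauchy (\<lambda>n. cubic (P n))"
  proof (rule CauchyI)
    fix e :: real assume e: "0 < e"
    obtain C where C: "\<And>S R a M D y. finite S \<Longrightarrow> finite R \<Longrightarrow> 1 \<le> M \<Longrightarrow> 1 \<le> D \<Longrightarrow> 0 < y \<Longrightarrow> y \<le> D \<Longrightarrow>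
        wbound jap M (trig S a) \<Longrightarrow> wbound jap M (trig R (fourier_coeff u)) \<Longrightarrow>
        norm (trig S a - trig R (fourier_coeff u)) \<le> y \<Longrightarrow>
        norm (cubic (trig S a) - cubic (trig R (fourier_coeff u))) \<le> C * M^3 * y * (1 + ln (D / y))"
      using norm_cubic_trig_diff by metis
    obtain y :: real where y: "0 < y" "y \<le> 1" "C * (max 1 \<bar>M\<bar>)^3 * (y * (1 + ln (1 / y))) < e"
      using small_x_log[OF zero_less_one e] by blast
    obtain N where N: "\<And>m n. m \<ge> N \<Longrightarrow> n \<ge> N \<Longrightarrow> norm (P m - P n) < y"
      using CauchyD[OF LIMSEQ_imp_Cauchy[OF Plim] y(1)] by blast
    have "norm (cubic (P m) - cubic (P n)) < e" if "m \<ge> N" "n \<ge> N" for m n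
    proof -
      have "norm (cubic (P m) - cubic (P n)) \<le> C * (max 1 \<bar>M\<bar>)^3 * y * (1 + ln (1 / y))"
        using bound[of m] bound[of n] N[OF that] y unfolding P_def
        by (intro C) auto
      then show ?thesis using y(3) by (simp add: mult.assoc)
    qed
    then show "\<exists>N. \<forall>m\<ge>N. \<forall>n\<ge>N. norm (cubic (P m) - cubic (P n)) < e" by blast
  qed
  then obtain g' where g': "(\<lambda>n. cubic (P n)) \<longlonglongrightarrow> g'"
    using Cauchy_convergent_iff convergent_def by blast
  obtain g where g: "square_integrable g" "g' = abs_l2_circle g"
    by (rule l2_circle_cases)
  obtain f where f: "square_integrable f" "u = abs_l2_circle f"
    by (rule l2_circle_cases)
  \<comment> \<open>One subsequence makes the partial sums converge almost everywhere, a further one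
    their cubes; along the latter both limits can be compared pointwise.\<close>
  obtain r :: "nat \<Rightarrow> nat" where r: "strict_mono r"
    and rF: "AE z in circle_measure. (\<lambda>n. F (r n) z) \<longlonglongrightarrow> f z"
    using l2_circle_AE_subseq[of F, OF sqF f(1)] Plim unfolding PF f(2) by blast
  have "(\<lambda>n. abs_l2_circle (V (r n))) \<longlonglongrightarrow> abs_l2_circle g"
    using LIMSEQ_subseq_LIMSEQ[OF g' r] unfolding cV g(2) by (simp add: o_def)
  then obtain r' :: "nat \<Rightarrow> nat" where r': "strict_mono r'"
    and rV: "AE z in circle_measure. (\<lambda>n. V (r (r' n)) z) \<longlonglongrightarrow> g z"
    using l2_circle_AE_subseq[of "\<lambda>n. V (r n)", OF sqV g(1)] by blast
  have AE: "AE z in circle_measure. g z = complex_of_real ((cmod (f z))\<^sup>2) * f z"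
    using rF rV
  proof eventually_elim
    case (elim z)
    have "(\<lambda>n. F (r (r' n)) z) \<longlonglongrightarrow> f z"
      using LIMSEQ_subseq_LIMSEQ[OF elim(1) r'] by (simp add: o_def)
    then have "(\<lambda>n. V (r (r' n)) z) \<longlonglongrightarrow> complex_of_real ((cmod (f z))\<^sup>2) * f z"
      unfolding V_def by (intro tendsto_intros)
    then show ?case using elim(2) by (rule LIMSEQ_unique[rotated])
  qed
  have [measurable]: "f \<in> borel_measurable borel"
    using f by (simp add: square_integrable_def)
  have meas: "(\<lambda>z. complex_of_real ((cmod (f z))\<^sup>2) * f z) \<in> borel_measurable borel"
    by measurable
  have "cubic u = abs_l2_circle (\<lambda>z. complex_of_real ((cmod (f z))\<^sup>2) * f z)"
    unfolding f(2) by (rule cubic_abs_l2_circle[OF f(1) abs_l2_circle_eqI(1)[OF g(1) meas AE]])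
  also have "\<dots> = g'"
    unfolding g(2) by (rule abs_l2_circle_eqI(2)[OF g(1) meas AE, symmetric])
  finally show ?thesis using g' by (simp add: P_def)
qed

lemma norm_trig_diff_le:
  assumes "finite S"
  shows "norm (trig S (fourier_coeff u) - trig S (fourier_coeff v)) \<le> norm (u - v)"
proof (rule power2_le_imp_le)
  have "trig S (fourier_coeff u) - trig S (fourier_coeff v) = trig S (fourier_coeff (u - v))"
    by (rule fourier_coeff_eqI) (use assms in \<open>simp add: fourier_coeff_diff\<close>)
  then show "(norm (trig S (fourier_coeff u) - trig S (fourier_coeff v)))\<^sup>2 \<le> (norm (u - v))\<^sup>2"
    using Bessel[OF assms, of "u - v"] norm_trig[OF assms, of "fourier_coeff (u - v)"] by simp
qed simp

text \<open>Partial sums inherit the bound \<open>M\<close> and the closeness in L2, and the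
  constants do not depend on the cutoff, so the inequality for polynomials passes to the
  limit.\<close>

lemma cubic_log_Lipschitz:
  obtains C where "0 < C"
    "\<And>u v M D y. 1 \<le> M \<Longrightarrow> 1 \<le> D \<Longrightarrow> 0 < y \<Longrightarrow> y \<le> D \<Longrightarrow>
      wbound jap M u \<Longrightarrow> wbound jap M v \<Longrightarrow> norm (u - v) \<le> y \<Longrightarrow>
      norm (cubic u - cubic v) \<le> C * M^3 * y * (1 + ln (D / y))"
proof -
  obtain C where C0: "0 < C" and C: "\<And>S R a b M D y. finite S \<Longrightarrow> finite R \<Longrightarrow> 1 \<le> M \<Longrightarrow> 1 \<le> D \<Longrightarrow> 0 < y \<Longrightarrow> y \<le> D \<Longrightarrow>
      wbound jap M (trig S a) \<Longrightarrow> wbound jap M (trig R b) \<Longrightarrow> norm (trig S a - trig R b) \<le> y \<Longrightarrow>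
      norm (cubic (trig S a) - cubic (trig R b)) \<le> C * M^3 * y * (1 + ln (D / y))"
    using norm_cubic_trig_diff by blast
  show ?thesis
  proof (rule that[OF C0])
    fix u v :: l2_circle and M D y :: real
    assume M: "1 \<le> M" and D: "1 \<le> D" and y: "0 < y" "y \<le> D"
      and u: "wbound jap M u" and v: "wbound jap M v" and uv: "norm (u - v) \<le> y"
    let ?P = "\<lambda>n u. trig {- int n..int n} (fourier_coeff u)"
    show "norm (cubic u - cubic v) \<le> C * M^3 * y * (1 + ln (D / y))"
    proof (rule LIMSEQ_le_const2)
      show "(\<lambda>n. norm (cubic (?P n u) - cubic (?P n v))) \<longlonglongrightarrow> norm (cubic u - cubic v)"
        by (intro tendsto_intros cubic_trig_tendsto[OF u] cubic_trig_tendsto[OF v])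
      show "\<exists>N. \<forall>n\<ge>N. norm (cubic (?P n u) - cubic (?P n v)) \<le> C * M^3 * y * (1 + ln (D / y))"
        by (intro exI allI impI C M D y wbound_trig u v order_trans[OF norm_trig_diff_le uv]) auto
    qed
  qed
qed

lemma cubic_wbound_tail:
  obtains W where "0 < W"
    "\<And>u M. wbound jap M u \<Longrightarrow> wbound (\<lambda>k. jap k powr (1/6)) (W * M^3) (cubic u)"
proof -
  obtain W where W0: "0 < W" and W: "\<And>S K a M. finite S \<Longrightarrow> finite K \<Longrightarrow> (\<Sum>k\<in>S. jap k * (cmod (a k))\<^sup>2) \<le> M\<^sup>2 \<Longrightarrow>
      (\<Sum>k\<in>K. jap k powr (1/6) * (cmod (tcoeff S a k))\<^sup>2) \<le> (W * M^3)\<^sup>2"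
    using tcoeff_tail by blast
  show ?thesis
  proof (rule that[OF W0])
    fix u M assume u: "wbound jap M u"
    show "wbound (\<lambda>k. jap k powr (1/6)) (W * M^3) (cubic u)"
    proof (rule wbound_tendsto[OF cubic_trig_tendsto[OF u]])
      show "wbound (\<lambda>k. jap k powr (1/6)) (W * M^3) (cubic (trig {- int n..int n} (fourier_coeff u)))" for n
        unfolding wbound_def by (auto simp: fourier_coeff_cubic_trig intro!: W wboundD[OF u])
    qed
  qed
qed

lemma cubic_wbound_tame:
  assumes s: "0 \<le> s" and u: "wbound jap M u" and us: "wbound (\<lambda>k. jap k powr (2 * s)) B u" and B: "0 \<le> B"
    and A: "\<And>S. finite S \<Longrightarrow> (\<Sum>k\<in>S. cmod (fourier_coeff u k)) \<le> A"
  shows "wbound (\<lambda>k. jap k powr (2 * s)) (3 * 3 powr s * A\<^sup>2 * B) (cubic u)"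
proof (rule wbound_tendsto[OF cubic_trig_tendsto[OF u]])
  fix n
  have sq: "(\<Sum>k\<in>K. jap k powr (2 * s) * (cmod (f k))\<^sup>2) = (L2_set (\<lambda>k. jap k powr s * cmod (f k)) K)\<^sup>2"
    for f :: "int \<Rightarrow> complex" and K
    by (simp add: L2_set_def power_mult_distrib powr_power sum_nonneg mult.commute)
  show "wbound (\<lambda>k. jap k powr (2 * s)) (3 * 3 powr s * A\<^sup>2 * B) (cubic (trig {- int n..int n} (fourier_coeff u)))"
    unfolding wbound_def
  proof (intro allI impI)
    fix K :: "int set" assume K: "finite K"
    let ?S = "{- int n..int n}"
    have "L2_set (\<lambda>k. jap k powr s * cmod (tcoeff ?S (fourier_coeff u) k)) K
        \<le> 3 * 3 powr s * A\<^sup>2 * L2_set (\<lambda>k. jap k powr s * cmod (fourier_coeff u k)) ?S"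
      by (rule tcoeff_tame[OF _ K s A]) auto
    also have "\<dots> \<le> 3 * 3 powr s * A\<^sup>2 * B"
    proof (rule mult_left_mono)
      show "L2_set (\<lambda>k. jap k powr s * cmod (fourier_coeff u k)) ?S \<le> B"
        by (rule power2_le_imp_le[OF _ B], subst sq[symmetric]) (rule wboundD[OF us], simp)
    qed simp
    finally have "(L2_set (\<lambda>k. jap k powr s * cmod (tcoeff ?S (fourier_coeff u) k)) K)\<^sup>2
        \<le> (3 * 3 powr s * A\<^sup>2 * B)\<^sup>2"
      by (intro power_mono) auto
    then show "(\<Sum>k\<in>K. jap k powr (2 * s) * (cmod (fourier_coeff (cubic (trig ?S (fourier_coeff u))) k))\<^sup>2)
        \<le> (3 * 3 powr s * A\<^sup>2 * B)\<^sup>2"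
      unfolding sq by (simp add: fourier_coeff_cubic_trig)
  qed
qed

text \<open>A genuine Lipschitz bound, in terms of l1 norms of the coefficients. On finitely many
  modes these are controlled by the L2 norm, which is enough to solve the truncated
  equation.\<close>

lemma tcoeff_Lipschitz:
  assumes S: "finite S" and K: "finite K"
    and a: "(\<Sum>k\<in>S. cmod (a k)) \<le> A" and b: "(\<Sum>k\<in>S. cmod (b k)) \<le> A"
  shows "L2_set (\<lambda>k. cmod (tcoeff S a k - tcoeff S b k)) K \<le> 3 * A\<^sup>2 * L2_set (\<lambda>k. cmod (a k - b k)) S"
proof -
  have A0: "0 \<le> A"
    using a by (rule order_trans[rotated]) (simp add: sum_nonneg)
  let ?w = "\<lambda>k. cmod (a k - b k)"
  let ?B = "A\<^sup>2 * L2_set ?w S"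
  have one: "L2_set (conv p q r S f g ?w) K \<le> ?B"
    if pqr: "\<bar>p\<bar> = 1" "\<bar>q\<bar> = 1" "\<bar>r\<bar> = 1" and f: "\<And>k. 0 \<le> f k" "sum f S \<le> A"
      and g: "\<And>k. 0 \<le> g k" "sum g S \<le> A" for p q r f g
    unfolding L2_set_def[of "conv p q r S f g ?w"]
  proof (rule real_le_lsqrt)
    have "(\<Sum>k\<in>K. (conv p q r S f g ?w k)\<^sup>2) \<le> (sum f S * sum g S)\<^sup>2 * (\<Sum>k\<in>S. (?w k)\<^sup>2)"
      by (intro conv_l1_l1_l2 pqr S K f g) simp
    also have "\<dots> \<le> (A * A)\<^sup>2 * (\<Sum>k\<in>S. (?w k)\<^sup>2)"
      using A0 f g by (intro mult_right_mono power_mono mult_mono) (auto intro!: sum_nonneg mult_nonneg_nonneg)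
    also have "\<dots> = ?B\<^sup>2"
      by (simp add: L2_set_def power_mult_distrib sum_nonneg power2_eq_square)
    finally show "(\<Sum>k\<in>K. (conv p q r S f g ?w k)\<^sup>2) \<le> ?B\<^sup>2" .
  qed (auto intro: sum_nonneg)
  let ?a = "\<lambda>k. cmod (a k)" and ?b = "\<lambda>k. cmod (b k)"
  have "L2_set (\<lambda>k. cmod (tcoeff S a k - tcoeff S b k)) K
      \<le> L2_set (\<lambda>k. (conv 1 (-1) 1 S ?w ?a ?a k + conv 1 (-1) 1 S ?b ?w ?a k) + conv 1 (-1) 1 S ?b ?b ?w k) K"
    by (rule L2_set_mono) (auto intro: tcoeff_diff_le_conv)
  also have "\<dots> \<le> (L2_set (conv 1 (-1) 1 S ?w ?a ?a) K + L2_set (conv 1 (-1) 1 S ?b ?w ?a) K)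
      + L2_set (conv 1 (-1) 1 S ?b ?b ?w) K"
    by (intro order_trans[OF L2_set_triangle_ineq] add_right_mono L2_set_triangle_ineq)
  also have "\<dots> \<le> (?B + ?B) + ?B"
  proof (intro add_mono)
    show "L2_set (conv 1 (-1) 1 S ?b ?b ?w) K \<le> ?B"
      by (rule one) (use b in auto)
    have eq: "conv 1 (-1) 1 S ?w ?a ?a = conv 1 (-1) 1 S ?a ?a ?w"
      by (rule ext) (rule conv_swap13)
    show "L2_set (conv 1 (-1) 1 S ?w ?a ?a) K \<le> ?B"
      by (subst eq, rule one) (use a in auto)
    have eq: "conv 1 (-1) 1 S ?b ?w ?a = conv 1 1 (-1) S ?a ?b ?w"
      by (rule ext, subst conv_swap12) (rule conv_swap13)
    show "L2_set (conv 1 (-1) 1 S ?b ?w ?a) K \<le> ?B"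
      by (subst eq, rule one) (use a b in auto)
  qed
  finally show ?thesis by simp
qed

section \<open>Ordinary differential equations with a Lipschitz field\<close>

lemma continuous_on_atLeast_0I:
  fixes f :: "real \<Rightarrow> 'a::topological_space"
  assumes "\<And>T. 0 \<le> T \<Longrightarrow> continuous_on {0..T} f"
  shows "continuous_on {0..} f"
  unfolding continuous_on_eq_continuous_within
proof
  fix x :: real assume x: "x \<in> {0..}"
  have "continuous (at x within {0..x+1}) f"
    using x assms[of "x+1"] by (simp add: continuous_on_eq_continuous_within)
  moreover have "at x within {0..x+1} = at x within {0..}"
    by (rule at_within_nhd[of x "{..<x+1}"]) auto
  ultimately show "continuous (at x within {0..}) f"
    by simp
qed

lemma continuous_on_integral_from_0:
  fixes g :: "real \<Rightarrow> 'a::banach"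
  assumes "continuous_on {0..} g"
  shows "continuous_on {0..} (\<lambda>t. integral {0..t} g)"
  by (intro continuous_on_atLeast_0I indefinite_integral_continuous_1 integrable_continuous_real
      continuous_on_subset[OF assms]) auto

lemma integral_exp_real:
  fixes a t :: real
  assumes "a \<noteq> 0" "0 \<le> t"
  shows "((\<lambda>s. exp (a * s)) has_integral (exp (a * t) - 1) / a) {0..t}"
proof -
  have "((\<lambda>s. exp (a * s)) has_integral exp (a * t) / a - exp (a * 0) / a) {0..t}"
    using assms by (intro fundamental_theorem_of_calculus)
      (auto intro!: derivative_eq_intros simp: has_real_derivative_iff_has_vector_derivative[symmetric])
  then show ?thesis by (simp add: diff_divide_distrib)
qed

text \<open>Picard's map is a contraction for the sup norm with weight \<open>exp (- 2 L t)\<close>, which gives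
  a solution for all times at once.\<close>

lemma Lipschitz_ODE_solution:
  fixes F :: "'a::banach \<Rightarrow> 'a"
  assumes L: "0 < L" and Lip: "\<And>x y. norm (F x - F y) \<le> L * norm (x - y)"
  shows "\<exists>u :: real \<Rightarrow> 'a. continuous_on {0..} u \<and> (\<forall>t\<ge>0. u t = u0 + integral {0..t} (\<lambda>s. F (u s)))"
proof -
  \<comment> \<open>\<open>v\<close> stands for \<open>exp (- 2 L t) u t\<close>, so that its sup
    norm is the weighted norm of \<open>u\<close>. The \<open>max 0 t\<close> in
    \<open>\<Psi>\<close> freezes the curve at negative times, because bounded continuous functions
    live on the whole line.\<close>
  define g where "g v s = F (exp (2 * L * s) *\<^sub>R apply_bcontfun v s)" for v :: "real \<Rightarrow>\<^sub>C 'a" and s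
  define \<Psi> where "\<Psi> v t = exp (- (2 * L * max 0 t)) *\<^sub>R (u0 + integral {0..max 0 t} (g v))"
    for v :: "real \<Rightarrow>\<^sub>C 'a" and t
  have contF: "continuous_on UNIV F"
  proof (rule continuous_onI)
    fix x e assume "(0::real) < e"
    then show "\<exists>d>0. \<forall>x'\<in>UNIV. dist x' x < d \<longrightarrow> dist (F x') (F x) \<le> e" for x
      using L Lip
      by (intro exI[of _ "e / L"]) (auto simp: dist_norm field_simps intro!: order_trans[OF Lip])
  qed
  have contg: "continuous_on A (g v)" for v A
    unfolding g_def
    by (rule continuous_on_compose2[OF contF]) (auto intro!: continuous_intros)
  have intg: "g v integrable_on {0..t}" for v t
    by (intro integrable_continuous_real contg)
  have expint: "((\<lambda>s. B * exp (2 * L * s)) has_integral B * ((exp (2 * L * t) - 1) / (2 * L))) {0..t}"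
    if "0 \<le> t" for B t
    using integral_exp_real[of "2 * L" t] L that by (intro has_integral_mult_right) auto
  have \<Psi>_bcont: "\<Psi> v \<in> bcontfun" for v
  proof (rule bcontfun_normI)
    show "continuous_on UNIV (\<Psi> v)"
      unfolding \<Psi>_def
      by (intro continuous_intros continuous_on_compose2[OF continuous_on_integral_from_0[OF contg]]) auto
    fix t :: real
    define \<tau> where "\<tau> = max 0 t"
    have \<tau>: "0 \<le> \<tau>" by (simp add: \<tau>_def)
    let ?B = "norm (F 0) + L * norm v"
    have "norm (integral {0..\<tau>} (g v)) \<le> integral {0..\<tau>} (\<lambda>s. ?B * exp (2 * L * s))"
    proof (rule integral_norm_bound_integral[OF intg])
      show "(\<lambda>s. ?B * exp (2 * L * s)) integrable_on {0..\<tau>}"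
        using expint[OF \<tau>] by blast
      fix s assume s: "s \<in> {0..\<tau>}"
      have "norm (g v s) \<le> norm (F 0) + norm (g v s - F 0)"
        using norm_triangle_ineq[of "F 0" "g v s - F 0"] by simp
      also have "\<dots> \<le> norm (F 0) + L * (exp (2 * L * s) * norm (apply_bcontfun v s))"
        using Lip[of "exp (2 * L * s) *\<^sub>R apply_bcontfun v s" 0] by (simp add: g_def)
      also have "\<dots> \<le> norm (F 0) * exp (2 * L * s) + L * (exp (2 * L * s) * norm v)"
        using s L mult_left_mono[of 1 "exp (2 * L * s)" "norm (F 0)"]
        by (intro add_mono mult_left_mono norm_bounded) auto
      also have "\<dots> = ?B * exp (2 * L * s)"
        by (simp add: algebra_simps)
      finally show "norm (g v s) \<le> ?B * exp (2 * L * s)" .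
    qed
    also have "\<dots> = ?B * ((exp (2 * L * \<tau>) - 1) / (2 * L))"
      by (rule integral_unique[OF expint[OF \<tau>]])
    also have "\<dots> \<le> ?B * (exp (2 * L * \<tau>) / (2 * L))"
      using L by (intro mult_left_mono divide_right_mono) auto
    finally have int_le: "norm (integral {0..\<tau>} (g v)) \<le> ?B * (exp (2 * L * \<tau>) / (2 * L))" .
    have "norm (\<Psi> v t) = exp (- (2 * L * \<tau>)) * norm (u0 + integral {0..\<tau>} (g v))"
      by (simp add: \<Psi>_def \<tau>_def)
    also have "\<dots> \<le> exp (- (2 * L * \<tau>)) * (norm u0 + ?B * (exp (2 * L * \<tau>) / (2 * L)))"
      by (intro mult_left_mono order_trans[OF norm_triangle_ineq] add_left_mono int_le) simp
    also have "\<dots> = exp (- (2 * L * \<tau>)) * norm u0 + ?B / (2 * L)"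
      by (simp add: algebra_simps exp_minus field_simps)
    also have "\<dots> \<le> 1 * norm u0 + ?B / (2 * L)"
      using L \<tau> by (intro add_right_mono mult_right_mono) auto
    finally show "norm (\<Psi> v t) \<le> norm u0 + ?B / (2 * L)"
      by simp
  qed
  define \<Phi> where "\<Phi> v = Bcontfun (\<Psi> v)" for v
  have \<Phi>: "apply_bcontfun (\<Phi> v) = \<Psi> v" for v
    unfolding \<Phi>_def by (rule Bcontfun_inverse[OF \<Psi>_bcont])
  \<comment> \<open>The rate \<open>2 * L\<close> is twice the Lipschitz constant: integrating
    \<open>L * exp (2 * L * s)\<close> and removing the weight leaves the factor 1/2.\<close>
  have contraction: "dist (\<Phi> v) (\<Phi> w) \<le> (1/2) * dist v w" for v w
  proof (rule dist_bound)
    fix t :: real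
    define \<tau> where "\<tau> = max 0 t"
    have \<tau>: "0 \<le> \<tau>" by (simp add: \<tau>_def)
    have "norm (integral {0..\<tau>} (\<lambda>s. g v s - g w s)) \<le> integral {0..\<tau>} (\<lambda>s. (L * dist v w) * exp (2 * L * s))"
    proof (rule integral_norm_bound_integral)
      show "(\<lambda>s. g v s - g w s) integrable_on {0..\<tau>}"
        by (intro integrable_diff intg)
      show "(\<lambda>s. (L * dist v w) * exp (2 * L * s)) integrable_on {0..\<tau>}"
        using expint[OF \<tau>] by blast
      fix s assume "s \<in> {0..\<tau>}"
      have "norm (g v s - g w s) \<le> L * norm (exp (2 * L * s) *\<^sub>R apply_bcontfun v s - exp (2 * L * s) *\<^sub>R apply_bcontfun w s)"
        unfolding g_def by (rule Lip)
      also have "\<dots> = L * (exp (2 * L * s) * dist (apply_bcontfun v s) (apply_bcontfun w s))"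
        by (simp add: dist_norm flip: scaleR_diff_right)
      also have "\<dots> \<le> L * (exp (2 * L * s) * dist v w)"
        using L by (intro mult_left_mono dist_bounded) auto
      finally show "norm (g v s - g w s) \<le> (L * dist v w) * exp (2 * L * s)"
        by (simp add: mult_ac)
    qed
    also have "\<dots> = (L * dist v w) * ((exp (2 * L * \<tau>) - 1) / (2 * L))"
      by (rule integral_unique[OF expint[OF \<tau>]])
    also have "\<dots> \<le> (L * dist v w) * (exp (2 * L * \<tau>) / (2 * L))"
      using L by (intro mult_left_mono divide_right_mono) auto
    finally have int_le: "norm (integral {0..\<tau>} (\<lambda>s. g v s - g w s)) \<le> dist v w * exp (2 * L * \<tau>) / 2"
      using L by simp
    have "\<Psi> v t - \<Psi> w t = exp (- (2 * L * \<tau>)) *\<^sub>R integral {0..\<tau>} (\<lambda>s. g v s - g w s)"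
      by (simp add: \<Psi>_def \<tau>_def integral_diff[OF intg intg] flip: scaleR_diff_right)
    then have "dist (\<Psi> v t) (\<Psi> w t) = exp (- (2 * L * \<tau>)) * norm (integral {0..\<tau>} (\<lambda>s. g v s - g w s))"
      by (simp add: dist_norm)
    also have "\<dots> \<le> exp (- (2 * L * \<tau>)) * (dist v w * exp (2 * L * \<tau>) / 2)"
      by (intro mult_left_mono int_le) simp
    also have "\<dots> = (1/2) * dist v w"
      by (simp add: exp_minus field_simps)
    finally show "dist (apply_bcontfun (\<Phi> v) t) (apply_bcontfun (\<Phi> w) t) \<le> (1/2) * dist v w"
      by (simp add: \<Phi>)
  qed
  obtain v where v: "\<Phi> v = v"
    using banach_fix_type[of "1/2" \<Phi>] contraction by auto
  define u where "u t = exp (2 * L * t) *\<^sub>R apply_bcontfun v t" for t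
  have gu: "g v = (\<lambda>s. F (u s))"
    by (simp add: g_def u_def fun_eq_iff)
  have solves: "u t = u0 + integral {0..t} (\<lambda>s. F (u s))" if "0 \<le> t" for t
  proof -
    have "apply_bcontfun v t = exp (- (2 * L * t)) *\<^sub>R (u0 + integral {0..t} (g v))"
      using \<Phi>[of v] that by (simp add: v \<Psi>_def)
    then show ?thesis
      unfolding u_def[of t] gu[symmetric] by (simp flip: exp_add)
  qed
  show ?thesis
  proof (intro exI[of _ u] conjI allI impI)
    show "continuous_on {0..} u"
      unfolding u_def by (intro continuous_intros) auto
  qed (rule solves)
qed

section \<open>Galerkin approximations\<close>

text \<open>Both symmetries of the quartic form \<open>\<Sum> a\<^sub>x cnj a\<^sub>y a\<^sub>z cnj a\<^sub>k\<close> over \<open>x + z = y + k\<close> are used: swapping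
  the pairs \<open>(x, z)\<close> and \<open>(y, k)\<close> conjugates it, and swapping inside a pair preserves it. For an
  affine weight the sum over \<open>(x, z)\<close> equals the sum over \<open>(y, k)\<close>, which gives conservation of mass
  and momentum.\<close>

lemma tcoeff_conservation:
  fixes \<alpha> \<beta> :: real
  assumes S: "finite S"
  shows "(\<Sum>k\<in>S. (\<alpha> + \<beta> * real_of_int k) * Im (tcoeff S a k * cnj (a k))) = 0"
proof -
  define Q where "Q = {(x, y, z, k). x \<in> S \<and> y \<in> S \<and> z \<in> S \<and> k \<in> S \<and> x - y + z = k}"
  define q where "q = (\<lambda>(x, y, z, k). Im (a x * cnj (a y) * a z * cnj (a k)))"
  define h where "h k = \<alpha> + \<beta> * real_of_int k" for k
  have q_swap: "q (y, x, k, z) = - q (x, y, z, k)" for x y z k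
  proof -
    have "a y * cnj (a x) * a k * cnj (a z) = cnj (a x * cnj (a y) * a z * cnj (a k))"
      by (simp only: complex_cnj_mult complex_cnj_cnj mult_ac)
    then show ?thesis by (simp only: q_def prod.case cnj.simps)
  qed
  have q_out: "q (x, k, z, y) = q (x, y, z, k)" and q_in: "q (z, y, x, k) = q (x, y, z, k)" for x y z k
  proof -
    have "a x * cnj (a k) * a z * cnj (a y) = a x * cnj (a y) * a z * cnj (a k)"
      "a z * cnj (a y) * a x * cnj (a k) = a x * cnj (a y) * a z * cnj (a k)"
      by (simp_all only: mult_ac)
    then show "q (x, k, z, y) = q (x, y, z, k)" "q (z, y, x, k) = q (x, y, z, k)"
      by (simp_all only: q_def prod.case)
  qed
  have swap: "(\<Sum>i\<in>Q. h (case i of (x, y, z, k) \<Rightarrow> k) * q i) = (\<Sum>i\<in>Q. - (h (case i of (x, y, z, k) \<Rightarrow> z) * q i))"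
  proof (rule sum.reindex_bij_witness[of _ "\<lambda>(x, y, z, k). (y, x, k, z)" "\<lambda>(x, y, z, k). (y, x, k, z)"])
    fix i assume "i \<in> Q"
    show "- (h (case (case i of (x, y, z, k) \<Rightarrow> (y, x, k, z)) of (x, y, z, k) \<Rightarrow> z)
        * q (case i of (x, y, z, k) \<Rightarrow> (y, x, k, z))) = h (case i of (x, y, z, k) \<Rightarrow> k) * q i"
    proof (cases i)
      case (fields x y z k)
      then show ?thesis by (simp add: q_swap[where x = x and y = y and z = z and k = k])
    qed
  qed (auto simp: Q_def)
  have swap_out: "(\<Sum>i\<in>Q. h (case i of (x, y, z, k) \<Rightarrow> k) * q i) = (\<Sum>i\<in>Q. h (case i of (x, y, z, k) \<Rightarrow> y) * q i)"
    by (rule sum.reindex_bij_witness[of _ "\<lambda>(x, y, z, k). (x, k, z, y)" "\<lambda>(x, y, z, k). (x, k, z, y)"])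
      (auto simp: Q_def q_out)
  have swap_in: "(\<Sum>i\<in>Q. h (case i of (x, y, z, k) \<Rightarrow> z) * q i) = (\<Sum>i\<in>Q. h (case i of (x, y, z, k) \<Rightarrow> x) * q i)"
    by (rule sum.reindex_bij_witness[of _ "\<lambda>(x, y, z, k). (z, y, x, k)" "\<lambda>(x, y, z, k). (z, y, x, k)"])
      (auto simp: Q_def q_in)
  \<comment> \<open>Write \<open>X\<close> for the sum with weight \<open>h k\<close>. By the three
    reindexings the left side is \<open>2 X\<close> and the right side \<open>- 2 X\<close>, so
    \<open>X = 0\<close> once the two sides agree; they agree term by term since
    \<open>x + z = y + k\<close> and \<open>h\<close> is affine.\<close>
  have "(\<Sum>i\<in>Q. h (case i of (x, y, z, k) \<Rightarrow> k) * q i) + (\<Sum>i\<in>Q. h (case i of (x, y, z, k) \<Rightarrow> y) * q i)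
      = (\<Sum>i\<in>Q. h (case i of (x, y, z, k) \<Rightarrow> z) * q i) + (\<Sum>i\<in>Q. h (case i of (x, y, z, k) \<Rightarrow> x) * q i)"
    unfolding sum.distrib[symmetric]
  proof (rule sum.cong[OF refl], clarify)
    fix x y z k assume "(x, y, z, k) \<in> Q"
    then have "x - y + z = k" by (simp add: Q_def)
    then have "real_of_int k + real_of_int y = real_of_int z + real_of_int x"
      by linarith
    then have "2 * \<alpha> + \<beta> * (real_of_int k + real_of_int y) = 2 * \<alpha> + \<beta> * (real_of_int z + real_of_int x)"
      by simp
    then have "h k + h y = h z + h x"
      by (simp add: h_def distrib_left)
    then show "h k * q (x, y, z, k) + h y * q (x, y, z, k) = h z * q (x, y, z, k) + h x * q (x, y, z, k)"
      by (simp only: distrib_right[symmetric])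
  qed
  then have zero: "(\<Sum>i\<in>Q. h (case i of (x, y, z, k) \<Rightarrow> k) * q i) = 0"
    using swap swap_out swap_in unfolding sum_negf by linarith
  have "(\<Sum>k\<in>S. h k * Im (tcoeff S a k * cnj (a k)))
      = (\<Sum>k\<in>S. \<Sum>i\<in>fib 1 (-1) 1 S k. case i of (x, y, z) \<Rightarrow> h k * q (x, y, z, k))"
    unfolding tcoeff_def sum_distrib_right Im_sum sum_distrib_left
    by (intro sum.cong refl) (auto simp: q_def)
  also have "\<dots> = (\<Sum>(k, i)\<in>Sigma S (fib 1 (-1) 1 S). case i of (x, y, z) \<Rightarrow> h k * q (x, y, z, k))"
    using S by (intro sum.Sigma) auto
  also have "\<dots> = (\<Sum>i\<in>Q. h (case i of (x, y, z, k) \<Rightarrow> k) * q i)"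
    by (rule sum.reindex_bij_witness[of _ "\<lambda>(x, y, z, k). (k, x, y, z)" "\<lambda>(k, x, y, z). (x, y, z, k)"])
      (auto simp: Q_def fib_def)
  finally show ?thesis using zero by (simp add: h_def)
qed

text \<open>Composition with the radial retraction makes the Galerkin field globally Lipschitz; by conservation
  of mass the retraction is the identity along the solution.\<close>

definition radial :: "real \<Rightarrow> 'a::real_normed_vector \<Rightarrow> 'a" where
  "radial R x = (R / max R (norm x)) *\<^sub>R x"

lemma norm_radial_le:
  assumes "0 < R"
  shows "norm (radial R x) \<le> R"
proof -
  have "R * norm x \<le> R * max R (norm x)"
    using assms by (intro mult_left_mono) auto
  then show ?thesis
    using assms by (auto simp: radial_def field_simps)
qed

lemma radial_eq: "0 < R \<Longrightarrow> norm x \<le> R \<Longrightarrow> radial R x = x"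
  by (simp add: radial_def max_def)

text \<open>The point is moved at a fixed scaling factor, then the factor is changed at a fixed
  point; each move costs at most the norm of \<open>x - y\<close>.\<close>

lemma radial_Lipschitz:
  assumes R: "0 < R"
  shows "norm (radial R x - radial R y) \<le> 2 * norm (x - y)"
proof -
  define X where "X = max R (norm x)"
  define Y where "Y = max R (norm y)"
  have XY: "0 < X" "0 < Y" "R \<le> X" "norm y \<le> Y" using R by (auto simp: X_def Y_def)
  have YX: "\<bar>Y - X\<bar> \<le> norm (x - y)"
    using norm_triangle_ineq3[of x y] by (auto simp: X_def Y_def)
  have "radial R x - radial R y = (R / X) *\<^sub>R (x - y) + (R / X - R / Y) *\<^sub>R y"
    by (simp add: radial_def X_def Y_def algebra_simps)
  then have "norm (radial R x - radial R y) \<le> norm ((R / X) *\<^sub>R (x - y)) + norm ((R / X - R / Y) *\<^sub>R y)"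
    by (simp only: norm_triangle_ineq)
  also have "norm ((R / X) *\<^sub>R (x - y)) \<le> 1 * norm (x - y)"
    unfolding norm_scaleR using R XY by (intro mult_right_mono) auto
  also have "norm ((R / X - R / Y) *\<^sub>R y) \<le> 1 * norm (x - y)"
  proof -
    have "R / X - R / Y = (R / X) * ((Y - X) / Y)"
      using XY by (simp add: field_simps)
    then have "norm ((R / X - R / Y) *\<^sub>R y) = (R / X) * \<bar>Y - X\<bar> * (norm y / Y)"
      using R XY by (simp add: abs_mult)
    also have "\<dots> \<le> 1 * norm (x - y) * 1"
      using R XY YX by (intro mult_mono) auto
    finally show ?thesis by simp
  qed
  finally show ?thesis by simp
qed

text \<open>Restricting to the frequencies \<open>0..n\<close> performs the projection on
  nonnegative frequencies and the Galerkin cutoff together.\<close>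

definition galerkin_field :: "nat \<Rightarrow> l2_circle \<Rightarrow> l2_circle" where
  "galerkin_field n u = trig {0..int n} (fourier_coeff (cubic (trig {0..int n} (fourier_coeff u))))"

lemma fourier_coeff_galerkin_field:
  "fourier_coeff (galerkin_field n u) k
    = (if k \<in> {0..int n} then tcoeff {0..int n} (fourier_coeff u) k else 0)"
  by (simp add: galerkin_field_def fourier_coeff_cubic_trig)

text \<open>On \<open>n + 1\<close> modes Cauchy-Schwarz turns the L2 bound \<open>R\<close> into
  the l1 bound \<open>A = sqrt (n + 1) * R\<close>. The constant grows with \<open>n\<close>; it
  serves only to solve the truncated equation.\<close>

lemma galerkin_field_Lipschitz:
  "\<exists>L>0. \<forall>u v. norm u \<le> R \<longrightarrow> norm v \<le> R \<longrightarrow>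
     norm (galerkin_field n u - galerkin_field n v) \<le> L * norm (u - v)"
proof -
  let ?S = "{0..int n}"
  define A where "A = sqrt (real (card ?S)) * R"
  have sum_le: "(\<Sum>k\<in>?S. cmod (fourier_coeff u k)) \<le> A" if "norm u \<le> R" for u
  proof -
    have "(\<Sum>k\<in>?S. 1 * cmod (fourier_coeff u k))\<^sup>2 \<le> (\<Sum>k\<in>?S. 1\<^sup>2) * (\<Sum>k\<in>?S. (cmod (fourier_coeff u k))\<^sup>2)"
      by (rule Cauchy_Schwarz_ineq_sum)
    also have "\<dots> \<le> real (card ?S) * R\<^sup>2"
    proof (intro mult_mono)
      have "(\<Sum>k\<in>?S. (cmod (fourier_coeff u k))\<^sup>2) \<le> (norm u)\<^sup>2"
        by (rule Bessel) simp
      also have "\<dots> \<le> R\<^sup>2" using that by (intro power_mono) auto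
      finally show "(\<Sum>k\<in>?S. (cmod (fourier_coeff u k))\<^sup>2) \<le> R\<^sup>2" .
    qed (auto intro: sum_nonneg)
    also have "\<dots> = A\<^sup>2"
      by (simp add: A_def power_mult_distrib)
    finally have "(\<Sum>k\<in>?S. cmod (fourier_coeff u k))\<^sup>2 \<le> A\<^sup>2" by simp
    moreover have "0 \<le> R" using that norm_ge_zero order_trans by blast
    then have "0 \<le> A" by (simp add: A_def)
    ultimately show ?thesis by (rule power2_le_imp_le)
  qed
  have "norm (galerkin_field n u - galerkin_field n v) \<le> (3 * A\<^sup>2 + 1) * norm (u - v)"
    if u: "norm u \<le> R" and v: "norm v \<le> R" for u v
  proof (rule norm_le_fourier_coeffI)
    fix K :: "int set" assume K: "finite K"
    have "L2_set (\<lambda>k. cmod (fourier_coeff u k - fourier_coeff v k)) ?S \<le> norm (u - v)"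
      unfolding L2_set_def using Bessel[of ?S "u - v"]
      by (intro real_le_lsqrt) (auto simp: fourier_coeff_diff intro: sum_nonneg)
    then have "L2_set (\<lambda>k. cmod (tcoeff ?S (fourier_coeff u) k - tcoeff ?S (fourier_coeff v) k)) K
        \<le> 3 * A\<^sup>2 * norm (u - v)"
      by (intro order_trans[OF tcoeff_Lipschitz[OF _ K sum_le[OF u] sum_le[OF v]]] mult_left_mono) auto
    also have "\<dots> \<le> (3 * A\<^sup>2 + 1) * norm (u - v)"
      by (intro mult_right_mono) auto
    finally have le: "(\<Sum>k\<in>K. (cmod (tcoeff ?S (fourier_coeff u) k - tcoeff ?S (fourier_coeff v) k))\<^sup>2)
        \<le> ((3 * A\<^sup>2 + 1) * norm (u - v))\<^sup>2"
      unfolding L2_set_def by (rule sqrt_le_D)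
    have "(\<Sum>k\<in>K. (cmod (fourier_coeff (galerkin_field n u - galerkin_field n v) k))\<^sup>2)
        \<le> (\<Sum>k\<in>K. (cmod (tcoeff ?S (fourier_coeff u) k - tcoeff ?S (fourier_coeff v) k))\<^sup>2)"
      by (intro sum_mono) (auto simp: fourier_coeff_diff fourier_coeff_galerkin_field)
    then show "(\<Sum>k\<in>K. (cmod (fourier_coeff (galerkin_field n u - galerkin_field n v) k))\<^sup>2)
        \<le> ((3 * A\<^sup>2 + 1) * norm (u - v))\<^sup>2"
      using le by linarith
  qed auto
  then show ?thesis
    by (intro exI[of _ "3 * A\<^sup>2 + 1"]) (auto simp: add_nonneg_pos)
qed

lemma fourier_coeff_integral:
  assumes "f integrable_on S"
  shows "fourier_coeff (integral S f) k = integral S (\<lambda>s. fourier_coeff (f s) k)"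
  using integral_linear[OF assms bounded_linear_fourier_coeff, of k] by (simp add: o_def)

lemma fourier_coeff_radial: "fourier_coeff (radial R u) k = complex_of_real (R / max R (norm u)) * fourier_coeff u k"
  by (simp add: radial_def scaleR_conv_of_real)

text \<open>The retracted field has a global solution. The conservation laws are proved for the
  retracted equation itself, where the retraction is a positive real factor; constancy of the norm
  then shows that the retraction never acts.\<close>

lemma galerkin_solution:
  assumes c: "c = \<i> \<or> c = - \<i>" and supp: "\<And>k. k \<notin> {0..int n} \<Longrightarrow> fourier_coeff u0 k = 0"
  obtains u :: "real \<Rightarrow> l2_circle" where "continuous_on {0..} u" "u 0 = u0"
    "\<And>t. 0 \<le> t \<Longrightarrow> u t = u0 + integral {0..t} (\<lambda>s. cscale c (galerkin_field n (u s)))"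
    "\<And>t k. 0 \<le> t \<Longrightarrow> k \<notin> {0..int n} \<Longrightarrow> fourier_coeff (u t) k = 0"
    "\<And>t. 0 \<le> t \<Longrightarrow> (\<Sum>k\<in>{0..int n}. jap k * (cmod (fourier_coeff (u t) k))\<^sup>2)
      = (\<Sum>k\<in>{0..int n}. jap k * (cmod (fourier_coeff u0 k))\<^sup>2)"
    "continuous_on UNIV (galerkin_field n)"
proof -
  let ?S = "{0..int n}"
  \<comment> \<open>Any radius not below the conserved norm will do; adding 1 keeps it positive for
    \<open>u0 = 0\<close>.\<close>
  define R where "R = norm u0 + 1"
  have R: "0 < R" by (simp add: R_def add_nonneg_pos)
  define F where "F u = cscale c (galerkin_field n (radial R u))" for u
  have cmod_c: "cmod c = 1" using c by auto
  obtain L where L: "0 < L" "\<And>u v. norm u \<le> R \<Longrightarrow> norm v \<le> R \<Longrightarrow>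
      norm (galerkin_field n u - galerkin_field n v) \<le> L * norm (u - v)"
    using galerkin_field_Lipschitz by blast
  have FLip: "norm (F u - F v) \<le> (2 * L) * norm (u - v)" for u v
  proof -
    have "norm (F u - F v) = norm (galerkin_field n (radial R u) - galerkin_field n (radial R v))"
      by (simp add: F_def cmod_c flip: cscale_diff_right)
    also have "\<dots> \<le> L * norm (radial R u - radial R v)"
      by (intro L norm_radial_le R)
    also have "\<dots> \<le> L * (2 * norm (u - v))"
      using L(1) by (intro mult_left_mono radial_Lipschitz R) auto
    finally show ?thesis by simp
  qed
  have contG: "continuous_on UNIV (galerkin_field n)"
    unfolding continuous_on_eq_continuous_within
  proof
    fix v :: l2_circle
    obtain L' where L': "0 < L'" "\<And>u w. norm u \<le> norm v + 1 \<Longrightarrow> norm w \<le> norm v + 1 \<Longrightarrow>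
        norm (galerkin_field n u - galerkin_field n w) \<le> L' * norm (u - w)"
      using galerkin_field_Lipschitz by blast
    have "\<exists>d>0. \<forall>u. dist u v < d \<longrightarrow> dist (galerkin_field n u) (galerkin_field n v) < e" if "0 < e" for e
    proof (intro exI[of _ "min 1 (e / L')"] conjI allI impI)
      show "0 < min 1 (e / L')" using L' that by simp
      fix u assume u: "dist u v < min 1 (e / L')"
      then have "norm (u - v) < 1" by (simp add: dist_norm)
      then have "norm u \<le> norm v + 1"
        using norm_triangle_ineq[of v "u - v"] by simp
      then have "dist (galerkin_field n u) (galerkin_field n v) \<le> L' * norm (u - v)"
        unfolding dist_norm by (intro L') auto
      also have "\<dots> < e"
        using u L' by (simp add: dist_norm field_simps)
      finally show "dist (galerkin_field n u) (galerkin_field n v) < e" .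
    qed
    then show "continuous (at v) (galerkin_field n)"
      unfolding continuous_at_eps_delta by (simp add: dist_norm)
  qed
  obtain u :: "real \<Rightarrow> l2_circle" where cont: "continuous_on {0..} u"
    and u: "\<And>t. 0 \<le> t \<Longrightarrow> u t = u0 + integral {0..t} (\<lambda>s. F (u s))"
    using Lipschitz_ODE_solution[of "2 * L" F u0] L(1) FLip by auto
  have contF: "continuous_on UNIV F"
  proof (rule continuous_onI)
    fix x e assume "(0::real) < e"
    then show "\<exists>d>0. \<forall>x'\<in>UNIV. dist x' x < d \<longrightarrow> dist (F x') (F x) \<le> e"
      using L(1)
      by (intro exI[of _ "e / (2 * L)"]) (auto simp: dist_norm field_simps intro!: order_trans[OF FLip])
  qed
  have contFu: "continuous_on A (\<lambda>s. F (u s))" if "A \<subseteq> {0..}" for A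
    using that by (intro continuous_on_compose2[OF contF continuous_on_subset[OF cont]]) auto
  have intF: "(\<lambda>s. F (u s)) integrable_on {0..t}" for t
    by (intro integrable_continuous_real contFu) auto
  have u00: "u 0 = u0" using u[of 0] by simp
  have fcF: "fourier_coeff (F v) k = (if k \<in> ?S then c * tcoeff ?S (fourier_coeff (radial R v)) k else 0)" for v k
    by (simp add: F_def fourier_coeff_galerkin_field)
  have range: "fourier_coeff (u t) k = 0" if "0 \<le> t" "k \<notin> ?S" for t k
  proof -
    have "fourier_coeff (u t) k = integral {0..t} (\<lambda>s. fourier_coeff (F (u s)) k)"
      using supp[OF that(2)] by (simp add: u[OF that(1)] fourier_coeff_add fourier_coeff_integral[OF intF])
    also have "(\<lambda>s. fourier_coeff (F (u s)) k) = (\<lambda>s. 0)"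
      using that(2) by (auto simp: fcF)
    also have "integral {0..t} (\<lambda>s. 0 :: complex) = 0"
      by simp
    finally show ?thesis .
  qed
  have conserved: "(\<Sum>k\<in>?S. (\<alpha> + \<beta> * real_of_int k) * (cmod (fourier_coeff (u t) k))\<^sup>2)
      = (\<Sum>k\<in>?S. (\<alpha> + \<beta> * real_of_int k) * (cmod (fourier_coeff u0 k))\<^sup>2)" if t: "0 \<le> t" for \<alpha> \<beta> t
  proof -
    define E where "E s = (\<Sum>k\<in>?S. (\<alpha> + \<beta> * real_of_int k) * (fourier_coeff (u s) k \<bullet> fourier_coeff (u s) k))" for s
    have deriv_u: "(u has_vector_derivative F (u s)) (at s within {0..t})" if s: "s \<in> {0..t}" for s
    proof -
      have "((\<lambda>s. integral {0..s} (\<lambda>s. F (u s))) has_vector_derivative F (u s)) (at s within {0..t})"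
        by (rule integral_has_vector_derivative[OF contFu s]) auto
      then have "((\<lambda>s. u0 + integral {0..s} (\<lambda>s. F (u s))) has_vector_derivative F (u s)) (at s within {0..t})"
        by (auto intro: derivative_eq_intros)
      then show ?thesis
        by (rule has_vector_derivative_transform[rotated 2]) (use s u in auto)
    qed
    have "(E has_vector_derivative 0) (at s within {0..t})" if s: "s \<in> {0..t}" for s
    proof -
      have fc: "((\<lambda>s. fourier_coeff (u s) k) has_vector_derivative fourier_coeff (F (u s)) k) (at s within {0..t})" for k
        by (rule bounded_linear.has_vector_derivative[OF bounded_linear_fourier_coeff deriv_u[OF s]])
      have "(E has_vector_derivative (\<Sum>k\<in>?S. (\<alpha> + \<beta> * real_of_int k) *
          (fourier_coeff (u s) k \<bullet> fourier_coeff (F (u s)) k + fourier_coeff (F (u s)) k \<bullet> fourier_coeff (u s) k)))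
          (at s within {0..t})"
        unfolding E_def
        by (intro has_vector_derivative_sum has_vector_derivative_mult_right
            bounded_bilinear.has_vector_derivative[OF bounded_bilinear_inner] fc)
      moreover have "(\<Sum>k\<in>?S. (\<alpha> + \<beta> * real_of_int k) *
          (fourier_coeff (u s) k \<bullet> fourier_coeff (F (u s)) k + fourier_coeff (F (u s)) k \<bullet> fourier_coeff (u s) k)) = 0"
      proof -
        \<comment> \<open>The retracted argument \<open>v\<close> is \<open>\<phi>\<close> times
          \<open>u s\<close>. Multiplying the derivative of the conserved sum by
          \<open>\<phi>\<close> replaces \<open>u s\<close> by \<open>v\<close> in the second
          factor, so that \<open>tcoeff_conservation\<close> applies to \<open>v\<close> throughout.
          The sign \<open>\<sigma>\<close> below is given by
          \<open>Re (c * w) = \<sigma> * Im w\<close>.\<close>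
        define \<phi> where "\<phi> = R / max R (norm (u s))"
        have \<phi>: "0 < \<phi>" using R by (simp add: \<phi>_def)
        define v where "v = fourier_coeff (radial R (u s))"
        have v: "v k = complex_of_real \<phi> * fourier_coeff (u s) k" for k
          by (simp add: v_def \<phi>_def fourier_coeff_radial)
        define \<sigma> :: real where "\<sigma> = (if c = \<i> then - 1 else 1)"
        have inner: "\<phi> * (fourier_coeff (u s) k \<bullet> fourier_coeff (F (u s)) k + fourier_coeff (F (u s)) k \<bullet> fourier_coeff (u s) k)
            = (2 * \<sigma>) * Im (tcoeff ?S v k * cnj (v k))" if "k \<in> ?S" for k
        proof -
          have "Re (c * w) = \<sigma> * Im w" for w
            using c by (auto simp: \<sigma>_def)
          then have "Re (c * (tcoeff ?S v k * cnj (v k))) = \<sigma> * Im (tcoeff ?S v k * cnj (v k))" .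
          moreover have "Re (c * (tcoeff ?S v k * cnj (v k))) = \<phi> * (fourier_coeff (F (u s)) k \<bullet> fourier_coeff (u s) k)"
          proof -
            have "c * (tcoeff ?S v k * cnj (v k)) = complex_of_real \<phi> * (fourier_coeff (F (u s)) k * cnj (fourier_coeff (u s) k))"
              using that unfolding fcF v_def[symmetric] v by (simp add: mult_ac)
            then show ?thesis by (simp add: inner_complex_def)
          qed
          ultimately show ?thesis by (simp add: inner_commute algebra_simps)
        qed
        have "\<phi> * (\<Sum>k\<in>?S. (\<alpha> + \<beta> * real_of_int k) *
            (fourier_coeff (u s) k \<bullet> fourier_coeff (F (u s)) k + fourier_coeff (F (u s)) k \<bullet> fourier_coeff (u s) k))
            = (\<Sum>k\<in>?S. (2 * \<sigma>) * ((\<alpha> + \<beta> * real_of_int k) * Im (tcoeff ?S v k * cnj (v k))))"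
          unfolding sum_distrib_left
        proof (rule sum.cong[OF refl])
          fix k assume k: "k \<in> ?S"
          show "\<phi> * ((\<alpha> + \<beta> * real_of_int k) * (fourier_coeff (u s) k \<bullet> fourier_coeff (F (u s)) k
              + fourier_coeff (F (u s)) k \<bullet> fourier_coeff (u s) k))
            = (2 * \<sigma>) * ((\<alpha> + \<beta> * real_of_int k) * Im (tcoeff ?S v k * cnj (v k)))"
            using arg_cong[OF inner[OF k], of "\<lambda>x. (\<alpha> + \<beta> * real_of_int k) * x"] by (simp only: mult_ac)
        qed
        also have "\<dots> = 0"
          unfolding sum_distrib_left[symmetric] by (simp only: tcoeff_conservation finite_atLeastAtMost_int mult_zero_right)
        finally show ?thesis using \<phi> by (metis mult_eq_0_iff less_irrefl)
      qed
      ultimately show ?thesis by simp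
    qed
    then obtain C where "\<And>s. s \<in> {0..t} \<Longrightarrow> E s = C"
      by (rule has_vector_derivative_zero_constant[of "{0..t}" E, rotated]) auto
    then have "E t = E 0" using t by simp
    then show ?thesis by (simp add: E_def u00 power2_norm_eq_inner)
  qed
  have norm_sq: "(norm v)\<^sup>2 = (\<Sum>k\<in>?S. (cmod (fourier_coeff v k))\<^sup>2)" if "\<And>k. k \<notin> ?S \<Longrightarrow> fourier_coeff v k = 0" for v
  proof -
    have "v = trig ?S (fourier_coeff v)"
      by (rule fourier_coeff_eqI) (use that in auto)
    then show ?thesis using norm_trig[of ?S "fourier_coeff v"] by simp
  qed
  have "(norm (u t))\<^sup>2 = (norm u0)\<^sup>2" if "0 \<le> t" for t
    using conserved[OF that, of 1 0] norm_sq[of "u t"] norm_sq[of u0] range[OF that] supp by simp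
  then have norm_u: "norm (u t) = norm u0" if "0 \<le> t" for t
    using that by (simp add: power2_eq_iff_nonneg)
  have "F (u s) = cscale c (galerkin_field n (u s))" if "0 \<le> s" for s
    unfolding F_def using radial_eq[OF R, of "u s"] norm_u[OF that] by (simp add: R_def)
  then have solves: "u t = u0 + integral {0..t} (\<lambda>s. cscale c (galerkin_field n (u s)))" if "0 \<le> t" for t
    unfolding u[OF that] by (intro arg_cong[of _ _ "\<lambda>x. u0 + x"] integral_cong) auto
  \<comment> \<open>On the frequencies \<open>0..n\<close> the weight \<open>jap k\<close> is
    \<open>1 + k\<close>, that is \<open>\<alpha> = \<beta> = 1\<close>; the mass was the case
    \<open>\<alpha> = 1\<close>, \<open>\<beta> = 0\<close>.\<close>
  have energy: "(\<Sum>k\<in>?S. jap k * (cmod (fourier_coeff (u t) k))\<^sup>2)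
      = (\<Sum>k\<in>?S. jap k * (cmod (fourier_coeff u0 k))\<^sup>2)" if "0 \<le> t" for t
    using conserved[OF that, of 1 1] by (simp add: jap_def)
  show ?thesis
    by (rule that[OF cont u00 solves range energy contG])
qed

section \<open>Stability of approximate solutions\<close>

definition szego_field :: "l2_circle \<Rightarrow> l2_circle" where
  "szego_field u = szego_projector (cubic u)"

text \<open>The log-Lipschitz bound and the tail bound are packed together, both being monotone in
  the constant. One choice \<open>K\<^sub>0\<close> can then be fixed and used explicitly in
  exponents and rates.\<close>

definition cubic_const :: "real \<Rightarrow> bool" where
  "cubic_const C \<longleftrightarrow> 0 < C \<and>
     (\<forall>u v M D y. 1 \<le> M \<longrightarrow> 1 \<le> D \<longrightarrow> 0 < y \<longrightarrow> y \<le> D \<longrightarrow> wbound jap M u \<longrightarrow> wbound jap M v \<longrightarrow>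
        norm (u - v) \<le> y \<longrightarrow> norm (szego_field u - szego_field v) \<le> C * M^3 * y * (1 + ln (D / y))) \<and>
     (\<forall>u M. 0 \<le> M \<longrightarrow> wbound jap M u \<longrightarrow> wbound (\<lambda>k. jap k powr (1/6)) (C * M^3) (cubic u))"

lemma cubic_const_exists: "\<exists>C. cubic_const C"
proof -
  obtain C where C: "0 < C" "\<And>u v M D y. 1 \<le> M \<Longrightarrow> 1 \<le> D \<Longrightarrow> 0 < y \<Longrightarrow> y \<le> D \<Longrightarrow>
      wbound jap M u \<Longrightarrow> wbound jap M v \<Longrightarrow> norm (u - v) \<le> y \<Longrightarrow>
      norm (cubic u - cubic v) \<le> C * M^3 * y * (1 + ln (D / y))"
    using cubic_log_Lipschitz by metis
  obtain W where W: "0 < W" "\<And>u M. wbound jap M u \<Longrightarrow> wbound (\<lambda>k. jap k powr (1/6)) (W * M^3) (cubic u)"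
    using cubic_wbound_tail by metis
  have "cubic_const (C + W)"
    unfolding cubic_const_def
  proof (intro conjI allI impI)
    show "0 < C + W" using C(1) W(1) by simp
    fix u v and M D y :: real
    assume *: "1 \<le> M" "1 \<le> D" "0 < y" "y \<le> D" "wbound jap M u" "wbound jap M v" "norm (u - v) \<le> y"
    have "szego_field u - szego_field v = szego_projector (cubic u - cubic v)"
      by (rule fourier_coeff_eqI) (simp add: szego_field_def fourier_coeff_diff)
    then have "norm (szego_field u - szego_field v) \<le> norm (cubic u - cubic v)"
      by (simp only: norm_szego_projector_le)
    also have "\<dots> \<le> C * M^3 * y * (1 + ln (D / y))"
      by (rule C(2)[OF *])
    also have "\<dots> \<le> (C + W) * M^3 * y * (1 + ln (D / y))"
    proof (intro mult_right_mono)
      show "0 \<le> 1 + ln (D / y)" using * by (intro add_nonneg_nonneg) auto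
    qed (use * W(1) in auto)
    finally show "norm (szego_field u - szego_field v) \<le> (C + W) * M^3 * y * (1 + ln (D / y))" .
  next
    fix u and M :: real assume *: "0 \<le> M" "wbound jap M u"
    have "\<bar>W * M^3\<bar> = W * M^3"
      using * W(1) by simp
    also have "\<dots> \<le> (C + W) * M^3"
      using * C(1) by (intro mult_right_mono) auto
    finally show "wbound (\<lambda>k. jap k powr (1/6)) ((C + W) * M^3) (cubic u)"
      by (rule wbound_mono_bound[OF W(2)[OF *(2)]])
  qed
  then show ?thesis by blast
qed

definition K\<^sub>0 :: real where "K\<^sub>0 = (SOME C. cubic_const C)"

lemma cubic_const_K0: "cubic_const K\<^sub>0"
  unfolding K\<^sub>0_def by (rule someI_ex[OF cubic_const_exists])

lemma K0_pos: "0 < K\<^sub>0"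
  using cubic_const_K0 by (simp add: cubic_const_def)

lemma szego_field_log_Lipschitz:
  assumes "1 \<le> M" "1 \<le> D" "0 < y" "y \<le> D" "wbound jap M u" "wbound jap M v" "norm (u - v) \<le> y"
  shows "norm (szego_field u - szego_field v) \<le> K\<^sub>0 * M^3 * y * (1 + ln (D / y))"
  using cubic_const_K0 assms unfolding cubic_const_def by metis

lemma wbound_cubic:
  assumes "0 \<le> M" "wbound jap M u"
  shows "wbound (\<lambda>k. jap k powr (1/6)) (K\<^sub>0 * M^3) (cubic u)"
  using cubic_const_K0 assms unfolding cubic_const_def by metis

lemma norm_szego_field_le:
  assumes "0 \<le> M" "wbound jap M u"
  shows "norm (szego_field u) \<le> K\<^sub>0 * M^3"
proof -
  have "norm (cubic u) \<le> K\<^sub>0 * M^3"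
    by (rule wbound_imp_norm_le[OF wbound_cubic[OF assms]])
      (use assms K0_pos jap_ge_1 in \<open>auto intro: ge_one_powr_ge_zero\<close>)
  then show ?thesis
    unfolding szego_field_def using norm_szego_projector_le order_trans by blast
qed

text \<open>Since \<open>y * (1 + ln (1 / y))\<close> tends to 0 with \<open>y\<close>, the field is
  uniformly continuous for the L2 distance on sets bounded in \<open>H^(1/2)\<close>. This suffices
  wherever only limits are taken.\<close>

lemma szego_field_modulus:
  assumes "1 \<le> M" "0 < e"
  obtains d where "0 < d" "\<And>u v. wbound jap M u \<Longrightarrow> wbound jap M v \<Longrightarrow> norm (u - v) \<le> d \<Longrightarrow>
    norm (szego_field u - szego_field v) < e"
proof -
  obtain y :: real where y: "0 < y" "y \<le> 1" "K\<^sub>0 * M^3 * (y * (1 + ln (1 / y))) < e"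
    using small_x_log[OF zero_less_one assms(2)] by blast
  show ?thesis
  proof (rule that[OF y(1)])
    fix u v assume "wbound jap M u" "wbound jap M v" "norm (u - v) \<le> y"
    then have "norm (szego_field u - szego_field v) \<le> K\<^sub>0 * M^3 * y * (1 + ln (1 / y))"
      using assms y by (intro szego_field_log_Lipschitz) auto
    then show "norm (szego_field u - szego_field v) < e"
      using y(3) by (simp add: mult.assoc)
  qed
qed

lemma continuous_on_szego_field:
  fixes u :: "real \<Rightarrow> l2_circle"
  assumes M: "1 \<le> M" and cont: "continuous_on A u" and bound: "\<And>t. t \<in> A \<Longrightarrow> wbound jap M (u t)"
  shows "continuous_on A (\<lambda>t. szego_field (u t))"
  unfolding continuous_on_iff
proof (intro ballI allI impI)
  fix t and e :: real assume t: "t \<in> A" and e: "0 < e"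
  obtain d where d: "0 < d" "\<And>u v. wbound jap M u \<Longrightarrow> wbound jap M v \<Longrightarrow> norm (u - v) \<le> d \<Longrightarrow>
      norm (szego_field u - szego_field v) < e"
    using szego_field_modulus[OF M e] by blast
  obtain d' where "0 < d'" "\<And>s. s \<in> A \<Longrightarrow> dist s t < d' \<Longrightarrow> dist (u s) (u t) < d"
    using cont t d(1) unfolding continuous_on_iff by metis
  then show "\<exists>d>0. \<forall>s\<in>A. dist s t < d \<longrightarrow> dist (szego_field (u s)) (szego_field (u t)) < e"
    using d(2) bound t by (intro exI[of _ d']) (auto simp: dist_norm less_imp_le)
qed

text \<open>Osgood's inequality: \<open>b = - 1\<close> gives uniqueness and stability, \<open>b = 1\<close> the double exponential growth of
  Sobolev norms.\<close>

lemma log_Gronwall: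
  fixes f :: "real \<Rightarrow> real"
  assumes r: "0 < r" and cont: "continuous_on {0..T} f" and f0: "\<And>s. s \<in> {0..T} \<Longrightarrow> 0 \<le> f s"
    and le: "\<And>s. s \<in> {0..T} \<Longrightarrow> f s \<le> A * (r + integral {0..s} f) * (a + b * ln (r + integral {0..s} f))"
    and b: "b \<noteq> 0" and t: "t \<in> {0..T}"
  shows "ln (r + integral {0..t} f) + a / b \<le> (ln r + a / b) * exp (A * b * t)"
proof -
  define R where "R s = r + integral {0..s} f" for s
  have int_nonneg: "0 \<le> integral {0..s} f" if "s \<in> {0..T}" for s
    using f0 that by (intro integral_nonneg integrable_continuous_real continuous_on_subset[OF cont]) auto
  have Rpos: "0 < R s" if "s \<in> {0..T}" for s
    using int_nonneg[OF that] r by (simp add: R_def)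
  have derR: "(R has_real_derivative f s) (at s within {0..T})" if "s \<in> {0..T}" for s
    unfolding R_def using integral_has_real_derivative[OF cont that]
    by (auto intro!: derivative_eq_intros)
  \<comment> \<open>The derivative of \<open>(ln R + a / b) * exp (- A b s)\<close> is
    \<open>exp (- A b s)\<close> times \<open>f / R - A * (a + b * ln R)\<close>, which is at most 0
    by hypothesis. The factor \<open>b\<close> has cancelled against \<open>a / b\<close>, so one
    argument covers both signs.\<close>
  define G where "G s = - ((ln (R s) + a / b) * exp (- (A * b * s)))" for s
  have "G 0 \<le> G t"
  proof (rule DERIV_nonneg_imp_increasing_open[of 0 t G])
    show "0 \<le> t" using t by simp
    show "continuous_on {0..t} G"
    proof -
      have "continuous_on {0..T} R"
        by (rule DERIV_continuous_on[OF derR])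
      then have "continuous_on {0..t} R"
        by (rule continuous_on_subset) (use t in auto)
      then show ?thesis
        unfolding G_def using Rpos t by (intro continuous_intros) force+
    qed
    fix s assume s: "0 < s" "s < t"
    then have sT: "s \<in> {0..T}" using t by auto
    have dR: "(R has_real_derivative f s) (at s)"
      using derR[OF sT] s t by (simp add: at_within_Icc_at)
    have "(G has_real_derivative exp (- (A * b * s)) * (A * (a + b * ln (R s)) - f s / R s)) (at s)"
      unfolding G_def using Rpos[OF sT] b dR
      by (auto intro!: derivative_eq_intros simp: field_simps)
    moreover have "f s / R s \<le> A * (a + b * ln (R s))"
      using le[OF sT] Rpos[OF sT] unfolding R_def[symmetric] by (simp add: divide_le_eq mult_ac)
    ultimately show "\<exists>y. (G has_real_derivative y) (at s) \<and> 0 \<le> y"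
      by (intro exI[of _ "exp (- (A * b * s)) * (A * (a + b * ln (R s)) - f s / R s)"]) simp
  qed
  then have "(ln (R t) + a / b) * exp (- (A * b * t)) \<le> ln r + a / b"
    by (simp add: G_def R_def)
  then have "(ln (R t) + a / b) * exp (- (A * b * t)) * exp (A * b * t) \<le> (ln r + a / b) * exp (A * b * t)"
    by (rule mult_right_mono) simp
  then show ?thesis
    by (simp add: R_def mult.assoc flip: exp_add)
qed

text \<open>\<open>\<epsilon>\<close> is the defect in the integrated equation. Galerkin solutions
  have a defect tending to 0 and exact solutions have defect 0, so a single stability estimate
  yields convergence, uniqueness and continuous dependence.\<close>

definition approx_solution :: "complex \<Rightarrow> real \<Rightarrow> real \<Rightarrow> real \<Rightarrow> (real \<Rightarrow> l2_circle) \<Rightarrow> bool" where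
  "approx_solution c T M \<epsilon> u \<longleftrightarrow> continuous_on {0..T} u \<and> (\<forall>t\<in>{0..T}. wbound jap M (u t)) \<and>
     (\<forall>t\<in>{0..T}. norm (u t - u 0 - cscale c (integral {0..t} (\<lambda>s. szego_field (u s)))) \<le> \<epsilon>)"

text \<open>The distance itself need not be differentiable in time; Osgood's argument runs on the
  majorant \<open>r\<close> plus the integral of the difference of the fields. The log-Lipschitz
  bound, with this majorant as \<open>y\<close>, closes the inequality with
  \<open>b = - 1\<close>.\<close>

lemma approx_solution_stable:
  assumes c: "cmod c = 1" and M: "1 \<le> M" and T: "0 \<le> T"
    and u: "approx_solution c T M \<epsilon> u" and v: "approx_solution c T M \<epsilon> v"
    and r: "norm (u 0 - v 0) + 2 * \<epsilon> \<le> r" "0 < r" "r \<le> 1" and t: "t \<in> {0..T}"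
  defines "a \<equiv> 1 + ln (1 + 2 * T * (K\<^sub>0 * M^3))"
  shows "ln (r + integral {0..t} (\<lambda>s. norm (szego_field (u s) - szego_field (v s)))) \<le> a - (a - ln r) * exp (- (K\<^sub>0 * M^3 * t))"
    and "norm (u t - v t) \<le> r + integral {0..t} (\<lambda>s. norm (szego_field (u s) - szego_field (v s)))"
proof -
  let ?f = "\<lambda>s. norm (szego_field (u s) - szego_field (v s))"
  let ?R = "\<lambda>t. r + integral {0..t} ?f"
  \<comment> \<open>\<open>D\<close> bounds the majorant on the whole interval:
    \<open>r \<le> 1\<close>, and each field has norm at most
    \<open>K\<^sub>0 * M^3\<close>.\<close>
  define D where "D = 1 + 2 * T * (K\<^sub>0 * M^3)"
  have KM: "0 \<le> K\<^sub>0 * M^3" using K0_pos M by simp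
  have D: "1 \<le> D" using T KM by (simp add: D_def)
  have bu: "wbound jap M (u s)" "wbound jap M (v s)" if "s \<in> {0..T}" for s
    using u v that by (auto simp: approx_solution_def)
  have contu: "continuous_on {0..T} (\<lambda>s. szego_field (u s))" "continuous_on {0..T} (\<lambda>s. szego_field (v s))"
    using u v bu by (auto intro!: continuous_on_szego_field[OF M] simp: approx_solution_def)
  have contf: "continuous_on {0..T} ?f"
    by (intro continuous_intros contu)
  have sub: "{0..s} \<subseteq> {0..T}" if "s \<in> {0..T}" for s :: real
    using that by auto
  have int: "?f integrable_on {0..s}" "(\<lambda>s. szego_field (u s)) integrable_on {0..s}"
    "(\<lambda>s. szego_field (v s)) integrable_on {0..s}" if "s \<in> {0..T}" for s
    using sub[OF that] by (auto intro!: integrable_continuous_real continuous_on_subset[OF contf]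
        continuous_on_subset[OF contu(1)] continuous_on_subset[OF contu(2)])
  have R_le: "?R s \<le> D" if s: "s \<in> {0..T}" for s
  proof -
    have "integral {0..s} ?f \<le> integral {0..s} (\<lambda>_. 2 * (K\<^sub>0 * M^3))"
    proof (rule integral_le[OF int(1)[OF s]])
      fix x assume "x \<in> {0..s}"
      then have x: "x \<in> {0..T}" using s by auto
      have "?f x \<le> norm (szego_field (u x)) + norm (szego_field (v x))"
        by (rule norm_triangle_ineq4)
      also have "\<dots> \<le> 2 * (K\<^sub>0 * M^3)"
        using norm_szego_field_le[OF _ bu(1)[OF x]] norm_szego_field_le[OF _ bu(2)[OF x]] M by simp
      finally show "?f x \<le> 2 * (K\<^sub>0 * M^3)" .
    qed auto
    also have "\<dots> = s * (2 * (K\<^sub>0 * M^3))"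
      using s by simp
    also have "\<dots> \<le> T * (2 * (K\<^sub>0 * M^3))"
      using s KM by (intro mult_right_mono) auto
    finally show ?thesis using r(3) by (simp add: D_def)
  qed
  have norm_le: "norm (u s - v s) \<le> ?R s" if s: "s \<in> {0..T}" for s
  proof -
    let ?U = "u s - u 0 - cscale c (integral {0..s} (\<lambda>s. szego_field (u s)))"
    let ?V = "v s - v 0 - cscale c (integral {0..s} (\<lambda>s. szego_field (v s)))"
    let ?I = "cscale c (integral {0..s} (\<lambda>s. szego_field (u s) - szego_field (v s)))"
    have "?I = cscale c (integral {0..s} (\<lambda>s. szego_field (u s))) - cscale c (integral {0..s} (\<lambda>s. szego_field (v s)))"
      by (simp add: integral_diff[OF int(2)[OF s] int(3)[OF s]] cscale_diff_right)
    then have "u s - v s = ?U - ?V + (u 0 - v 0) + ?I"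
      by simp
    then have "norm (u s - v s) \<le> norm (?U - ?V + (u 0 - v 0)) + norm ?I"
      by (simp only: norm_triangle_ineq)
    also have "norm (?U - ?V + (u 0 - v 0)) \<le> norm (?U - ?V) + norm (u 0 - v 0)"
      by (rule norm_triangle_ineq)
    also have "norm (?U - ?V) \<le> norm ?U + norm ?V"
      by (rule norm_triangle_ineq4)
    also have "norm ?U \<le> \<epsilon>" using u s by (auto simp: approx_solution_def)
    also have "norm ?V \<le> \<epsilon>" using v s by (auto simp: approx_solution_def)
    also have "norm ?I \<le> integral {0..s} ?f"
    proof -
      have "norm ?I = norm (integral {0..s} (\<lambda>s. szego_field (u s) - szego_field (v s)))"
        by (simp add: c)
      also have "\<dots> \<le> integral {0..s} ?f"
        using int[OF s] by (intro integral_norm_bound_integral integrable_diff) auto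
      finally show ?thesis .
    qed
    finally show ?thesis using r(1) by simp
  qed
  show "norm (u t - v t) \<le> ?R t"
    by (rule norm_le[OF t])
  have "ln (?R t) + a / (- 1) \<le> (ln r + a / (- 1)) * exp (K\<^sub>0 * M^3 * (- 1) * t)"
  proof (rule log_Gronwall[OF r(2) contf _ _ _ t])
    fix s assume s: "s \<in> {0..T}"
    have "0 \<le> integral {0..s} ?f"
      using int(1)[OF s] by (intro integral_nonneg) auto
    then have Rpos: "0 < ?R s" using r(2) by linarith
    have "?f s \<le> K\<^sub>0 * M^3 * ?R s * (1 + ln (D / ?R s))"
      by (rule szego_field_log_Lipschitz[OF M D Rpos R_le[OF s] bu[OF s] norm_le[OF s]])
    also have "ln (D / ?R s) = ln D - ln (?R s)"
      using Rpos D by (intro ln_divide_pos) auto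
    also have "1 + (ln D - ln (?R s)) = a + (- 1) * ln (?R s)"
      by (simp add: a_def D_def)
    finally show "?f s \<le> K\<^sub>0 * M^3 * ?R s * (a + (- 1) * ln (?R s))" .
  qed auto
  then show "ln (?R t) \<le> a - (a - ln r) * exp (- (K\<^sub>0 * M^3 * t))"
    by (simp add: algebra_simps)
qed

text \<open>The growth factor acts on \<open>ln r\<close> and not on \<open>r\<close>. Although
  \<open>q\<close> may be tiny, \<open>q * ln r\<close> still tends to minus infinity as
  \<open>r\<close> tends to 0, so a suitable \<open>r\<close> exists, depending on \<open>M\<close>,
  \<open>T\<close> and \<open>\<eta>\<close> alone.\<close>

lemma approx_solution_stability:
  assumes M: "1 \<le> M" and T: "0 \<le> T" and \<eta>: "0 < \<eta>"
  obtains r where "0 < r"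
    "\<And>c \<epsilon> u v t. cmod c = 1 \<Longrightarrow> approx_solution c T M \<epsilon> u \<Longrightarrow> approx_solution c T M \<epsilon> v \<Longrightarrow>
      norm (u 0 - v 0) + 2 * \<epsilon> \<le> r \<Longrightarrow> t \<in> {0..T} \<Longrightarrow> norm (u t - v t) \<le> \<eta>"
proof -
  define a where "a = 1 + ln (1 + 2 * T * (K\<^sub>0 * M^3))"
  define q where "q = exp (- (K\<^sub>0 * M^3 * T))"
  \<comment> \<open>The exponential is the solution of
    \<open>a - (a - ln r) * q = ln \<eta>\<close>; the cap 1 is demanded by
    \<open>approx_solution_stable\<close>.\<close>
  define r where "r = min 1 (exp ((ln \<eta> - a * (1 - q)) / q))"
  have KM: "0 \<le> K\<^sub>0 * M^3" using K0_pos M by simp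
  have a1: "1 \<le> a" using T KM by (simp add: a_def)
  have q: "0 < q" by (simp add: q_def)
  have r: "0 < r" "r \<le> 1" by (auto simp: r_def)
  have lnr: "ln r \<le> 0" using r by simp
  have "ln r \<le> (ln \<eta> - a * (1 - q)) / q"
  proof -
    have "ln r \<le> ln (exp ((ln \<eta> - a * (1 - q)) / q))"
      using r(1) by (intro iffD2[OF ln_le_cancel_iff]) (auto simp: r_def)
    then show ?thesis by simp
  qed
  then have lnr2: "a - (a - ln r) * q \<le> ln \<eta>"
    using q by (simp add: field_simps)
  show ?thesis
  proof (rule that[OF r(1)])
    fix c \<epsilon> u v t
    assume *: "cmod c = 1" "approx_solution c T M \<epsilon> u" "approx_solution c T M \<epsilon> v"
      "norm (u 0 - v 0) + 2 * \<epsilon> \<le> r" and t: "t \<in> {0..T}"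
    let ?R = "r + integral {0..t} (\<lambda>s. norm (szego_field (u s) - szego_field (v s)))"
    have "ln ?R \<le> a - (a - ln r) * exp (- (K\<^sub>0 * M^3 * t))"
      unfolding a_def by (rule approx_solution_stable(1)[OF *(1) M T *(2-4) r t])
    also have "\<dots> \<le> a - (a - ln r) * q"
      unfolding q_def using t KM lnr a1
      by (intro diff_left_mono mult_left_mono) (auto intro!: mult_left_mono)
    also have "\<dots> \<le> ln \<eta>" by (rule lnr2)
    finally have "ln ?R \<le> ln \<eta>" .
    moreover have "0 < ?R"
    proof -
      have "0 \<le> integral {0..t} (\<lambda>s. norm (szego_field (u s) - szego_field (v s)))"
      \<comment> \<open>A function that is not integrable has \<open>integral\<close> 0 by default,
        so the sign is right in either case.\<close>
      proof (cases "(\<lambda>s. norm (szego_field (u s) - szego_field (v s))) integrable_on {0..t}")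
        case True
        then show ?thesis by (intro integral_nonneg) auto
      next
        case False
        then show ?thesis by (simp add: not_integrable_integral)
      qed
      then show ?thesis using r(1) by linarith
    qed
    ultimately have "?R \<le> \<eta>"
      using \<eta> by simp
    then show "norm (u t - v t) \<le> \<eta>"
      using approx_solution_stable(2)[OF *(1) M T *(2-4) r t] by linarith
  qed
qed

lemma approx_solution_unique:
  assumes c: "cmod c = 1" and u: "approx_solution c T M 0 u" and v: "approx_solution c T N 0 v"
    and eq: "u 0 = v 0" and t: "t \<in> {0..T}"
  shows "u t = v t"
proof -
  define B where "B = max 1 (max \<bar>M\<bar> \<bar>N\<bar>)"
  have u': "approx_solution c T B 0 u" and v': "approx_solution c T B 0 v"
    using u v unfolding approx_solution_def B_def
    by (auto intro: wbound_mono_bound[of _ M] wbound_mono_bound[of _ N])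
  have T: "0 \<le> T" using t by auto
  have small: "norm (u t - v t) \<le> \<eta>" if \<eta>: "0 < \<eta>" for \<eta>
  proof -
    obtain r where r: "0 < r" "\<And>c \<epsilon> u v t. cmod c = 1 \<Longrightarrow> approx_solution c T B \<epsilon> u \<Longrightarrow> approx_solution c T B \<epsilon> v \<Longrightarrow>
      norm (u 0 - v 0) + 2 * \<epsilon> \<le> r \<Longrightarrow> t \<in> {0..T} \<Longrightarrow> norm (u t - v t) \<le> \<eta>"
      using approx_solution_stability[OF _ T \<eta>, of B] by (auto simp: B_def)
    show ?thesis
      by (rule r(2)[OF c u' v' _ t]) (use eq r(1) in simp)
  qed
  have "norm (u t - v t) \<le> 0"
  proof (rule field_le_epsilon)
    fix e :: real assume "0 < e"
    then show "norm (u t - v t) \<le> 0 + e" using small[of e] by simp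
  qed
  then show ?thesis by simp
qed

section \<open>Sobolev norms along Galerkin approximations\<close>

text \<open>Below \<open>\<rho>\<close> the \<open>H^(1/2)\<close> bound costs
  \<open>sqrt (ln \<rho>)\<close>; above \<open>\<rho>\<close> the squared sum is at most
  \<open>\<rho> powr (- \<theta>) * W * R^2\<close> with \<open>\<theta> = s - 1/2\<close>. The
  choice \<open>\<rho> = R powr (2 / \<theta>)\<close> cancels \<open>R^2\<close>, so the
  \<open>H^s\<close> norm enters through its logarithm only.\<close>

lemma Brezis_Gallouet_wiener:
  fixes a :: "int \<Rightarrow> real"
  assumes S: "finite S" and a: "\<And>k. 0 \<le> a k" and s: "1/2 < s"
    and W: "\<And>F. finite F \<Longrightarrow> (\<Sum>k\<in>F. jap k powr (- (s + 1/2))) \<le> W"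
    and H: "(\<Sum>k\<in>S. jap k * (a k)\<^sup>2) \<le> M\<^sup>2" and M: "0 \<le> M"
    and Hs: "L2_set (\<lambda>k. jap k powr s * a k) S \<le> R" and R: "1 \<le> R"
  shows "(\<Sum>k\<in>S. a k)\<^sup>2 \<le> ((8 + 8 / (s - 1/2)) * M\<^sup>2 + 2 * W) * (1 + ln R)"
proof -
  define \<theta> where "\<theta> = s - 1/2"
  have \<theta>: "0 < \<theta>" using s by (simp add: \<theta>_def)
  define q where "q = 8 / \<theta>"
  have q: "0 \<le> q" using \<theta> by (simp add: q_def)
  define \<rho> where "\<rho> = R powr (2 / \<theta>)"
  have \<rho>: "1 \<le> \<rho>" unfolding \<rho>_def using R \<theta> by (intro ge_one_powr_ge_zero) auto
  have ln\<rho>: "ln \<rho> = 2 / \<theta> * ln R" unfolding \<rho>_def by (rule ln_powr)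
  have W0: "0 \<le> W" using W[of "{}"] by simp
  have lnR: "0 \<le> ln R" using R by simp
  let ?lo = "\<Sum>k\<in>S. if \<bar>real_of_int k\<bar> \<le> \<rho> then a k else 0"
  let ?hi = "\<Sum>k\<in>S. if \<bar>real_of_int k\<bar> \<le> \<rho> then 0 else a k"
  have split: "(\<Sum>k\<in>S. a k) = ?lo + ?hi"
    unfolding sum.distrib[symmetric] by (rule sum.cong) auto
  have lo: "?lo \<le> sqrt (4 + 2 * ln \<rho>) * M"
    by (rule sum_low_le[OF S \<rho> a H M])
  have lo0: "0 \<le> ?lo" by (rule sum_nonneg) (auto simp: a)
  have lo2: "?lo\<^sup>2 \<le> (4 + 2 * ln \<rho>) * M\<^sup>2"
  proof -
    have "?lo\<^sup>2 \<le> (sqrt (4 + 2 * ln \<rho>) * M)\<^sup>2"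
      by (rule power_mono[OF lo lo0])
    also have "\<dots> = (4 + 2 * ln \<rho>) * M\<^sup>2"
      using \<rho> by (simp add: power_mult_distrib)
    finally show ?thesis .
  qed
  have hi2: "?hi\<^sup>2 \<le> W"
  proof -
    define F where "F = {k\<in>S. \<not> \<bar>real_of_int k\<bar> \<le> \<rho>}"
    have F: "finite F" using S by (simp add: F_def)
    have "?hi = (\<Sum>k\<in>F. a k)"
      unfolding F_def using S by (subst sum.inter_filter) (auto intro!: sum.cong)
    also have "\<dots> = (\<Sum>k\<in>F. jap k powr (- s) * (jap k powr s * a k))"
      by (rule sum.cong) (simp_all add: powr_minus field_simps)
    finally have "?hi\<^sup>2 = (\<Sum>k\<in>F. jap k powr (- s) * (jap k powr s * a k))\<^sup>2" by simp
    also have "\<dots> \<le> (\<Sum>k\<in>F. (jap k powr (- s))\<^sup>2) * (\<Sum>k\<in>F. (jap k powr s * a k)\<^sup>2)"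
      by (rule Cauchy_Schwarz_ineq_sum)
    also have "\<dots> \<le> (\<rho> powr (- \<theta>) * W) * R\<^sup>2"
    proof (rule mult_mono)
      have "(\<Sum>k\<in>F. (jap k powr (- s))\<^sup>2) \<le> (\<Sum>k\<in>F. \<rho> powr (- \<theta>) * jap k powr (- (s + 1/2)))"
      proof (rule sum_mono)
        fix k assume "k \<in> F"
        then have k: "\<rho> \<le> jap k" by (simp add: F_def jap_def)
        \<comment> \<open>\<open>2 * s\<close> is split as \<open>(s - 1/2) + (s + 1/2)\<close>: the
          first exponent gives decay in \<open>\<rho>\<close>, the second exceeds 1 and is
          summable.\<close>
        have "(jap k powr (- s))\<^sup>2 = jap k powr (- \<theta>) * jap k powr (- (s + 1/2))"
          by (simp add: powr_power \<theta>_def flip: powr_add)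
        also have "\<dots> \<le> \<rho> powr (- \<theta>) * jap k powr (- (s + 1/2))"
          using k \<rho> \<theta> by (intro mult_right_mono powr_mono2') auto
        finally show "(jap k powr (- s))\<^sup>2 \<le> \<rho> powr (- \<theta>) * jap k powr (- (s + 1/2))" .
      qed
      also have "\<dots> = \<rho> powr (- \<theta>) * (\<Sum>k\<in>F. jap k powr (- (s + 1/2)))"
        by (simp add: sum_distrib_left)
      also have "\<dots> \<le> \<rho> powr (- \<theta>) * W"
        by (intro mult_left_mono W F) simp
      finally show "(\<Sum>k\<in>F. (jap k powr (- s))\<^sup>2) \<le> \<rho> powr (- \<theta>) * W" .
      have "(\<Sum>k\<in>F. (jap k powr s * a k)\<^sup>2) \<le> (\<Sum>k\<in>S. (jap k powr s * a k)\<^sup>2)"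
        using S by (intro sum_mono2) (auto simp: F_def)
      also have "\<dots> \<le> R\<^sup>2"
        using Hs unfolding L2_set_def by (rule sqrt_le_D)
      finally show "(\<Sum>k\<in>F. (jap k powr s * a k)\<^sup>2) \<le> R\<^sup>2" .
    qed (auto intro!: sum_nonneg mult_nonneg_nonneg W0)
    also have "\<rho> powr (- \<theta>) = R powr (- 2)"
      unfolding \<rho>_def powr_powr using \<theta> by simp
    also have "R powr (- 2) * W * R\<^sup>2 = W"
      using R by (simp add: powr_minus field_simps)
    finally show ?thesis .
  qed
  have "(\<Sum>k\<in>S. a k)\<^sup>2 \<le> 2 * ?lo\<^sup>2 + 2 * ?hi\<^sup>2"
    unfolding split using sum_squares_bound[of ?lo ?hi] by (simp add: power2_sum)
  also have "\<dots> \<le> 2 * ((4 + 2 * ln \<rho>) * M\<^sup>2) + 2 * W"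
    using lo2 hi2 by simp
  also have "\<dots> = (8 + q * ln R) * M\<^sup>2 + 2 * W"
    by (simp add: ln\<rho> q_def algebra_simps)
  also have "\<dots> \<le> ((8 + q) * (1 + ln R)) * M\<^sup>2 + (2 * W) * (1 + ln R)"
  proof (intro add_mono mult_right_mono)
    show "8 + q * ln R \<le> (8 + q) * (1 + ln R)"
      using lnR q by (simp add: algebra_simps)
    show "2 * W \<le> 2 * W * (1 + ln R)" using W0 lnR by (simp add: distrib_left)
  qed simp
  also have "\<dots> = ((8 + q) * M\<^sup>2 + 2 * W) * (1 + ln R)"
    by (simp add: algebra_simps)
  finally show ?thesis by (simp add: \<theta>_def q_def)
qed

text \<open>The Fourier multiplier \<open>jap powr s\<close> cut off to \<open>S\<close>, which is
  bounded on L2 for finite \<open>S\<close>. It moves \<open>H^s\<close> estimates under the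
  L2-valued integral, so that no integration in \<open>H^s\<close> is needed.\<close>

definition weighted :: "real \<Rightarrow> int set \<Rightarrow> l2_circle \<Rightarrow> l2_circle" where
  "weighted s S v = trig S (\<lambda>k. complex_of_real (jap k powr s) * fourier_coeff v k)"

lemma norm_weighted:
  assumes "finite S"
  shows "norm (weighted s S v) = L2_set (\<lambda>k. jap k powr s * cmod (fourier_coeff v k)) S"
proof -
  have "norm (weighted s S v) = sqrt ((norm (weighted s S v))\<^sup>2)" by simp
  also have "\<dots> = L2_set (\<lambda>k. jap k powr s * cmod (fourier_coeff v k)) S"
    unfolding weighted_def norm_trig[OF assms] L2_set_def by (simp add: norm_mult)
  finally show ?thesis .
qed

lemma norm_weighted_power2:
  assumes "finite K"
  shows "(norm (weighted s K v))\<^sup>2 = (\<Sum>k\<in>K. jap k powr (2 * s) * (cmod (fourier_coeff v k))\<^sup>2)"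
  unfolding norm_weighted[OF assms] L2_set_def
  by (simp add: sum_nonneg power_mult_distrib powr_power mult.commute)

lemma bounded_linear_weighted: "bounded_linear (weighted s S)"
proof -
  have char: "bounded_linear (\<lambda>z. cscale z (character k))" for k
  proof (rule bounded_linear_intro)
    show "cscale (x + y) (character k) = cscale x (character k) + cscale y (character k)" for x y
      by (rule cscale_add_left)
    show "cscale (r *\<^sub>R x) (character k) = r *\<^sub>R cscale x (character k)" for r x
      by (simp add: scaleR_conv_of_real flip: cscale_of_real)
    show "norm (cscale x (character k)) \<le> norm x * norm (character k)" for x
      by simp
  qed
  show ?thesis
    unfolding weighted_def[abs_def] trig_def
    by (intro bounded_linear_sum bounded_linear_compose[OF char]
        bounded_linear_const_mult bounded_linear_fourier_coeff)
qed

text \<open>\<open>?R\<close> majorises the \<open>H^s\<close> norm as in the stability estimate.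
  The tame bound times the squared l1 norm from \<open>Brezis_Gallouet_wiener\<close> gives
  \<open>f \<le> A * ?R * (1 + ln ?R)\<close>, hence \<open>b = 1\<close>. The bound
  \<open>B'\<close> is chosen before \<open>n\<close>, so it survives the limit of the Galerkin
  scheme.\<close>

lemma galerkin_sobolev_bound:
  assumes s: "1/2 < s" and M: "1 \<le> M" and c: "cmod c = 1"
  obtains B' where "\<And>n (u :: real \<Rightarrow> l2_circle) t. continuous_on {0..} u \<Longrightarrow>
    (\<And>t. 0 \<le> t \<Longrightarrow> u t = u 0 + integral {0..t} (\<lambda>s. cscale c (galerkin_field n (u s)))) \<Longrightarrow>
    (\<And>t k. 0 \<le> t \<Longrightarrow> k \<notin> {0..int n} \<Longrightarrow> fourier_coeff (u t) k = 0) \<Longrightarrow>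
    (\<And>t. 0 \<le> t \<Longrightarrow> wbound jap M (u t)) \<Longrightarrow> continuous_on UNIV (galerkin_field n) \<Longrightarrow>
    wbound (\<lambda>k. jap k powr (2 * s)) B (u 0) \<Longrightarrow> t \<in> {0..T} \<Longrightarrow> wbound (\<lambda>k. jap k powr (2 * s)) B' (u t)"
proof -
  obtain W where W0: "0 \<le> W" and W: "\<And>F. finite F \<Longrightarrow> (\<Sum>k\<in>F. jap k powr (- (s + 1/2))) \<le> W"
    using sum_jap_powr_bounded[of "s + 1/2"] s by auto
  \<comment> \<open>\<open>wbound\<close> sees only the square of \<open>B\<close>, hence the
    absolute value; starting from at least 1 keeps the logarithm nonnegative.\<close>
  define r where "r = max 1 \<bar>B\<bar>"
  have r: "1 \<le> r" "\<bar>B\<bar> \<le> r" by (auto simp: r_def)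
  define C where "C = (8 + 8 / (s - 1/2)) * M\<^sup>2 + 2 * W"
  define A where "A = 3 * 3 powr s * C"
  have C: "0 \<le> C" using s W0 by (simp add: C_def)
  then have A: "0 \<le> A" by (simp add: A_def)
  show ?thesis
  proof (rule that)
    fix n and u :: "real \<Rightarrow> l2_circle" and t :: real
    assume cont: "continuous_on {0..} u"
      and u: "\<And>t. 0 \<le> t \<Longrightarrow> u t = u 0 + integral {0..t} (\<lambda>s. cscale c (galerkin_field n (u s)))"
      and supp: "\<And>t k. 0 \<le> t \<Longrightarrow> k \<notin> {0..int n} \<Longrightarrow> fourier_coeff (u t) k = 0"
      and bound: "\<And>t. 0 \<le> t \<Longrightarrow> wbound jap M (u t)"
      and contG: "continuous_on UNIV (galerkin_field n)"
      and B: "wbound (\<lambda>k. jap k powr (2 * s)) B (u 0)" and t: "t \<in> {0..T}"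
    let ?S = "{0..int n}"
    define f where "f t = norm (weighted s ?S (galerkin_field n (u t)))" for t
    have contGu: "continuous_on {0..T} (\<lambda>s. galerkin_field n (u s))"
      by (rule continuous_on_compose2[OF contG continuous_on_subset[OF cont]]) auto
    have contf: "continuous_on {0..T} f"
      unfolding f_def
      by (intro continuous_intros bounded_linear.continuous_on[OF bounded_linear_weighted] contGu)
    have intG: "(\<lambda>s. galerkin_field n (u s)) integrable_on {0..\<tau>}" if "\<tau> \<in> {0..T}" for \<tau>
      using that by (intro integrable_continuous_real continuous_on_subset[OF contGu]) auto
    have intf: "f integrable_on {0..\<tau>}" if "\<tau> \<in> {0..T}" for \<tau>
      using that by (intro integrable_continuous_real continuous_on_subset[OF contf]) auto
    let ?R = "\<lambda>\<tau>. r + integral {0..\<tau>} f"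
    have R1: "1 \<le> ?R \<tau>" if "\<tau> \<in> {0..T}" for \<tau>
    proof -
      have "0 \<le> integral {0..\<tau>} f"
        by (rule integral_nonneg[OF intf[OF that]]) (simp add: f_def)
      then show ?thesis using r by linarith
    qed
    have y: "norm (weighted s ?S (u \<tau>)) \<le> ?R \<tau>" if \<tau>: "\<tau> \<in> {0..T}" for \<tau>
    proof -
      interpret w: bounded_linear "weighted s ?S" by (rule bounded_linear_weighted)
      have int': "(\<lambda>s. cscale c (galerkin_field n (u s))) integrable_on {0..\<tau>}"
        using integrable_linear[OF intG[OF \<tau>] bounded_linear_cscale] by (simp add: o_def)
      have wc: "weighted s ?S (cscale c v) = cscale c (weighted s ?S v)" for v
        unfolding weighted_def by (rule fourier_coeff_eqI) simp
      have "weighted s ?S (u \<tau>) = weighted s ?S (u 0)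
          + integral {0..\<tau>} (\<lambda>x. weighted s ?S (cscale c (galerkin_field n (u x))))"
        using \<tau> u[of \<tau>] integral_linear[OF int' bounded_linear_weighted[of s ?S]]
        by (simp add: w.add o_def)
      then have "norm (weighted s ?S (u \<tau>)) \<le> norm (weighted s ?S (u 0))
          + norm (integral {0..\<tau>} (\<lambda>x. weighted s ?S (cscale c (galerkin_field n (u x)))))"
        by (simp only: norm_triangle_ineq)
      also have "norm (weighted s ?S (u 0)) \<le> r"
      proof -
        have "(norm (weighted s ?S (u 0)))\<^sup>2 = (\<Sum>k\<in>?S. jap k powr (2 * s) * (cmod (fourier_coeff (u 0) k))\<^sup>2)"
          by (rule norm_weighted_power2) simp
        also have "\<dots> \<le> \<bar>B\<bar>\<^sup>2" using wboundD[OF B, of ?S] by simp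
        finally have "norm (weighted s ?S (u 0)) \<le> \<bar>B\<bar>" by (rule power2_le_imp_le) simp
        then show ?thesis using r by linarith
      qed
      also have "norm (integral {0..\<tau>} (\<lambda>x. weighted s ?S (cscale c (galerkin_field n (u x))))) \<le> integral {0..\<tau>} f"
      proof (rule integral_norm_bound_integral[OF _ intf[OF \<tau>]])
        show "(\<lambda>x. weighted s ?S (cscale c (galerkin_field n (u x)))) integrable_on {0..\<tau>}"
          using integrable_linear[OF int' bounded_linear_weighted[of s ?S]] by (simp add: o_def)
      qed (simp add: wc c f_def)
      finally show ?thesis by simp
    qed
    have "ln (?R t) + 1 / 1 \<le> (ln r + 1 / 1) * exp (A * 1 * t)"
    proof (rule log_Gronwall[OF _ contf _ _ _ t])
      fix \<tau> assume \<tau>: "\<tau> \<in> {0..T}"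
      let ?a = "fourier_coeff (u \<tau>)"
      have ys: "L2_set (\<lambda>k. jap k powr s * cmod (?a k)) ?S \<le> ?R \<tau>"
        using y[OF \<tau>] by (simp add: norm_weighted)
      have "f \<tau> = L2_set (\<lambda>k. jap k powr s * cmod (tcoeff ?S ?a k)) ?S"
        unfolding f_def norm_weighted[OF finite_atLeastAtMost_int]
        by (rule L2_set_cong) (auto simp: fourier_coeff_galerkin_field)
      also have "\<dots> \<le> 3 * 3 powr s * (\<Sum>k\<in>?S. cmod (?a k))\<^sup>2 * L2_set (\<lambda>k. jap k powr s * cmod (?a k)) ?S"
        using s by (intro tcoeff_tame) auto
      also have "\<dots> \<le> 3 * 3 powr s * (C * (1 + ln (?R \<tau>))) * ?R \<tau>"
      proof (intro mult_mono mult_left_mono ys)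
        show "(\<Sum>k\<in>?S. cmod (?a k))\<^sup>2 \<le> C * (1 + ln (?R \<tau>))"
          unfolding C_def using \<tau> M wboundD[OF bound, of \<tau> ?S]
          by (intro Brezis_Gallouet_wiener s W ys R1) auto
      qed (use C R1[OF \<tau>] in auto)
      also have "\<dots> = A * ?R \<tau> * (1 + 1 * ln (?R \<tau>))"
        by (simp add: A_def mult_ac)
      finally show "f \<tau> \<le> A * ?R \<tau> * (1 + 1 * ln (?R \<tau>))" .
    qed (use r in \<open>auto simp: f_def\<close>)
    also have "\<dots> \<le> (ln r + 1) * exp (A * T)"
      using t A r by (intro mult_mono) (auto intro!: mult_left_mono)
    finally have "ln (?R t) \<le> (ln r + 1) * exp (A * T)" by simp
    then have "?R t \<le> exp ((ln r + 1) * exp (A * T))"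
      using R1[OF t] by (metis exp_le_cancel_iff exp_ln less_le_trans zero_less_one)
    then have le: "norm (weighted s ?S (u t)) \<le> exp ((ln r + 1) * exp (A * T))"
      using y[OF t] by linarith
    show "wbound (\<lambda>k. jap k powr (2 * s)) (exp ((ln r + 1) * exp (A * T))) (u t)"
      unfolding wbound_def
    proof (intro allI impI)
      fix F :: "int set" assume F: "finite F"
      have "(\<Sum>k\<in>F. jap k powr (2 * s) * (cmod (fourier_coeff (u t) k))\<^sup>2)
          \<le> (\<Sum>k\<in>F \<union> ?S. jap k powr (2 * s) * (cmod (fourier_coeff (u t) k))\<^sup>2)"
        using F by (intro sum_mono2) auto
      also have "\<dots> = (\<Sum>k\<in>?S. jap k powr (2 * s) * (cmod (fourier_coeff (u t) k))\<^sup>2)"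
        using F supp[of t] t by (intro sum.mono_neutral_right) auto
      also have "\<dots> = (norm (weighted s ?S (u t)))\<^sup>2"
        by (rule norm_weighted_power2[symmetric]) simp
      also have "\<dots> \<le> (exp ((ln r + 1) * exp (A * T)))\<^sup>2"
        by (intro power_mono le) simp
      finally show "(\<Sum>k\<in>F. jap k powr (2 * s) * (cmod (fourier_coeff (u t) k))\<^sup>2)
          \<le> (exp ((ln r + 1) * exp (A * T)))\<^sup>2" .
    qed
  qed
qed

section \<open>Existence of forward solutions\<close>

text \<open>As \<open>v\<close> has no frequencies outside \<open>0..n\<close>, the two fields
  differ by the frequencies above \<open>n\<close> of the cubic term. Its \<open>H^(1/12)\<close>
  bound turns into the decay \<open>(n + 1) powr (-1/12)\<close>.\<close>

lemma galerkin_defect: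
  assumes M: "0 \<le> M" and v: "wbound jap M v" and supp: "\<And>k. k \<notin> {0..int n} \<Longrightarrow> fourier_coeff v k = 0"
  shows "norm (galerkin_field n v - szego_field v) \<le> K\<^sub>0 * M^3 * real (Suc n) powr (-1/12)"
proof (rule norm_le_fourier_coeffI)
  show "0 \<le> K\<^sub>0 * M^3 * real (Suc n) powr (-1/12)"
    using K0_pos M by simp
  have v_eq: "trig {0..int n} (fourier_coeff v) = v"
    by (rule fourier_coeff_eqI) (use supp in auto)
  have coeff: "fourier_coeff (galerkin_field n v - szego_field v) k
      = (if int n < k then - fourier_coeff (cubic v) k else 0)" for k
    unfolding galerkin_field_def v_eq szego_field_def by (auto simp: fourier_coeff_diff)
  fix S :: "int set" assume S: "finite S"
  have "(\<Sum>k\<in>S. (cmod (fourier_coeff (galerkin_field n v - szego_field v) k))\<^sup>2)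
      \<le> (\<Sum>k\<in>S. real (Suc n) powr (-1/6) * (jap k powr (1/6) * (cmod (fourier_coeff (cubic v) k))\<^sup>2))"
  proof (rule sum_mono)
    fix k
    show "(cmod (fourier_coeff (galerkin_field n v - szego_field v) k))\<^sup>2
        \<le> real (Suc n) powr (-1/6) * (jap k powr (1/6) * (cmod (fourier_coeff (cubic v) k))\<^sup>2)"
    proof (cases "int n < k")
      case True
      then have "real (Suc n) \<le> jap k" by (simp add: jap_def)
      then have "jap k powr (-1/6) \<le> real (Suc n) powr (-1/6)"
        by (intro powr_mono2') auto
      then have "jap k powr (-1/6) * jap k powr (1/6) \<le> real (Suc n) powr (-1/6) * jap k powr (1/6)"
        by (rule mult_right_mono) simp
      then have "1 \<le> real (Suc n) powr (-1/6) * jap k powr (1/6)"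
        by (simp flip: powr_add)
      then have "1 * (cmod (fourier_coeff (cubic v) k))\<^sup>2
          \<le> (real (Suc n) powr (-1/6) * jap k powr (1/6)) * (cmod (fourier_coeff (cubic v) k))\<^sup>2"
        by (rule mult_right_mono) simp
      then show ?thesis using True by (simp only: coeff if_True norm_minus_cancel mult_1_left mult.assoc)
    next
      case False
      then show ?thesis by (simp add: coeff)
    qed
  qed
  also have "\<dots> = real (Suc n) powr (-1/6) * (\<Sum>k\<in>S. jap k powr (1/6) * (cmod (fourier_coeff (cubic v) k))\<^sup>2)"
    by (simp only: sum_distrib_left)
  also have "\<dots> \<le> real (Suc n) powr (-1/6) * (K\<^sub>0 * M^3)\<^sup>2"
    by (intro mult_left_mono wboundD[OF wbound_cubic[OF M v] S]) simp
  also have "\<dots> = (K\<^sub>0 * M^3 * real (Suc n) powr (-1/12))\<^sup>2"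
  proof -
    have "real (Suc n) powr (-1/6) = (real (Suc n) powr (-1/12))\<^sup>2"
      by (subst powr_power) auto
    then show ?thesis by (simp only: power_mult_distrib mult_ac)
  qed
  finally show "(\<Sum>k\<in>S. (cmod (fourier_coeff (galerkin_field n v - szego_field v) k))\<^sup>2)
      \<le> (K\<^sub>0 * M^3 * real (Suc n) powr (-1/12))\<^sup>2" .
qed

lemma galerkin_approx_solution:
  assumes c: "cmod c = 1" and M: "1 \<le> M" and T: "0 \<le> T"
    and cont: "continuous_on {0..} u"
    and u: "\<And>t. 0 \<le> t \<Longrightarrow> u t = u 0 + integral {0..t} (\<lambda>s. cscale c (galerkin_field n (u s)))"
    and supp: "\<And>t k. 0 \<le> t \<Longrightarrow> k \<notin> {0..int n} \<Longrightarrow> fourier_coeff (u t) k = 0"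
    and bound: "\<And>t. 0 \<le> t \<Longrightarrow> wbound jap M (u t)" and contG: "continuous_on UNIV (galerkin_field n)"
  shows "approx_solution c T M (T * (K\<^sub>0 * M^3 * real (Suc n) powr (-1/12))) u"
  unfolding approx_solution_def
proof (intro conjI ballI)
  show "continuous_on {0..T} u"
    by (rule continuous_on_subset[OF cont]) auto
  show "wbound jap M (u t)" if "t \<in> {0..T}" for t
    using that by (intro bound) auto
  fix t assume t: "t \<in> {0..T}"
  let ?d = "K\<^sub>0 * M^3 * real (Suc n) powr (-1/12)"
  have contF: "continuous_on {0..t} (\<lambda>s. szego_field (u s))"
    using bound by (intro continuous_on_szego_field[OF M continuous_on_subset[OF cont]]) auto
  have contG': "continuous_on {0..t} (\<lambda>s. galerkin_field n (u s))"
    by (rule continuous_on_compose2[OF contG continuous_on_subset[OF cont]]) auto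
  have int: "(\<lambda>s. szego_field (u s)) integrable_on {0..t}" "(\<lambda>s. galerkin_field n (u s)) integrable_on {0..t}"
    using contF contG' by (auto intro: integrable_continuous_real)
  have "integral {0..t} (\<lambda>s. cscale c (galerkin_field n (u s))) = cscale c (integral {0..t} (\<lambda>s. galerkin_field n (u s)))"
    using integral_linear[OF int(2) bounded_linear_cscale] by (simp add: o_def)
  then have "u t - u 0 - cscale c (integral {0..t} (\<lambda>s. szego_field (u s)))
      = cscale c (integral {0..t} (\<lambda>s. galerkin_field n (u s) - szego_field (u s)))"
    using u[of t] t by (simp add: integral_diff[OF int(2,1)] cscale_diff_right)
  then have "norm (u t - u 0 - cscale c (integral {0..t} (\<lambda>s. szego_field (u s))))
      = norm (integral {0..t} (\<lambda>s. galerkin_field n (u s) - szego_field (u s)))"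
    by (simp add: c)
  also have "\<dots> \<le> integral {0..t} (\<lambda>s. ?d)"
    using int M by (intro integral_norm_bound_integral integrable_diff galerkin_defect bound supp) auto
  also have "\<dots> = t * ?d"
    using t by simp
  also have "\<dots> \<le> T * ?d"
    using t K0_pos M by (intro mult_right_mono) auto
  finally show "norm (u t - u 0 - cscale c (integral {0..t} (\<lambda>s. szego_field (u s)))) \<le> T * ?d" .
qed

lemma approx_solution_mono:
  "approx_solution c T M \<epsilon> u \<Longrightarrow> \<epsilon> \<le> \<epsilon>' \<Longrightarrow> approx_solution c T M \<epsilon>' u"
  unfolding approx_solution_def by (meson order_trans)

text \<open>The clause with \<open>jap\<close> preserves every bound \<open>M\<close>, in particular
  the best one: it says that the energy does not increase. The last clause is only local boundedness
  in \<open>H^s\<close>; continuity is derived from it afterwards.\<close>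

definition forward_solution :: "complex \<Rightarrow> l2_circle \<Rightarrow> (real \<Rightarrow> l2_circle) \<Rightarrow> bool" where
  "forward_solution c u\<^sub>0 u \<longleftrightarrow> u 0 = u\<^sub>0 \<and> continuous_on {0..} u \<and>
    (\<forall>t\<ge>0. \<forall>k<0. fourier_coeff (u t) k = 0) \<and>
    (\<forall>t\<ge>0. \<forall>M. wbound jap M u\<^sub>0 \<longrightarrow> wbound jap M (u t)) \<and>
    (\<forall>t\<ge>0. u t = u\<^sub>0 + cscale c (integral {0..t} (\<lambda>s. szego_field (u s)))) \<and>
    (\<forall>s>1/2. \<forall>B T. wbound (\<lambda>k. jap k powr (2 * s)) B u\<^sub>0 \<longrightarrow>
      (\<exists>B'. \<forall>t\<in>{0..T}. wbound (\<lambda>k. jap k powr (2 * s)) B' (u t)))"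

text \<open>Two Galerkin solutions are approximate solutions of the full equation with small defects
  and close initial values, so \<open>approx_solution_stability\<close> makes the sequence Cauchy in
  L2, uniformly on \<open>[0, T]\<close>. Uniform continuity of the field carries the equation to
  the limit, and \<open>wbound_tendsto\<close> the bounds.\<close>

lemma forward_solution_exists:
  assumes c: "c = \<i> \<or> c = - \<i>" and u0: "wbound jap M\<^sub>0 u\<^sub>0" and neg: "\<And>k. k < 0 \<Longrightarrow> fourier_coeff u\<^sub>0 k = 0"
  shows "\<exists>u. forward_solution c u\<^sub>0 u"
proof -
  have c1: "cmod c = 1" using c by auto
  define v where "v n = trig {0..int n} (fourier_coeff u\<^sub>0)" for n
  \<comment> \<open>Since \<open>u\<^sub>0\<close> has no negative frequencies, the one-sided cutoff
    is the symmetric partial sum, whose convergence is known.\<close>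
  have v_eq: "v n = trig {- int n..int n} (fourier_coeff u\<^sub>0)" for n
    unfolding v_def by (rule fourier_coeff_eqI) (use neg in auto)
  have v_lim: "v \<longlonglongrightarrow> u\<^sub>0"
    unfolding v_eq[abs_def] by (rule fourier_partial_sums_tendsto)
  have v_bound: "wbound w M (v n)" if "wbound w M u\<^sub>0" "\<And>k. 0 \<le> w k" for w M n
    unfolding v_def using that by (intro wbound_trig) auto
  define G where "G n u \<longleftrightarrow> continuous_on {0..} u \<and> u 0 = v n \<and>
      (\<forall>t\<ge>0. u t = v n + integral {0..t} (\<lambda>s. cscale c (galerkin_field n (u s)))) \<and>
      (\<forall>t\<ge>0. \<forall>k. k \<notin> {0..int n} \<longrightarrow> fourier_coeff (u t) k = 0) \<and>
      (\<forall>t\<ge>0. (\<Sum>k\<in>{0..int n}. jap k * (cmod (fourier_coeff (u t) k))\<^sup>2)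
        = (\<Sum>k\<in>{0..int n}. jap k * (cmod (fourier_coeff (v n) k))\<^sup>2)) \<and>
      continuous_on UNIV (galerkin_field n)" for n and u :: "real \<Rightarrow> l2_circle"
  have "\<exists>U. \<forall>n. G n (U n)"
  proof (rule choice, rule allI)
    fix n
    have "\<And>k. k \<notin> {0..int n} \<Longrightarrow> fourier_coeff (v n) k = 0" by (auto simp: v_def)
    from c this show "\<exists>u. G n u"
    proof (rule galerkin_solution)
      fix w :: "real \<Rightarrow> l2_circle"
      assume "continuous_on {0..} w" "w 0 = v n"
        "\<And>t. 0 \<le> t \<Longrightarrow> w t = v n + integral {0..t} (\<lambda>s. cscale c (galerkin_field n (w s)))"
        "\<And>t k. 0 \<le> t \<Longrightarrow> k \<notin> {0..int n} \<Longrightarrow> fourier_coeff (w t) k = 0"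
        "\<And>t. 0 \<le> t \<Longrightarrow> (\<Sum>k\<in>{0..int n}. jap k * (cmod (fourier_coeff (w t) k))\<^sup>2)
          = (\<Sum>k\<in>{0..int n}. jap k * (cmod (fourier_coeff (v n) k))\<^sup>2)"
        "continuous_on UNIV (galerkin_field n)"
      then show ?thesis
        unfolding G_def by (intro exI[of _ w] conjI allI impI) assumption+
    qed
  qed
  then obtain U where G: "\<And>n. G n (U n)"
    by blast
  have contU: "continuous_on {0..} (U n)" and U0: "U n 0 = v n" and contG: "continuous_on UNIV (galerkin_field n)" for n
    using G[of n] unfolding G_def by blast+
  have U: "U n t = v n + integral {0..t} (\<lambda>s. cscale c (galerkin_field n (U n s)))" if "0 \<le> t" for n t
    using G[of n] that unfolding G_def by blast
  have Usupp: "fourier_coeff (U n t) k = 0" if "0 \<le> t" "k \<notin> {0..int n}" for n t k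
    using G[of n] that unfolding G_def by blast
  have Uenergy: "(\<Sum>k\<in>{0..int n}. jap k * (cmod (fourier_coeff (U n t) k))\<^sup>2)
        = (\<Sum>k\<in>{0..int n}. jap k * (cmod (fourier_coeff (v n) k))\<^sup>2)" if "0 \<le> t" for n t
    using G[of n] that unfolding G_def by blast
  have U': "U n t = U n 0 + integral {0..t} (\<lambda>s. cscale c (galerkin_field n (U n s)))" if "0 \<le> t" for n t
    unfolding U0 by (rule U[OF that])
  have Ubound: "wbound jap M (U n t)" if "0 \<le> t" "wbound jap M u\<^sub>0" for M n t
    unfolding wbound_def
  proof (intro allI impI)
    fix F :: "int set" assume F: "finite F"
    have "(\<Sum>k\<in>F. jap k * (cmod (fourier_coeff (U n t) k))\<^sup>2)
        \<le> (\<Sum>k\<in>F \<union> {0..int n}. jap k * (cmod (fourier_coeff (U n t) k))\<^sup>2)"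
      using F by (intro sum_mono2) auto
    also have "\<dots> = (\<Sum>k\<in>{0..int n}. jap k * (cmod (fourier_coeff (U n t) k))\<^sup>2)"
      using F Usupp[OF that(1)] by (intro sum.mono_neutral_right) auto
    also have "\<dots> \<le> M\<^sup>2"
      unfolding Uenergy[OF that(1)] by (rule wboundD[OF v_bound[OF that(2)]]) auto
    finally show "(\<Sum>k\<in>F. jap k * (cmod (fourier_coeff (U n t) k))\<^sup>2) \<le> M\<^sup>2" .
  qed
  define M where "M = max 1 \<bar>M\<^sub>0\<bar>"
  have M: "1 \<le> M" by (simp add: M_def)
  have u0M: "wbound jap M u\<^sub>0"
    by (rule wbound_mono_bound[OF u0]) (simp add: M_def)
  define \<delta> where "\<delta> n = K\<^sub>0 * M^3 * real (Suc n) powr (-1/12)" for n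
  have \<delta>lim: "\<delta> \<longlonglongrightarrow> 0"
    unfolding \<delta>_def by real_asymp
  have \<delta>mono: "\<delta> n \<le> \<delta> N" if "N \<le> n" for n N
    unfolding \<delta>_def using that K0_pos M by (intro mult_left_mono powr_mono2') auto
  have approx: "approx_solution c T M (T * \<delta> n) (U n)" if "0 \<le> T" for T n
    unfolding \<delta>_def
    by (rule galerkin_approx_solution[OF c1 M that contU U' Usupp Ubound[OF _ u0M] contG])
  have cauchy: "\<exists>N. \<forall>m\<ge>N. \<forall>n\<ge>N. \<forall>t\<in>{0..T}. norm (U m t - U n t) \<le> \<eta>" if T: "0 \<le> T" and \<eta>: "0 < \<eta>" for T \<eta>
  proof -
    obtain r where r: "0 < r" "\<And>c \<epsilon> u v t. cmod c = 1 \<Longrightarrow> approx_solution c T M \<epsilon> u \<Longrightarrow> approx_solution c T M \<epsilon> v \<Longrightarrow>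
      norm (u 0 - v 0) + 2 * \<epsilon> \<le> r \<Longrightarrow> t \<in> {0..T} \<Longrightarrow> norm (u t - v t) \<le> \<eta>"
      using approx_solution_stability[OF M T \<eta>] by metis
    obtain N1 where N1: "\<And>m n. m \<ge> N1 \<Longrightarrow> n \<ge> N1 \<Longrightarrow> norm (v m - v n) < r / 2"
      using CauchyD[OF LIMSEQ_imp_Cauchy[OF v_lim], of "r / 2"] r(1) by auto
    have "(\<lambda>n. 2 * (T * \<delta> n)) \<longlonglongrightarrow> 2 * (T * 0)"
      by (intro tendsto_intros \<delta>lim)
    from order_tendstoD(2)[OF this, of "r / 2"]
    have "\<forall>\<^sub>F n in sequentially. 2 * (T * \<delta> n) < r / 2"
      using r(1) by simp
    then obtain N2 where N2: "2 * (T * \<delta> N2) < r / 2"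
      unfolding eventually_sequentially by blast
    \<comment> \<open>Stability is stated for two curves with the same defect; as
      \<open>\<delta>\<close> does not increase, the value at \<open>N2\<close> serves for
      both.\<close>
    have "norm (U m t - U n t) \<le> \<eta>" if mn: "m \<ge> max N1 N2" "n \<ge> max N1 N2" and t: "t \<in> {0..T}" for m n t
    proof (rule r(2)[OF c1 _ _ _ t])
      have le: "T * \<delta> m \<le> T * \<delta> N2" "T * \<delta> n \<le> T * \<delta> N2"
        using mn T by (auto intro!: mult_left_mono \<delta>mono)
      show "approx_solution c T M (T * \<delta> N2) (U m)" "approx_solution c T M (T * \<delta> N2) (U n)"
        by (rule approx_solution_mono[OF approx[OF T] le(1)], rule approx_solution_mono[OF approx[OF T] le(2)])
      show "norm (U m 0 - U n 0) + 2 * (T * \<delta> N2) \<le> r"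
        unfolding U0 using N1[of m n] N2 mn by simp
    qed
    then show ?thesis by (intro exI[of _ "max N1 N2"]) auto
  qed
  define u where "u t = lim (\<lambda>n. U n t)" for t
  have lim_u: "(\<lambda>n. U n t) \<longlonglongrightarrow> u t" if t: "0 \<le> t" for t
  proof -
    have "Cauchy (\<lambda>n. U n t)"
    proof (rule CauchyI)
      fix e :: real assume e: "0 < e"
      obtain N where N: "\<And>m n s. m \<ge> N \<Longrightarrow> n \<ge> N \<Longrightarrow> s \<in> {0..t} \<Longrightarrow> norm (U m s - U n s) \<le> e / 2"
        using cauchy[OF t, of "e/2"] e by (metis half_gt_zero)
      have "norm (U m t - U n t) < e" if "m \<ge> N" "n \<ge> N" for m n
        using N[OF that, of t] t e by simp
      then show "\<exists>N. \<forall>m\<ge>N. \<forall>n\<ge>N. norm (U m t - U n t) < e"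
        by (intro exI[of _ N]) auto
    qed
    then show ?thesis
      unfolding u_def by (simp add: Cauchy_convergent_iff convergent_LIMSEQ_iff)
  qed
  have unif: "uniform_limit {0..T} U u sequentially" if T: "0 \<le> T" for T
  proof (rule uniform_limitI)
    fix e :: real assume e: "0 < e"
    obtain N where N: "\<And>m n s. m \<ge> N \<Longrightarrow> n \<ge> N \<Longrightarrow> s \<in> {0..T} \<Longrightarrow> norm (U m s - U n s) \<le> e / 2"
      using cauchy[OF T, of "e/2"] e by (metis half_gt_zero)
    have "dist (U n t) (u t) < e" if n: "n \<ge> N" and t: "t \<in> {0..T}" for n t
    proof -
      have "norm (U n t - u t) \<le> e / 2"
      proof (rule LIMSEQ_le_const2)
        show "(\<lambda>m. norm (U n t - U m t)) \<longlonglongrightarrow> norm (U n t - u t)"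
          using t by (intro tendsto_intros lim_u) auto
        show "\<exists>N. \<forall>m\<ge>N. norm (U n t - U m t) \<le> e / 2"
          using N[OF n _ t] by (intro exI[of _ N]) auto
      qed
      then show ?thesis using e by (simp add: dist_norm)
    qed
    then show "\<forall>\<^sub>F n in sequentially. \<forall>t\<in>{0..T}. dist (U n t) (u t) < e"
      unfolding eventually_sequentially by (intro exI[of _ N]) auto
  qed
  have contu: "continuous_on {0..} u"
  proof (rule continuous_on_atLeast_0I)
    fix T :: real assume T: "0 \<le> T"
    show "continuous_on {0..T} u"
      by (rule uniform_limit_theorem[OF _ unif[OF T]])
        (auto intro!: always_eventually continuous_on_subset[OF contU])
  qed
  have ubound: "wbound jap M' (u t)" if "0 \<le> t" "wbound jap M' u\<^sub>0" for t M'
    by (rule wbound_tendsto[OF lim_u[OF that(1)] Ubound[OF that]])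
  have uu0: "u 0 = u\<^sub>0"
    using lim_u[of 0] v_lim unfolding U0 by (auto intro: LIMSEQ_unique)
  have uneg: "fourier_coeff (u t) k = 0" if "0 \<le> t" "k < 0" for t k
  proof -
    have "(\<lambda>n. fourier_coeff (U n t) k) \<longlonglongrightarrow> fourier_coeff (u t) k"
      by (rule tendsto_fourier_coeff[OF lim_u[OF that(1)]])
    moreover have "fourier_coeff (U n t) k = 0" for n
      using that by (intro Usupp) auto
    ultimately show ?thesis by (simp add: LIMSEQ_const_iff)
  qed
  have solves: "u t = u\<^sub>0 + cscale c (integral {0..t} (\<lambda>s. szego_field (u s)))" if t: "0 \<le> t" for t
  proof -
    have "uniform_limit {0..t} (\<lambda>n s. szego_field (U n s)) (\<lambda>s. szego_field (u s)) sequentially"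
    proof (rule uniform_limitI)
      fix e :: real assume e: "0 < e"
      obtain d where d: "0 < d" "\<And>u v. wbound jap M u \<Longrightarrow> wbound jap M v \<Longrightarrow> norm (u - v) \<le> d \<Longrightarrow>
          norm (szego_field u - szego_field v) < e"
        using szego_field_modulus[OF M e] by blast
      have "\<forall>\<^sub>F n in sequentially. \<forall>s\<in>{0..t}. dist (U n s) (u s) < d"
        by (rule uniform_limitD[OF unif[OF t] d(1)])
      then show "\<forall>\<^sub>F n in sequentially. \<forall>s\<in>{0..t}. dist (szego_field (U n s)) (szego_field (u s)) < e"
      proof eventually_elim
        case (elim n)
        then show ?case
          using Ubound[OF _ u0M] ubound[OF _ u0M] by (auto simp: dist_norm intro!: d(2) less_imp_le)
      qed
    qed
    moreover have "continuous_on {0..t} (\<lambda>s. szego_field (U n s))" for n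
      using Ubound[OF _ u0M] by (intro continuous_on_szego_field[OF M continuous_on_subset[OF contU]]) auto
    ultimately obtain I J where I: "\<And>n. ((\<lambda>s. szego_field (U n s)) has_integral I n) {0..t}"
      and J: "((\<lambda>s. szego_field (u s)) has_integral J) {0..t}" and IJ: "I \<longlonglongrightarrow> J"
      by (rule uniform_limit_integral) auto
    have "(\<lambda>n. norm (U n t - U n 0 - cscale c (I n))) \<longlonglongrightarrow> norm (u t - u\<^sub>0 - cscale c J)"
      using lim_u[OF t] lim_u[of 0] uu0 bounded_linear.tendsto[OF bounded_linear_cscale IJ]
      by (intro tendsto_intros) auto
    moreover have "norm (U n t - U n 0 - cscale c (I n)) \<le> t * \<delta> n" for n
    proof -
      have "norm (U n t - U n 0 - cscale c (integral {0..t} (\<lambda>s. szego_field (U n s)))) \<le> t * \<delta> n"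
        using approx[OF t, of n] t unfolding approx_solution_def by simp
      then show ?thesis by (simp only: integral_unique[OF I])
    qed
    moreover have "(\<lambda>n. t * \<delta> n) \<longlonglongrightarrow> t * 0"
      by (intro tendsto_intros \<delta>lim)
    ultimately have "norm (u t - u\<^sub>0 - cscale c J) \<le> t * 0"
      by (intro LIMSEQ_le) auto
    then show ?thesis
      by (simp add: integral_unique[OF J] algebra_simps)
  qed
  have sobolev: "\<exists>B'. \<forall>t\<in>{0..T}. wbound (\<lambda>k. jap k powr (2 * s)) B' (u t)"
    if s: "1/2 < s" and B: "wbound (\<lambda>k. jap k powr (2 * s)) B u\<^sub>0" for s B T
  proof -
    obtain B' where B': "\<And>n (u :: real \<Rightarrow> l2_circle) t. continuous_on {0..} u \<Longrightarrow>
      (\<And>t. 0 \<le> t \<Longrightarrow> u t = u 0 + integral {0..t} (\<lambda>s. cscale c (galerkin_field n (u s)))) \<Longrightarrow>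
      (\<And>t k. 0 \<le> t \<Longrightarrow> k \<notin> {0..int n} \<Longrightarrow> fourier_coeff (u t) k = 0) \<Longrightarrow>
      (\<And>t. 0 \<le> t \<Longrightarrow> wbound jap M (u t)) \<Longrightarrow> continuous_on UNIV (galerkin_field n) \<Longrightarrow>
      wbound (\<lambda>k. jap k powr (2 * s)) B (u 0) \<Longrightarrow> t \<in> {0..T} \<Longrightarrow> wbound (\<lambda>k. jap k powr (2 * s)) B' (u t)"
      using galerkin_sobolev_bound[OF s M c1] by metis
    have "wbound (\<lambda>k. jap k powr (2 * s)) B' (u t)" if t: "t \<in> {0..T}" for t
    proof (rule wbound_tendsto[OF lim_u])
      show "wbound (\<lambda>k. jap k powr (2 * s)) B' (U n t)" for n
        by (rule B'[OF contU U' Usupp Ubound[OF _ u0M] contG _ t]) (use B in \<open>auto simp: U0 intro: v_bound\<close>)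
    qed (use t in auto)
    then show ?thesis by blast
  qed
  show ?thesis
    unfolding forward_solution_def
    by (intro exI[of _ u] conjI allI impI uu0 contu uneg ubound solves sobolev)
qed

section \<open>Sobolev norms and the energy\<close>

text \<open>From \<open>1 + k^2 \<le> (1 + \<bar>k\<bar>)^2 \<le> 2 * (1 + k^2)\<close>: the weight
  of \<open>sobolev_term\<close> and the powers of \<open>jap\<close> give equivalent norms.\<close>

lemma jap_powr_bounds:
  assumes "0 \<le> s"
  shows "(1 + (real_of_int k)\<^sup>2) powr s \<le> jap k powr (2 * s)"
    "jap k powr (2 * s) \<le> 2 powr s * (1 + (real_of_int k)\<^sup>2) powr s"
proof -
  have sq: "jap k powr (2 * s) = ((jap k)\<^sup>2) powr s"
    by (simp add: powr_powr flip: powr_numeral)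
  have exp: "(jap k)\<^sup>2 = 1 + (real_of_int k)\<^sup>2 + 2 * \<bar>real_of_int k\<bar>"
    by (simp add: jap_def power2_sum)
  show "(1 + (real_of_int k)\<^sup>2) powr s \<le> jap k powr (2 * s)"
    unfolding sq using assms by (intro powr_mono2) (auto simp: exp add_nonneg_nonneg)
  have "0 \<le> (1 - \<bar>real_of_int k\<bar>)\<^sup>2" by simp
  then have "(jap k)\<^sup>2 \<le> 2 * (1 + (real_of_int k)\<^sup>2)"
    unfolding exp by (simp add: power2_diff)
  then have "((jap k)\<^sup>2) powr s \<le> (2 * (1 + (real_of_int k)\<^sup>2)) powr s"
    using assms by (intro powr_mono2) auto
  also have "\<dots> = 2 powr s * (1 + (real_of_int k)\<^sup>2) powr s"
    by (intro powr_mult)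
  finally show "jap k powr (2 * s) \<le> 2 powr s * (1 + (real_of_int k)\<^sup>2) powr s"
    by (simp only: sq)
qed

lemma jap_powr_half [simp]: "(\<lambda>k. jap k powr (2 * (1/2))) = jap"
  by (simp add: fun_eq_iff)

lemma wbound_summable:
  assumes "wbound w M u" "\<And>k. 0 \<le> w k"
  shows "(\<lambda>k. w k * (cmod (fourier_coeff u k))\<^sup>2) summable_on UNIV"
proof (rule nonneg_bdd_above_summable_on)
  show "bdd_above (sum (\<lambda>k. w k * (cmod (fourier_coeff u k))\<^sup>2) ` {F. F \<subseteq> UNIV \<and> finite F})"
    by (rule bdd_aboveI[of _ "M\<^sup>2"]) (auto intro: wboundD[OF assms(1)])
qed (simp add: assms(2))

lemma wbound_infsum_le:
  assumes "wbound w M u" "\<And>k. 0 \<le> w k"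
  shows "(\<Sum>\<^sub>\<infinity>k\<in>UNIV. w k * (cmod (fourier_coeff u k))\<^sup>2) \<le> M\<^sup>2"
  by (rule infsum_le_finite_sums[OF wbound_summable[OF assms]]) (rule wboundD[OF assms(1)])

lemma wbound_sobolev_term:
  assumes "0 \<le> s" "wbound (\<lambda>k. jap k powr (2 * s)) B u"
  shows "wbound (\<lambda>k. (1 + (real_of_int k)\<^sup>2) powr s) B u"
  by (rule wbound_mono[OF assms(2)]) (use jap_powr_bounds(1)[OF assms(1)] in auto)

lemma sobolev_norm_le:
  assumes "0 \<le> s" "wbound (\<lambda>k. jap k powr (2 * s)) B u" "0 \<le> B"
  shows "sobolev_norm s u \<le> B"
  using wbound_infsum_le[OF wbound_sobolev_term[OF assms(1,2)]] assms(3)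
  unfolding sobolev_norm_def sobolev_term_def
  by (intro real_le_lsqrt infsum_nonneg) auto

lemma wbound_sobolev_norm:
  assumes s: "0 \<le> s" and sum: "sobolev_term s u summable_on UNIV"
  shows "wbound (\<lambda>k. jap k powr (2 * s)) (2 powr (s / 2) * sobolev_norm s u) u"
  unfolding wbound_def
proof (intro allI impI)
  fix F :: "int set" assume F: "finite F"
  have "(\<Sum>k\<in>F. jap k powr (2 * s) * (cmod (fourier_coeff u k))\<^sup>2) \<le> (\<Sum>k\<in>F. 2 powr s * sobolev_term s u k)"
  proof (rule sum_mono)
    fix k
    show "jap k powr (2 * s) * (cmod (fourier_coeff u k))\<^sup>2 \<le> 2 powr s * sobolev_term s u k"
      unfolding sobolev_term_def mult.assoc[symmetric]
      by (intro mult_right_mono jap_powr_bounds(2) s) simp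
  qed
  also have "\<dots> = 2 powr s * (\<Sum>k\<in>F. sobolev_term s u k)"
    by (simp add: sum_distrib_left)
  also have "\<dots> \<le> 2 powr s * (\<Sum>\<^sub>\<infinity>k\<in>UNIV. sobolev_term s u k)"
    using sum F by (intro mult_left_mono finite_sum_le_infsum) (auto simp: sobolev_term_nonneg)
  also have "\<dots> = (2 powr (s / 2) * sobolev_norm s u)\<^sup>2"
    by (simp add: sobolev_norm_def power_mult_distrib powr_power infsum_nonneg sobolev_term_nonneg)
  finally show "(\<Sum>k\<in>F. jap k powr (2 * s) * (cmod (fourier_coeff u k))\<^sup>2) \<le> (2 powr (s / 2) * sobolev_norm s u)\<^sup>2" .
qed

lemma Hs_plus_set_iff:
  assumes "0 \<le> s"
  shows "u \<in> Hs_plus_set s \<longleftrightarrow> (\<exists>B. wbound (\<lambda>k. jap k powr (2 * s)) B u) \<and> (\<forall>k<0. fourier_coeff u k = 0)"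
  using wbound_sobolev_norm[OF assms] wbound_summable[OF wbound_sobolev_term[OF assms]]
  unfolding Hs_plus_set_def sobolev_term_def[abs_def] by auto

lemma sobolev_norm_nonneg: "0 \<le> sobolev_norm s u"
  by (simp add: sobolev_norm_def infsum_nonneg sobolev_term_nonneg)

lemma norm_le_sobolev_norm:
  assumes "0 \<le> s" "sobolev_term s u summable_on UNIV"
  shows "norm u \<le> 2 powr (s / 2) * sobolev_norm s u"
  by (rule wbound_imp_norm_le[OF wbound_sobolev_norm[OF assms]])
    (use assms jap_ge_1 in \<open>auto simp: sobolev_norm_nonneg intro!: ge_one_powr_ge_zero\<close>)

lemma Hs_plus_set_diff_summable:
  "u \<in> Hs_plus_set s \<Longrightarrow> v \<in> Hs_plus_set s \<Longrightarrow> sobolev_term s (u - v) summable_on UNIV"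
  unfolding Hs_plus_set_def by (auto intro: sobolev_term_diff_summable)

lemma sobolev_norm_triangle3:
  assumes "u \<in> Hs_plus_set s" "v \<in> Hs_plus_set s" "w \<in> Hs_plus_set s"
  shows "sobolev_norm s (u - w) \<le> sobolev_norm s (u - v) + sobolev_norm s (v - w)"
  using sobolev_norm_triangle[OF Hs_plus_set_diff_summable[OF assms(1,2)] Hs_plus_set_diff_summable[OF assms(2,3)]]
  by simp

lemma sobolev_norm_commute: "sobolev_norm s (u - v) = sobolev_norm s (v - u)"
  by (simp add: sobolev_norm_def sobolev_term_minus[of s u v])

lemma wbound_triangle:
  assumes u: "wbound w a u" and v: "wbound w b v" and ab: "0 \<le> a" "0 \<le> b" and w: "\<And>k. 0 \<le> w k"
  shows "wbound w (a + b) (u + v)"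
  unfolding wbound_def
proof (intro allI impI)
  fix F :: "int set" assume F: "finite F"
  have sq: "w k * (cmod z)\<^sup>2 = (sqrt (w k) * cmod z)\<^sup>2" for k z
    using w by (simp add: power_mult_distrib)
  have "L2_set (\<lambda>k. sqrt (w k) * cmod (fourier_coeff (u + v) k)) F
      \<le> L2_set (\<lambda>k. sqrt (w k) * cmod (fourier_coeff u k) + sqrt (w k) * cmod (fourier_coeff v k)) F"
    unfolding distrib_left[symmetric] fourier_coeff_add
    using w by (intro L2_set_mono mult_left_mono norm_triangle_ineq) auto
  also have "\<dots> \<le> L2_set (\<lambda>k. sqrt (w k) * cmod (fourier_coeff u k)) F + L2_set (\<lambda>k. sqrt (w k) * cmod (fourier_coeff v k)) F"
    by (rule L2_set_triangle_ineq)
  also have "\<dots> \<le> a + b"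
    using wboundD[OF u F] wboundD[OF v F] ab unfolding sq L2_set_def
    by (intro add_mono real_le_lsqrt) (auto intro: sum_nonneg)
  finally show "(\<Sum>k\<in>F. w k * (cmod (fourier_coeff (u + v) k))\<^sup>2) \<le> (a + b)\<^sup>2"
    unfolding sq L2_set_def by (rule sqrt_le_D)
qed

text \<open>Mass plus momentum on nonnegative frequencies. The \<open>infsum\<close> has the dummy
  value 0 for divergent sums, hence the \<open>wbound\<close> hypotheses below; under them
  \<open>sqrt (energy u)\<close> is the smallest nonnegative bound of \<open>u\<close>.\<close>

definition energy :: "l2_circle \<Rightarrow> real" where
  "energy u = (\<Sum>\<^sub>\<infinity>k\<in>UNIV. jap k * (cmod (fourier_coeff u k))\<^sup>2)"

lemma energy_nonneg: "0 \<le> energy u"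
  by (simp add: energy_def infsum_nonneg)

lemma energy_le: "wbound jap M u \<Longrightarrow> energy u \<le> M\<^sup>2"
  unfolding energy_def by (rule wbound_infsum_le) auto

lemma finite_sum_le_energy:
  assumes "wbound jap M u" "finite F"
  shows "(\<Sum>k\<in>F. jap k * (cmod (fourier_coeff u k))\<^sup>2) \<le> energy u"
  unfolding energy_def using assms
  by (intro finite_sum_le_infsum wbound_summable[OF assms(1)]) auto

lemma wbound_energy: "wbound jap M u \<Longrightarrow> wbound jap (sqrt (energy u)) u"
  unfolding wbound_def[of jap "sqrt (energy u)"]
  by (auto simp: energy_nonneg intro: finite_sum_le_energy)

lemma sqrt_energy_diff_le:
  assumes u: "wbound jap M u" and d: "wbound jap e (v - u)" "0 \<le> e"
  shows "\<bar>sqrt (energy v) - sqrt (energy u)\<bar> \<le> e"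
proof -
  have e: "sqrt (energy y) \<le> sqrt (energy x) + e"
    if x: "wbound jap N x" and xy: "wbound jap e (y - x)" for x y N
  proof -
    have "wbound jap (sqrt (energy x) + e) (x + (y - x))"
      by (rule wbound_triangle[OF wbound_energy[OF x] xy]) (auto simp: energy_nonneg d(2))
    then have "energy y \<le> (sqrt (energy x) + e)\<^sup>2"
      by (simp add: energy_le)
    then show ?thesis
      using d(2) energy_nonneg by (intro real_le_lsqrt) auto
  qed
  have v: "wbound jap (sqrt (energy u) + e) (u + (v - u))"
    by (rule wbound_triangle[OF wbound_energy[OF u] d(1)]) (auto simp: energy_nonneg d(2))
  have "wbound jap e (u - v)"
    using d(1) by (simp add: wbound_def fourier_coeff_diff norm_minus_commute)
  then have "sqrt (energy u) \<le> sqrt (energy v) + e"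
    using v e[of "sqrt (energy u) + e" v u] by simp
  moreover have "sqrt (energy v) \<le> sqrt (energy u) + e"
    by (rule e[OF u d(1)])
  ultimately show ?thesis by linarith
qed

text \<open>The energy of the high frequencies is the total energy minus that of finitely many modes.\<close>

lemma tendsto_sobolev_half:
  assumes lim: "(X \<longlongrightarrow> x) F" and E: "((\<lambda>i. energy (X i)) \<longlongrightarrow> energy x) F"
    and X: "\<And>i. wbound jap (N i) (X i)" and x: "wbound jap M x"
  shows "((\<lambda>i. sobolev_norm (1/2) (X i - x)) \<longlongrightarrow> 0) F"
proof (rule tendstoI)
  fix e :: real assume e: "0 < e"
  define \<epsilon> where "\<epsilon> = e\<^sup>2 / 8"
  have \<epsilon>: "0 < \<epsilon>" using e by (simp add: \<epsilon>_def)
  let ?g = "\<lambda>u k. jap k * (cmod (fourier_coeff u k))\<^sup>2"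
  have hs: "(?g x has_sum energy x) UNIV"
    unfolding energy_def by (intro has_sum_infsum wbound_summable[OF x]) auto
  obtain S where S: "finite S" and "dist (sum (?g x) S) (energy x) < \<epsilon>"
    using has_sum_finite_close[OF hs \<epsilon>] by auto
  then have tail: "energy x - sum (?g x) S < \<epsilon>"
    by (simp add: dist_real_def abs_less_iff)
  \<comment> \<open>\<open>h i\<close> bounds the squared weighted norm of \<open>X i - x\<close>:
    the modes in \<open>S\<close> exactly, the others through the two tails. The first part vanishes
    in the limit, and both tails tend to that of \<open>x\<close>, so the limit is below
    \<open>4 * \<epsilon> = e^2 / 2\<close>.\<close>
  define h where "h i = sum (?g (X i - x)) S + 2 * (energy (X i) - sum (?g (X i)) S) + 2 * (energy x - sum (?g x) S)" for i
  have "(h \<longlongrightarrow> sum (?g (x - x)) S + 2 * (energy x - sum (?g x) S) + 2 * (energy x - sum (?g x) S)) F"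
    unfolding h_def by (intro tendsto_intros tendsto_fourier_coeff lim E)
  moreover have "sum (?g (x - x)) S + 2 * (energy x - sum (?g x) S) + 2 * (energy x - sum (?g x) S) < e\<^sup>2 / 2"
    using tail by (simp add: \<epsilon>_def)
  ultimately have "\<forall>\<^sub>F i in F. h i < e\<^sup>2 / 2"
    by (rule order_tendstoD(2))
  then show "\<forall>\<^sub>F i in F. dist (sobolev_norm (1/2) (X i - x)) 0 < e"
  proof eventually_elim
    case (elim i)
    have split: "sum (?g u) (K - S) \<le> energy u - sum (?g u) S" if "wbound jap B u" "finite K" for u B K
    proof -
      have "sum (?g u) (K - S) + sum (?g u) S = sum (?g u) ((K - S) \<union> S)"
        using that S by (intro sum.union_disjoint[symmetric]) auto
      also have "\<dots> \<le> energy u"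
        using that S by (intro finite_sum_le_energy[OF that(1)]) auto
      finally show ?thesis by simp
    qed
    have le: "sum (?g (X i - x)) K \<le> h i" if K: "finite K" for K
    proof -
      have pw: "?g (X i - x) k \<le> 2 * ?g (X i) k + 2 * ?g x k" for k
      proof -
        have "(cmod (fourier_coeff (X i - x) k))\<^sup>2 \<le> (cmod (fourier_coeff (X i) k) + cmod (fourier_coeff x k))\<^sup>2"
          unfolding fourier_coeff_diff by (intro power_mono norm_triangle_ineq4) auto
        also have "\<dots> \<le> 2 * (cmod (fourier_coeff (X i) k))\<^sup>2 + 2 * (cmod (fourier_coeff x k))\<^sup>2"
          using sum_squares_bound[of "cmod (fourier_coeff (X i) k)" "cmod (fourier_coeff x k)"]
          by (simp add: power2_sum)
        finally have "jap k * (cmod (fourier_coeff (X i - x) k))\<^sup>2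
            \<le> jap k * (2 * (cmod (fourier_coeff (X i) k))\<^sup>2 + 2 * (cmod (fourier_coeff x k))\<^sup>2)"
          by (rule mult_left_mono) simp
        then show ?thesis by (simp add: algebra_simps)
      qed
      have "sum (?g (X i - x)) K \<le> sum (?g (X i - x)) (S \<union> (K - S))"
        using S K by (intro sum_mono2) auto
      also have "\<dots> = sum (?g (X i - x)) S + sum (?g (X i - x)) (K - S)"
        using S K by (intro sum.union_disjoint) auto
      also have "sum (?g (X i - x)) (K - S) \<le> (\<Sum>k\<in>K - S. 2 * ?g (X i) k + 2 * ?g x k)"
        by (rule sum_mono) (rule pw)
      also have "\<dots> = 2 * sum (?g (X i)) (K - S) + 2 * sum (?g x) (K - S)"
        by (simp add: sum.distrib sum_distrib_left)
      also have "\<dots> \<le> 2 * (energy (X i) - sum (?g (X i)) S) + 2 * (energy x - sum (?g x) S)"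
        by (intro add_mono mult_left_mono split[OF X K] split[OF x K]) auto
      finally show ?thesis by (simp add: h_def)
    qed
    have h0: "0 \<le> h i" using le[of "{}"] by simp
    have "wbound jap (sqrt (h i)) (X i - x)"
      unfolding wbound_def using le h0 by simp
    then have "wbound (\<lambda>k. jap k powr (2 * (1/2))) (sqrt (h i)) (X i - x)"
      by (simp only: jap_powr_half)
    then have "sobolev_norm (1/2) (X i - x) \<le> sqrt (h i)"
      by (rule sobolev_norm_le[rotated]) (use h0 in auto)
    also have "\<dots> < e"
    proof (rule real_less_lsqrt)
      have "h i < e\<^sup>2 / 2" by (rule elim)
      also have "\<dots> \<le> e\<^sup>2" by simp
      finally show "h i < e\<^sup>2" .
    qed (use e h0 in auto)
    finally show ?case
      by (simp add: dist_real_def sobolev_norm_nonneg)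
  qed
qed

section \<open>Reversibility and conservation of the energy\<close>

lemma approx_solutionI:
  assumes "continuous_on {0..T} u" "\<And>t. t \<in> {0..T} \<Longrightarrow> wbound jap M (u t)"
    "\<And>t. t \<in> {0..T} \<Longrightarrow> u t = u 0 + cscale c (integral {0..t} (\<lambda>s. szego_field (u s)))"
  shows "approx_solution c T M 0 u"
  unfolding approx_solution_def
proof (intro conjI ballI)
  fix t assume t: "t \<in> {0..T}"
  show "norm (u t - u 0 - cscale c (integral {0..t} (\<lambda>s. szego_field (u s)))) \<le> 0"
    by (subst assms(3)[OF t]) simp
qed (use assms(1,2) in auto)

text \<open>The reversed curve \<open>v\<close> solves the equation with \<open>- c\<close>. A
  forward solution \<open>w\<close> of that equation from \<open>u T\<close> keeps the bound
  \<open>N\<close>, and uniqueness, which allows different bounds \<open>M\<close> and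
  \<open>N\<close>, identifies \<open>v T = u 0\<close> with \<open>w T\<close>.\<close>

lemma wbound_reverse:
  fixes u :: "real \<Rightarrow> l2_circle"
  assumes c: "c = \<i> \<or> c = - \<i>" and T: "0 \<le> T" and M: "1 \<le> M"
    and cont: "continuous_on {0..T} u" and bound: "\<And>t. t \<in> {0..T} \<Longrightarrow> wbound jap M (u t)"
    and neg: "\<And>k. k < 0 \<Longrightarrow> fourier_coeff (u T) k = 0"
    and u: "\<And>t. t \<in> {0..T} \<Longrightarrow> u t = u 0 + cscale c (integral {0..t} (\<lambda>s. szego_field (u s)))"
    and uT: "wbound jap N (u T)"
  shows "wbound jap N (u 0)"
proof -
  define v where "v s = u (T - s)" for s
  have c': "- c = \<i> \<or> - c = - \<i>" "cmod (- c) = 1" using c by auto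
  have contF: "continuous_on {0..T} (\<lambda>s. szego_field (u s))"
    by (rule continuous_on_szego_field[OF M cont bound])
  have "approx_solution (- c) T M 0 v"
  proof (rule approx_solutionI)
    show "continuous_on {0..T} v"
      unfolding v_def by (rule continuous_on_compose2[OF cont]) (auto intro!: continuous_intros)
    show "wbound jap M (v t)" if "t \<in> {0..T}" for t
      unfolding v_def using that by (intro bound) auto
    fix t assume t: "t \<in> {0..T}"
    let ?f = "\<lambda>s. szego_field (u s)"
    have "integral {0..t} (\<lambda>s. szego_field (v s)) = integral {- t..0} (\<lambda>s. ?f (T + s))"
      using Henstock_Kurzweil_Integration.integral_reflect_real[of 0 "- t" "\<lambda>s. ?f (T + s)"] by (simp add: v_def)
    also have "\<dots> = integral {T - t..T} ?f"
      using integral_shift_Icc_real[of "- t" 0 ?f T] by (simp add: o_def)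
    finally have "integral {0..T - t} ?f + integral {0..t} (\<lambda>s. szego_field (v s)) = integral {0..T} ?f"
      using t contF by (simp add: Henstock_Kurzweil_Integration.integral_combine integrable_continuous_real)
    then have int: "integral {0..t} (\<lambda>s. szego_field (v s)) = integral {0..T} ?f - integral {0..T - t} ?f"
      by (simp add: algebra_simps)
    have "u (T - t) = u T - cscale c (integral {0..T} ?f - integral {0..T - t} ?f)"
      using u[of "T - t"] u[of T] t by (simp add: cscale_diff_right)
    then show "v t = v 0 + cscale (- c) (integral {0..t} (\<lambda>s. szego_field (v s)))"
      unfolding int cscale_minus by (simp add: v_def)
  qed
  note v = this
  obtain w where w: "forward_solution (- c) (u T) w"
    using forward_solution_exists[OF c'(1) uT neg] by blast
  then have w0: "w 0 = u T" and contw: "continuous_on {0..} w"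
    by (auto simp: forward_solution_def)
  have wbound: "wbound jap N (w t)" if "0 \<le> t" for t
    using w that uT unfolding forward_solution_def by blast
  have w_eq: "w t = w 0 + cscale (- c) (integral {0..t} (\<lambda>s. szego_field (w s)))" if "0 \<le> t" for t
    using w that unfolding forward_solution_def w0 by blast
  have w': "approx_solution (- c) T N 0 w"
    by (rule approx_solutionI[OF continuous_on_subset[OF contw] wbound w_eq]) auto
  have "v T = w T"
    by (rule approx_solution_unique[OF c'(2) v w']) (use T in \<open>auto simp: v_def w0\<close>)
  then show ?thesis
    using wbound[OF T] by (simp add: v_def)
qed

lemma forward_solutionD:
  assumes "forward_solution c u\<^sub>0 u"
  shows "u 0 = u\<^sub>0" "continuous_on {0..} u"
    "\<And>t k. 0 \<le> t \<Longrightarrow> k < 0 \<Longrightarrow> fourier_coeff (u t) k = 0"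
    "\<And>t M. 0 \<le> t \<Longrightarrow> wbound jap M u\<^sub>0 \<Longrightarrow> wbound jap M (u t)"
    "\<And>t. 0 \<le> t \<Longrightarrow> u t = u\<^sub>0 + cscale c (integral {0..t} (\<lambda>s. szego_field (u s)))"
    "\<And>s B T. 1/2 < s \<Longrightarrow> wbound (\<lambda>k. jap k powr (2 * s)) B u\<^sub>0 \<Longrightarrow>
      \<exists>B'. \<forall>t\<in>{0..T}. wbound (\<lambda>k. jap k powr (2 * s)) B' (u t)"
  using assms unfolding forward_solution_def by blast+

text \<open>One inequality is the preserved bound taken at its optimum for the initial value, the
  other is the same bound for the reversed evolution starting at \<open>u t\<close>.\<close>

lemma forward_solution_energy:
  assumes c: "c = \<i> \<or> c = - \<i>" and u: "forward_solution c u\<^sub>0 u" and u0: "wbound jap M u\<^sub>0" and t: "0 \<le> t"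
  shows "energy (u t) = energy u\<^sub>0"
proof (rule antisym)
  note D = forward_solutionD[OF u]
  have "wbound jap (sqrt (energy u\<^sub>0)) (u t)"
    by (rule D(4)[OF t wbound_energy[OF u0]])
  from energy_le[OF this] show "energy (u t) \<le> energy u\<^sub>0"
    by (simp add: energy_nonneg)
  define N where "N = max 1 \<bar>M\<bar>"
  have u0N: "wbound jap N u\<^sub>0"
    by (rule wbound_mono_bound[OF u0]) (simp add: N_def)
  have "wbound jap (sqrt (energy (u t))) (u 0)"
  proof (rule wbound_reverse[OF c t, of N])
    show "continuous_on {0..t} u" by (rule continuous_on_subset[OF D(2)]) auto
    show "wbound jap N (u s)" if "s \<in> {0..t}" for s
      using that by (intro D(4) u0N) auto
    show "u s = u 0 + cscale c (integral {0..s} (\<lambda>s. szego_field (u s)))" if "s \<in> {0..t}" for s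
      unfolding D(1) using that by (intro D(5)) auto
    show "wbound jap (sqrt (energy (u t))) (u t)"
      by (rule wbound_energy[OF D(4)[OF t u0]])
  qed (use D(3)[OF t] in \<open>auto simp: N_def\<close>)
  then show "energy u\<^sub>0 \<le> energy (u t)"
    unfolding D(1) by (rule order_trans[OF energy_le]) (simp add: energy_nonneg)
qed

lemma Hs_plus_set_subset:
  assumes "1/2 \<le> s"
  shows "Hs_plus_set s \<subseteq> Hs_plus_set (1/2)"
proof
  fix u assume "u \<in> Hs_plus_set s"
  then obtain B where B: "wbound (\<lambda>k. jap k powr (2 * s)) B u" and neg: "\<forall>k<0. fourier_coeff u k = 0"
    using assms by (auto simp: Hs_plus_set_iff)
  have "jap k powr (2 * (1/2)) \<le> jap k powr (2 * s)" for k
    using assms jap_ge_1 by (intro powr_mono) auto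
  then have "wbound (\<lambda>k. jap k powr (2 * (1/2))) B u"
    by (intro wbound_mono[OF B]) auto
  then show "u \<in> Hs_plus_set (1/2)"
    using neg by (subst Hs_plus_set_iff) auto
qed

lemma Hs_plus_half_wbound:
  assumes "u \<in> Hs_plus_set (1/2)"
  obtains M where "1 \<le> M" "wbound jap M u"
proof -
  obtain B where "wbound (\<lambda>k. jap k powr (2 * (1/2))) B u"
    using assms by (subst (asm) Hs_plus_set_iff) auto
  then have B: "wbound jap B u" by (simp only: jap_powr_half)
  show ?thesis
    by (rule that[of "max 1 \<bar>B\<bar>"]) (auto intro: wbound_mono_bound[OF B])
qed

text \<open>The \<open>H^s\<close> bound makes the l1 norm of the coefficients finite along the
  solution, so the tame estimate puts the field into a fixed ball of \<open>H^s\<close>. Its time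
  integral is taken in L2; the operators \<open>weighted s K\<close> for finite \<open>K\<close>
  transfer the bound \<open>L * (b - a)\<close> to \<open>H^s\<close>.\<close>

lemma forward_solution_sobolev:
  assumes c: "cmod c = 1" and u: "forward_solution c u\<^sub>0 u" and s: "1/2 < s" and u0: "u\<^sub>0 \<in> Hs_plus_set s"
  shows "\<And>t. 0 \<le> t \<Longrightarrow> u t \<in> Hs_plus_set s"
    and "\<exists>L\<ge>0. \<forall>a b. 0 \<le> a \<longrightarrow> a \<le> b \<longrightarrow> b \<le> T \<longrightarrow> sobolev_norm s (u b - u a) \<le> L * (b - a)"
proof -
  note D = forward_solutionD[OF u]
  have s0: "0 \<le> s" "1/2 \<le> s" using s by auto
  obtain B where B: "wbound (\<lambda>k. jap k powr (2 * s)) B u\<^sub>0"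
    using u0 s0(1) by (auto simp: Hs_plus_set_iff)
  show "u t \<in> Hs_plus_set s" if t: "0 \<le> t" for t
  proof -
    obtain B' where "\<forall>\<tau>\<in>{0..t}. wbound (\<lambda>k. jap k powr (2 * s)) B' (u \<tau>)"
      using D(6)[OF s B] by blast
    then have "wbound (\<lambda>k. jap k powr (2 * s)) B' (u t)" using t by auto
    then show ?thesis
      using D(3)[OF t] s0(1) by (auto simp: Hs_plus_set_iff)
  qed
  obtain M where M: "1 \<le> M" and u0M: "wbound jap M u\<^sub>0"
    using Hs_plus_half_wbound Hs_plus_set_subset[OF s0(2)] u0 by blast
  have uM: "wbound jap M (u t)" if "0 \<le> t" for t
    by (rule D(4)[OF that u0M])
  obtain W where W: "\<And>F. finite F \<Longrightarrow> (\<Sum>k\<in>F. jap k powr (- (s + 1/2))) \<le> W"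
    using sum_jap_powr_bounded[of "s + 1/2"] s by auto
  obtain B' where B'0: "\<forall>t\<in>{0..T}. wbound (\<lambda>k. jap k powr (2 * s)) B' (u t)"
    using D(6)[OF s B] by blast
  define R where "R = max 1 \<bar>B'\<bar>"
  have R: "1 \<le> R" by (simp add: R_def)
  have B': "wbound (\<lambda>k. jap k powr (2 * s)) R (u t)" if "t \<in> {0..T}" for t
    by (rule wbound_mono_bound[OF bspec[OF B'0 that]]) (simp add: R_def)
  define A where "A = sqrt (((8 + 8 / (s - 1/2)) * M\<^sup>2 + 2 * W) * (1 + ln R))"
  define L where "L = 3 * 3 powr s * A\<^sup>2 * R"
  have L: "0 \<le> L" using R by (simp add: L_def)
  have wiener: "(\<Sum>k\<in>S. cmod (fourier_coeff (u t) k)) \<le> A" if t: "t \<in> {0..T}" and S: "finite S" for t S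
    unfolding A_def
  proof (rule real_le_rsqrt, rule Brezis_Gallouet_wiener[OF S _ s W _ _ _ R])
    show "(\<Sum>k\<in>S. jap k * (cmod (fourier_coeff (u t) k))\<^sup>2) \<le> M\<^sup>2"
      using t by (intro wboundD[OF uM S]) auto
    have "(L2_set (\<lambda>k. jap k powr s * cmod (fourier_coeff (u t) k)) S)\<^sup>2 \<le> R\<^sup>2"
      unfolding norm_weighted[OF S, symmetric] norm_weighted_power2[OF S] by (rule wboundD[OF B'[OF t] S])
    then show "L2_set (\<lambda>k. jap k powr s * cmod (fourier_coeff (u t) k)) S \<le> R"
      by (rule power2_le_imp_le) (use R in simp)
  qed (use M in auto)
  have field: "wbound (\<lambda>k. jap k powr (2 * s)) L (szego_field (u t))" if t: "t \<in> {0..T}" for t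
  proof (rule wbound_mono)
    show "wbound (\<lambda>k. jap k powr (2 * s)) L (cubic (u t))"
      unfolding L_def using t R by (intro cubic_wbound_tame[OF s0(1) uM B' _ wiener]) auto
  qed (auto simp: szego_field_def)
  have "sobolev_norm s (u b - u a) \<le> L * (b - a)" if ab: "0 \<le> a" "a \<le> b" "b \<le> T" for a b
  proof (rule sobolev_norm_le[OF s0(1)])
    show "0 \<le> L * (b - a)" using L ab by simp
    have contF: "continuous_on {0..b} (\<lambda>t. szego_field (u t))"
      by (rule continuous_on_szego_field[OF M continuous_on_subset[OF D(2)] uM]) auto
    have intF: "(\<lambda>t. szego_field (u t)) integrable_on {0..b}" "(\<lambda>t. szego_field (u t)) integrable_on {a..b}"
      using ab by (auto intro!: integrable_continuous_real continuous_on_subset[OF contF])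
    have diff: "u b - u a = cscale c (integral {a..b} (\<lambda>t. szego_field (u t)))"
    proof -
      have "integral {0..a} (\<lambda>t. szego_field (u t)) + integral {a..b} (\<lambda>t. szego_field (u t)) = integral {0..b} (\<lambda>t. szego_field (u t))"
        using ab intF by (intro Henstock_Kurzweil_Integration.integral_combine) auto
      then have "integral {a..b} (\<lambda>t. szego_field (u t)) = integral {0..b} (\<lambda>t. szego_field (u t)) - integral {0..a} (\<lambda>t. szego_field (u t))"
        by (simp add: algebra_simps)
      then show ?thesis
        using D(5)[of a] D(5)[of b] ab by (simp add: cscale_diff_right)
    qed
    show "wbound (\<lambda>k. jap k powr (2 * s)) (L * (b - a)) (u b - u a)"
      unfolding wbound_def
    proof (intro allI impI)
      fix K :: "int set" assume K: "finite K"
      have wc: "weighted s K (cscale c v) = cscale c (weighted s K v)" for v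
        unfolding weighted_def by (rule fourier_coeff_eqI) (use K in simp)
      have "norm (weighted s K (u b - u a)) = norm (integral {a..b} (\<lambda>t. weighted s K (szego_field (u t))))"
        unfolding diff wc using integral_linear[OF intF(2) bounded_linear_weighted[of s K]]
        by (simp add: c o_def)
      also have "\<dots> \<le> integral {a..b} (\<lambda>t. L)"
      proof (rule integral_norm_bound_integral)
        show "(\<lambda>t. weighted s K (szego_field (u t))) integrable_on {a..b}"
          using integrable_linear[OF intF(2) bounded_linear_weighted[of s K]] by (simp add: o_def)
        fix t assume "t \<in> {a..b}"
        then have "t \<in> {0..T}" using ab by auto
        then have "(norm (weighted s K (szego_field (u t))))\<^sup>2 \<le> L\<^sup>2"
          unfolding norm_weighted_power2[OF K] by (intro wboundD[OF field] K)
        then show "norm (weighted s K (szego_field (u t))) \<le> L"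
          using L by (rule power2_le_imp_le)
      qed auto
      also have "\<dots> = L * (b - a)"
        using ab by simp
      finally have "(norm (weighted s K (u b - u a)))\<^sup>2 \<le> (L * (b - a))\<^sup>2"
        by (intro power_mono) auto
      then show "(\<Sum>k\<in>K. jap k powr (2 * s) * (cmod (fourier_coeff (u b - u a) k))\<^sup>2) \<le> (L * (b - a))\<^sup>2"
        unfolding norm_weighted_power2[OF K] .
    qed
  qed
  then show "\<exists>L\<ge>0. \<forall>a b. 0 \<le> a \<longrightarrow> a \<le> b \<longrightarrow> b \<le> T \<longrightarrow> sobolev_norm s (u b - u a) \<le> L * (b - a)"
    using L by blast
qed

section \<open>Global solutions and the flow\<close>

lemma continuous_map_mtopology_of:
  "continuous_map (mtopology_of m) (mtopology_of m') f \<longleftrightarrow>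
    f ` mspace m \<subseteq> mspace m' \<and>
    (\<forall>a\<in>mspace m. \<forall>e>0. \<exists>d>0. \<forall>x. x \<in> mspace m \<and> mdist m a x < d \<longrightarrow> mdist m' (f a) (f x) < e)"
  unfolding mtopology_of_def
  by (rule Metric_space.metric_continuous_map) auto

lemma continuous_map_Hs_plus:
  "continuous_map euclideanreal (mtopology_of (Hs_plus s)) u \<longleftrightarrow>
    (\<forall>t. u t \<in> Hs_plus_set s) \<and> (\<forall>t. ((\<lambda>x. sobolev_norm s (u x - u t)) \<longlongrightarrow> 0) (at t))"
proof -
  have eq: "((\<lambda>x. sobolev_norm s (u x - u t)) \<longlongrightarrow> 0) (at t) \<longleftrightarrow>
      (\<forall>e>0. \<exists>d>0. \<forall>x. dist t x < d \<longrightarrow> sobolev_norm s (u t - u x) < e)" for t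
  proof -
    have "sobolev_norm s 0 = 0"
      by (simp add: sobolev_norm_def sobolev_term_def)
    then show ?thesis
      unfolding LIM_def dist_real_def
      by (simp add: sobolev_norm_nonneg sobolev_norm_commute[of s "u t"] abs_minus_commute[of t])
        (metis abs_zero diff_self)
  qed
  have "continuous_map euclideanreal (mtopology_of (Hs_plus s)) u \<longleftrightarrow>
      continuous_map (mtopology_of euclidean_metric) (mtopology_of (Hs_plus s)) u"
    by (simp only: mtopology_of_euclidean)
  also have "\<dots> \<longleftrightarrow> (\<forall>t. u t \<in> Hs_plus_set s) \<and>
      (\<forall>t. \<forall>e>0. \<exists>d>0. \<forall>x. dist t x < d \<longrightarrow> sobolev_norm s (u t - u x) < e)"
    unfolding continuous_map_mtopology_of by auto
  finally show ?thesis by (simp only: eq)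
qed

lemma szego_solution_iff:
  "szego_solution u \<longleftrightarrow> continuous_map euclideanreal (mtopology_of (Hs_plus (1/2))) u \<and>
     (\<forall>a b. (\<lambda>t. szego_field (u t)) integrable_on {a..b}) \<and>
     (\<forall>t. u t = u 0 - cscale \<i> (integral_from_0 (\<lambda>t. szego_field (u t)) t))"
  by (simp add: szego_solution_def szego_field_def)

text \<open>\<open>szego_solution\<close> contains no bound, but a continuous curve in
  \<open>H^(1/2)\<close> is bounded on a compact time interval. Reflecting time turns negative times
  into an evolution with \<open>c = \<i>\<close>, so the results for nonnegative times apply to both
  halves.\<close>

lemma szego_solution_approx:
  assumes u: "szego_solution u"
  obtains M where "1 \<le> M" "approx_solution (- \<i>) T M 0 u" "approx_solution \<i> T M 0 (\<lambda>t. u (- t))"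
proof -
  have mem: "u t \<in> Hs_plus_set (1/2)" and lim: "((\<lambda>x. sobolev_norm (1/2) (u x - u t)) \<longlongrightarrow> 0) (at t)" for t
    using u unfolding szego_solution_iff continuous_map_Hs_plus by blast+
  have eq: "u t = u 0 - cscale \<i> (integral_from_0 (\<lambda>t. szego_field (u t)) t)" for t
    using u unfolding szego_solution_iff by blast
  have sum: "sobolev_term (1/2) (u t) summable_on UNIV" for t
    using mem[of t] by (simp add: Hs_plus_set_def)
  have diff: "sobolev_term (1/2) (u x - u t) summable_on UNIV" for x t
    by (rule Hs_plus_set_diff_summable[OF mem mem])
  have cont: "continuous_on A u" for A
  proof (intro continuous_at_imp_continuous_on ballI)
    fix t
    have "((\<lambda>x. 2 powr ((1/2) / 2) * sobolev_norm (1/2) (u x - u t)) \<longlongrightarrow> 2 powr ((1/2) / 2) * 0) (at t)"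
      by (intro tendsto_intros lim)
    then have "((\<lambda>x. 2 powr ((1/2) / 2) * sobolev_norm (1/2) (u x - u t)) \<longlongrightarrow> 0) (at t)"
      by (simp only: mult_zero_right)
    then have "((\<lambda>x. u x - u t) \<longlongrightarrow> 0) (at t)"
      by (rule Lim_null_comparison[rotated]) (intro always_eventually allI norm_le_sobolev_norm diff, simp)
    then show "isCont u t"
      unfolding isCont_def by (rule LIM_zero_cancel)
  qed
  have contN: "continuous_on {-T..T} (\<lambda>t. sobolev_norm (1/2) (u t))"
  proof (intro continuous_at_imp_continuous_on ballI)
    fix t
    have le: "\<bar>sobolev_norm (1/2) (u x) - sobolev_norm (1/2) (u t)\<bar> \<le> sobolev_norm (1/2) (u x - u t)" for x
      using sobolev_norm_triangle[OF diff[of x t] sum[of t]] sobolev_norm_triangle[OF diff[of t x] sum[of x]]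
        sobolev_norm_commute[of "1/2" "u t" "u x"] by simp
    have "((\<lambda>x. sobolev_norm (1/2) (u x) - sobolev_norm (1/2) (u t)) \<longlongrightarrow> 0) (at t)"
      by (rule Lim_null_comparison[OF always_eventually lim[of t]]) (use le in simp)
    then show "isCont (\<lambda>t. sobolev_norm (1/2) (u t)) t"
      unfolding isCont_def by (rule LIM_zero_cancel)
  qed
  have "bounded ((\<lambda>t. sobolev_norm (1/2) (u t)) ` {-T..T})"
    by (intro compact_imp_bounded compact_continuous_image contN) auto
  then obtain N where N: "\<And>t. t \<in> {-T..T} \<Longrightarrow> \<bar>sobolev_norm (1/2) (u t)\<bar> \<le> N"
    unfolding bounded_iff real_norm_def by (metis imageI)
  define M where "M = max 1 (2 powr ((1/2) / 2) * N)"
  have M: "1 \<le> M" by (simp add: M_def)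
  have bound: "wbound jap M (u t)" if t: "t \<in> {-T..T}" for t
  proof -
    have "wbound (\<lambda>k. jap k powr (2 * (1/2))) (2 powr ((1/2) / 2) * sobolev_norm (1/2) (u t)) (u t)"
      by (rule wbound_sobolev_norm[OF _ sum]) simp
    then have "wbound jap (2 powr ((1/2) / 2) * sobolev_norm (1/2) (u t)) (u t)"
      by (simp only: jap_powr_half)
    moreover have "\<bar>2 powr ((1/2) / 2) * sobolev_norm (1/2) (u t)\<bar> \<le> M"
      using mult_left_mono[OF N[OF t], of "2 powr ((1/2) / 2)"] by (simp add: M_def abs_mult max.coboundedI2)
    ultimately show ?thesis by (rule wbound_mono_bound)
  qed
  show ?thesis
  proof (rule that[OF M])
    show "approx_solution (- \<i>) T M 0 u"
    proof (rule approx_solutionI[OF cont])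
      show "wbound jap M (u t)" if "t \<in> {0..T}" for t
        using that by (intro bound) auto
      show "u t = u 0 + cscale (- \<i>) (integral {0..t} (\<lambda>s. szego_field (u s)))" if "t \<in> {0..T}" for t
        using that eq[of t] by (simp add: integral_from_0_def cscale_minus)
    qed
    show "approx_solution \<i> T M 0 (\<lambda>t. u (- t))"
    proof (rule approx_solutionI)
      show "continuous_on {0..T} (\<lambda>t. u (- t))"
        by (rule continuous_on_compose2[OF cont[of UNIV]]) (auto intro!: continuous_intros)
      show "wbound jap M (u (- t))" if "t \<in> {0..T}" for t
        using that by (intro bound) auto
      fix t assume t: "t \<in> {0..T}"
      have "integral {0..t} (\<lambda>s. szego_field (u (- s))) = integral {- t..0} (\<lambda>s. szego_field (u s))"
        using Henstock_Kurzweil_Integration.integral_reflect_real[of 0 "- t" "\<lambda>s. szego_field (u s)"] by simp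
      \<comment> \<open>For \<open>t = 0\<close> the first branch of \<open>integral_from_0\<close>
        applies, otherwise the second.\<close>
      then have "integral_from_0 (\<lambda>s. szego_field (u s)) (- t) = - integral {0..t} (\<lambda>s. szego_field (u (- s)))"
        using t by (cases "t = 0") (auto simp: integral_from_0_def)
      then show "u (- t) = u (- 0) + cscale \<i> (integral {0..t} (\<lambda>s. szego_field (u (- s))))"
        using eq[of "- t"] cscale_diff_right[of \<i> 0 "integral {0..t} (\<lambda>s. szego_field (u (- s)))"] by simp
    qed
  qed
qed

lemma szego_solution_unique:
  assumes u: "szego_solution u" and v: "szego_solution v" and eq: "u 0 = v 0"
  shows "u = v"
proof
  fix t :: real
  define T where "T = \<bar>t\<bar>"
  obtain M where "1 \<le> M" and M: "approx_solution (- \<i>) T M 0 u" "approx_solution \<i> T M 0 (\<lambda>t. u (- t))"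
    by (rule szego_solution_approx[OF u])
  obtain N where "1 \<le> N" and N: "approx_solution (- \<i>) T N 0 v" "approx_solution \<i> T N 0 (\<lambda>t. v (- t))"
    by (rule szego_solution_approx[OF v])
  show "u t = v t"
  proof (cases "0 \<le> t")
    case True
    show ?thesis
      by (rule approx_solution_unique[OF _ M(1) N(1) eq]) (use True in \<open>auto simp: T_def\<close>)
  next
    case False
    have "u (- (- t)) = v (- (- t))"
      by (rule approx_solution_unique[OF _ M(2) N(2)]) (use eq False in \<open>auto simp: T_def\<close>)
    then show ?thesis by simp
  qed
qed

text \<open>The solution is glued at 0 from the forward evolution \<open>p\<close> and the
  reflection of the reversed evolution \<open>q\<close>.\<close>

lemma szego_solution_exists:
  assumes u0: "u\<^sub>0 \<in> Hs_plus_set (1/2)"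
  shows "\<exists>u. szego_solution u \<and> u 0 = u\<^sub>0 \<and> (\<forall>t. energy (u t) = energy u\<^sub>0) \<and>
    (\<forall>s>1/2. u\<^sub>0 \<in> Hs_plus_set s \<longrightarrow> continuous_map euclideanreal (mtopology_of (Hs_plus s)) u)"
proof -
  obtain M where M: "1 \<le> M" and u0M: "wbound jap M u\<^sub>0"
    by (rule Hs_plus_half_wbound[OF u0])
  have neg: "\<And>k. k < 0 \<Longrightarrow> fourier_coeff u\<^sub>0 k = 0"
    using u0 by (simp add: Hs_plus_set_def)
  obtain p where p: "forward_solution (- \<i>) u\<^sub>0 p"
    using forward_solution_exists[OF _ u0M neg, of "- \<i>"] by auto
  obtain q where q: "forward_solution \<i> u\<^sub>0 q"
    using forward_solution_exists[OF _ u0M neg, of \<i>] by auto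
  note P = forward_solutionD[OF p] and Q = forward_solutionD[OF q]
  define u where "u t = (if 0 \<le> t then p t else q (- t))" for t
  have up: "u t = p t" if "0 \<le> t" for t using that by (simp add: u_def)
  have uq: "u t = q (- t)" if "t \<le> 0" for t using that P(1) Q(1) by (auto simp: u_def)
  have u_0: "u 0 = u\<^sub>0" using P(1) by (simp add: u_def)
  have uM: "wbound jap M (u t)" for t
    by (cases "0 \<le> t") (auto simp: u_def intro: P(4)[OF _ u0M] Q(4)[OF _ u0M])
  have uneg: "fourier_coeff (u t) k = 0" if "k < 0" for t k
    using that by (cases "0 \<le> t") (auto simp: u_def intro: P(3) Q(3))
  have energy: "energy (u t) = energy u\<^sub>0" for t
    using forward_solution_energy[OF _ p u0M] forward_solution_energy[OF _ q u0M] by (simp add: u_def)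
  have contp: "continuous_on {0..} u"
    using P(2) by (rule continuous_on_eq) (simp add: up)
  have contq: "continuous_on {..0} u"
  proof (rule continuous_on_eq)
    show "continuous_on {..0} (\<lambda>t. q (- t))"
      by (rule continuous_on_compose2[OF Q(2)]) (auto intro!: continuous_intros)
  qed (simp add: uq)
  have "continuous_on ({..0} \<union> {0..}) u"
    by (rule continuous_on_closed_Un[OF _ _ contq contp]) auto
  moreover have "{..0} \<union> {0..} = (UNIV :: real set)" by auto
  ultimately have cont: "continuous_on UNIV u" by simp
  have mem: "u t \<in> Hs_plus_set (1/2)" for t
  proof -
    have "wbound (\<lambda>k. jap k powr (2 * (1/2))) M (u t)"
      using uM by (simp only: jap_powr_half)
    then show ?thesis
      using uneg by (subst Hs_plus_set_iff) auto
  qed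
  have "continuous_map euclideanreal (mtopology_of (Hs_plus (1/2))) u"
    unfolding continuous_map_Hs_plus
  proof (intro conjI allI mem)
    fix t
    have "isCont u t"
      using cont by (simp add: continuous_on_eq_continuous_at)
    \<comment> \<open>The energy is constant in time, so continuity in L2 is enough for
      \<open>tendsto_sobolev_half\<close>.\<close>
    then show "((\<lambda>x. sobolev_norm (1/2) (u x - u t)) \<longlongrightarrow> 0) (at t)"
      by (intro tendsto_sobolev_half[OF _ _ uM uM]) (auto simp: isCont_def energy)
  qed
  moreover have contF: "continuous_on UNIV (\<lambda>t. szego_field (u t))"
    by (rule continuous_on_szego_field[OF M cont uM])
  then have "(\<lambda>t. szego_field (u t)) integrable_on {a..b}" for a b
    by (intro integrable_continuous_real) (auto intro: continuous_on_subset)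
  moreover have "u t = u 0 - cscale \<i> (integral_from_0 (\<lambda>t. szego_field (u t)) t)" for t
  proof (cases "0 \<le> t")
    case True
    have "integral {0..t} (\<lambda>s. szego_field (u s)) = integral {0..t} (\<lambda>s. szego_field (p s))"
      by (rule integral_cong) (simp add: up)
    then show ?thesis
      using True P(5)[OF True] by (simp add: up u_0 integral_from_0_def cscale_minus)
  next
    case False
    have "integral {t..0} (\<lambda>s. szego_field (u s)) = integral {t..0} (\<lambda>s. szego_field (q (- s)))"
      by (rule integral_cong) (simp add: uq)
    also have "\<dots> = integral {0..- t} (\<lambda>s. szego_field (q s))"
      using Henstock_Kurzweil_Integration.integral_reflect_real[of "- t" 0 "\<lambda>s. szego_field (q s)"] by simp
    finally show ?thesis
      using False Q(5)[of "- t"] cscale_diff_right[of \<i> 0 "integral {0..- t} (\<lambda>s. szego_field (q s))"]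
      by (simp add: uq u_0 integral_from_0_def)
  qed
  ultimately have sol: "szego_solution u"
    unfolding szego_solution_iff by blast
  have persist: "continuous_map euclideanreal (mtopology_of (Hs_plus s)) u" if s: "1/2 < s" and u0s: "u\<^sub>0 \<in> Hs_plus_set s" for s
    unfolding continuous_map_Hs_plus
  proof (intro conjI allI)
    have ps: "\<And>t. 0 \<le> t \<Longrightarrow> p t \<in> Hs_plus_set s" and qs: "\<And>t. 0 \<le> t \<Longrightarrow> q t \<in> Hs_plus_set s"
      by (rule forward_solution_sobolev(1)[OF _ p s u0s]; simp) (rule forward_solution_sobolev(1)[OF _ q s u0s]; simp)
    show mems: "u t \<in> Hs_plus_set s" for t
      using ps qs by (simp add: u_def)
    fix t :: real
    \<comment> \<open>The extra 1 leaves a neighbourhood of \<open>t\<close> inside the interval on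
      which the Lipschitz constants hold.\<close>
    define T where "T = \<bar>t\<bar> + 1"
    obtain L1 where L1: "0 \<le> L1" "\<And>a b. 0 \<le> a \<Longrightarrow> a \<le> b \<Longrightarrow> b \<le> T \<Longrightarrow> sobolev_norm s (p b - p a) \<le> L1 * (b - a)"
      using forward_solution_sobolev(2)[OF _ p s u0s, of T] by auto
    obtain L2 where L2: "0 \<le> L2" "\<And>a b. 0 \<le> a \<Longrightarrow> a \<le> b \<Longrightarrow> b \<le> T \<Longrightarrow> sobolev_norm s (q b - q a) \<le> L2 * (b - a)"
      using forward_solution_sobolev(2)[OF _ q s u0s, of T] by auto
    define L where "L = L1 + L2"
    have L: "L1 * x \<le> L * x" "L2 * x \<le> L * x" if "0 \<le> x" for x
      using L1(1) L2(1) that by (auto simp: L_def algebra_simps)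
    have Lp: "sobolev_norm s (u b - u a) \<le> L * (b - a)" if "0 \<le> a" "a \<le> b" "b \<le> T" for a b
      using L1(2)[OF that] L(1)[of "b - a"] that by (simp add: up)
    have Lq: "sobolev_norm s (u b - u a) \<le> L * (b - a)" if "- T \<le> a" "a \<le> b" "b \<le> 0" for a b
      using L2(2)[of "- b" "- a"] L(2)[of "b - a"] that sobolev_norm_commute[of s "u b" "u a"] by (simp add: uq)
    \<comment> \<open>The bounds for \<open>p\<close> and \<open>q\<close> concern one side of 0
      each; an interval containing 0 in its interior is cut there.\<close>
    have Lip: "sobolev_norm s (u b - u a) \<le> L * (b - a)" if ab: "- T \<le> a" "a \<le> b" "b \<le> T" for a b
    proof (cases "0 \<le> a \<or> b \<le> 0")
      case True
      then show ?thesis using Lp Lq ab by auto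
    next
      case False
      then have "sobolev_norm s (u b - u a) \<le> L * (b - 0) + L * (0 - a)"
        using ab by (intro order_trans[OF sobolev_norm_triangle3[OF mems mems[of 0] mems]] add_mono Lp Lq) auto
      then show ?thesis by (simp add: algebra_simps)
    qed
    have "\<forall>\<^sub>F x in at t. norm (sobolev_norm s (u x - u t)) \<le> L * \<bar>x - t\<bar>"
    proof -
      have "\<forall>\<^sub>F x in at t. dist x t < 1"
        by (rule tendstoD[OF tendsto_ident_at]) simp
      then show ?thesis
      proof eventually_elim
        case (elim x)
        then have x: "- T \<le> x" "x \<le> T" "- T \<le> t" "t \<le> T"
          by (auto simp: T_def dist_real_def)
        show ?case
          using Lip[of x t] Lip[of t x] x sobolev_norm_commute[of s "u x" "u t"] sobolev_norm_nonneg[of s "u x - u t"]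
          by (cases "x \<le> t") auto
      qed
    qed
    moreover have "((\<lambda>x. L * \<bar>x - t\<bar>) \<longlongrightarrow> L * \<bar>t - t\<bar>) (at t)"
      by (intro tendsto_intros)
    then have "((\<lambda>x. L * \<bar>x - t\<bar>) \<longlongrightarrow> 0) (at t)" by simp
    ultimately show "((\<lambda>x. sobolev_norm s (u x - u t)) \<longlongrightarrow> 0) (at t)"
      by (rule Lim_null_comparison)
  qed
  show ?thesis
    by (intro exI[of _ u] conjI allI impI sol u_0 energy persist)
qed

section \<open>The flow map and its continuity in the initial value\<close>

lemma szego_flow_spec:
  assumes u0: "u\<^sub>0 \<in> Hs_plus_set (1/2)"
  shows "szego_solution (szego_flow u\<^sub>0)" "szego_flow u\<^sub>0 0 = u\<^sub>0"
    "energy (szego_flow u\<^sub>0 t) = energy u\<^sub>0"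
    "1/2 < s \<Longrightarrow> u\<^sub>0 \<in> Hs_plus_set s \<Longrightarrow>
      continuous_map euclideanreal (mtopology_of (Hs_plus s)) (szego_flow u\<^sub>0)"
proof -
  obtain u where u: "szego_solution u" "u 0 = u\<^sub>0" and e: "\<forall>t. energy (u t) = energy u\<^sub>0"
    and s: "\<forall>s>1/2. u\<^sub>0 \<in> Hs_plus_set s \<longrightarrow> continuous_map euclideanreal (mtopology_of (Hs_plus s)) u"
    using szego_solution_exists[OF u0] by blast
  have flow: "szego_flow u\<^sub>0 = u"
    unfolding szego_flow_def
    by (rule the_equality) (use u szego_solution_unique in auto)
  show "szego_solution (szego_flow u\<^sub>0)" "szego_flow u\<^sub>0 0 = u\<^sub>0"
    "energy (szego_flow u\<^sub>0 t) = energy u\<^sub>0"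
    unfolding flow using u e by auto
  show "1/2 < s \<Longrightarrow> u\<^sub>0 \<in> Hs_plus_set s \<Longrightarrow>
      continuous_map euclideanreal (mtopology_of (Hs_plus s)) (szego_flow u\<^sub>0)"
    unfolding flow using s by blast
qed

lemma szego_flow_Hs_plus:
  assumes "u\<^sub>0 \<in> Hs_plus_set (1/2)"
  shows "szego_flow u\<^sub>0 t \<in> Hs_plus_set (1/2)"
    and "((\<lambda>x. sobolev_norm (1/2) (szego_flow u\<^sub>0 x - szego_flow u\<^sub>0 t)) \<longlongrightarrow> 0) (at t)"
  using szego_flow_spec(1)[OF assms] unfolding szego_solution_iff continuous_map_Hs_plus by blast+

lemma norm_le_sobolev_half:
  assumes "u \<in> Hs_plus_set (1/2)" "v \<in> Hs_plus_set (1/2)"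
  shows "norm (u - v) \<le> 2 * sobolev_norm (1/2) (u - v)"
    and "wbound jap (2 * sobolev_norm (1/2) (u - v)) (u - v)"
proof -
  have sum: "sobolev_term (1/2) (u - v) summable_on UNIV"
    by (rule Hs_plus_set_diff_summable[OF assms])
  have "2 powr ((1/2) / 2) \<le> (2::real) powr 1"
    by (intro powr_mono) auto
  then have le: "2 powr ((1/2) / 2) * sobolev_norm (1/2) (u - v) \<le> 2 * sobolev_norm (1/2) (u - v)"
    by (intro mult_right_mono) (auto simp: sobolev_norm_nonneg)
  show "norm (u - v) \<le> 2 * sobolev_norm (1/2) (u - v)"
    by (rule order_trans[OF norm_le_sobolev_norm[OF _ sum] le]) simp
  have "wbound (\<lambda>k. jap k powr (2 * (1/2))) (2 powr ((1/2) / 2) * sobolev_norm (1/2) (u - v)) (u - v)"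
    by (rule wbound_sobolev_norm[OF _ sum]) simp
  then have "wbound jap (2 powr ((1/2) / 2) * sobolev_norm (1/2) (u - v)) (u - v)"
    by (simp only: jap_powr_half)
  then show "wbound jap (2 * sobolev_norm (1/2) (u - v)) (u - v)"
    by (rule wbound_mono_bound) (use le in \<open>simp add: abs_mult sobolev_norm_nonneg\<close>)
qed

text \<open>Conservation of the energy returns the bound of the initial value at every time,
  forwards and backwards.\<close>

lemma wbound_szego_flow:
  assumes u0: "u\<^sub>0 \<in> Hs_plus_set (1/2)" and M: "wbound jap M u\<^sub>0"
  shows "wbound jap M (szego_flow u\<^sub>0 t)"
proof -
  obtain N where "wbound jap N (szego_flow u\<^sub>0 t)"
    using Hs_plus_half_wbound[OF szego_flow_Hs_plus(1)[OF u0]] by blast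
  then have "wbound jap (sqrt (energy u\<^sub>0)) (szego_flow u\<^sub>0 t)"
    using wbound_energy szego_flow_spec(3)[OF u0] by metis
  moreover have "\<bar>sqrt (energy u\<^sub>0)\<bar> \<le> \<bar>M\<bar>"
    using energy_le[OF M] by (simp add: energy_nonneg real_le_lsqrt)
  ultimately have "wbound jap \<bar>M\<bar> (szego_flow u\<^sub>0 t)"
    by (rule wbound_mono_bound)
  then show ?thesis by (simp add: wbound_def)
qed

text \<open>The bound supplied by \<open>szego_solution_approx\<close> depends on the solution;
  \<open>wbound_szego_flow\<close> replaces it by the common \<open>M\<close>, so that one
  \<open>r\<close> serves all initial values with that bound.\<close>

lemma szego_flow_L2_stable:
  assumes T: "0 \<le> T" and M: "1 \<le> M" and \<eta>: "0 < \<eta>"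
  obtains r where "0 < r" "\<And>u\<^sub>0 v\<^sub>0 t. u\<^sub>0 \<in> Hs_plus_set (1/2) \<Longrightarrow> v\<^sub>0 \<in> Hs_plus_set (1/2) \<Longrightarrow>
    wbound jap M u\<^sub>0 \<Longrightarrow> wbound jap M v\<^sub>0 \<Longrightarrow> norm (u\<^sub>0 - v\<^sub>0) \<le> r \<Longrightarrow> t \<in> {-T..T} \<Longrightarrow>
    norm (szego_flow u\<^sub>0 t - szego_flow v\<^sub>0 t) \<le> \<eta>"
proof -
  obtain r where r: "0 < r" "\<And>c \<epsilon> u v t. cmod c = 1 \<Longrightarrow> approx_solution c T M \<epsilon> u \<Longrightarrow> approx_solution c T M \<epsilon> v \<Longrightarrow>
      norm (u 0 - v 0) + 2 * \<epsilon> \<le> r \<Longrightarrow> t \<in> {0..T} \<Longrightarrow> norm (u t - v t) \<le> \<eta>"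
    using approx_solution_stability[OF M T \<eta>] by metis
  show ?thesis
  proof (rule that[OF r(1)])
    fix u\<^sub>0 v\<^sub>0 and t :: real
    assume u0: "u\<^sub>0 \<in> Hs_plus_set (1/2)" and v0: "v\<^sub>0 \<in> Hs_plus_set (1/2)"
      and uM: "wbound jap M u\<^sub>0" and vM: "wbound jap M v\<^sub>0" and le: "norm (u\<^sub>0 - v\<^sub>0) \<le> r" and t: "t \<in> {-T..T}"
    have approx: "approx_solution (- \<i>) T M 0 (szego_flow w)" "approx_solution \<i> T M 0 (\<lambda>t. szego_flow w (- t))"
      if w: "w \<in> Hs_plus_set (1/2)" "wbound jap M w" for w
    proof -
      obtain N where "1 \<le> N" "approx_solution (- \<i>) T N 0 (szego_flow w)" "approx_solution \<i> T N 0 (\<lambda>t. szego_flow w (- t))"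
        by (rule szego_solution_approx[OF szego_flow_spec(1)[OF w(1)]])
      then show "approx_solution (- \<i>) T M 0 (szego_flow w)" "approx_solution \<i> T M 0 (\<lambda>t. szego_flow w (- t))"
        using wbound_szego_flow[OF w] by (auto simp: approx_solution_def)
    qed
    show "norm (szego_flow u\<^sub>0 t - szego_flow v\<^sub>0 t) \<le> \<eta>"
    proof (cases "0 \<le> t")
      case True
      show ?thesis
        by (rule r(2)[OF _ approx(1)[OF u0 uM] approx(1)[OF v0 vM]])
          (use True t le in \<open>auto simp: szego_flow_spec(2)[OF u0] szego_flow_spec(2)[OF v0]\<close>)
    next
      case False
      have "norm (szego_flow u\<^sub>0 (- (- t)) - szego_flow v\<^sub>0 (- (- t))) \<le> \<eta>"
        by (rule r(2)[OF _ approx(2)[OF u0 uM] approx(2)[OF v0 vM]])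
          (use False t le in \<open>auto simp: szego_flow_spec(2)[OF u0] szego_flow_spec(2)[OF v0]\<close>)
      then show ?thesis by simp
    qed
  qed
qed

text \<open>By compactness of the time interval it is enough to compare the flows along convergent
  sequences of times, where conservation of the energy turns L2 convergence into \<open>H\<^sup>1\<^sup>/\<^sup>2\<close> convergence.\<close>

lemma szego_flow_continuous:
  assumes u0: "u\<^sub>0 \<in> Hs_plus_set (1/2)" and e: "0 < e"
  shows "\<exists>d>0. \<forall>v\<^sub>0 \<in> Hs_plus_set (1/2). sobolev_norm (1/2) (v\<^sub>0 - u\<^sub>0) < d \<longrightarrow>
    (\<forall>t\<in>{-T..T}. sobolev_norm (1/2) (szego_flow v\<^sub>0 t - szego_flow u\<^sub>0 t) < e)"
proof (rule ccontr)
  assume neg: "\<not> ?thesis"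
  have "\<exists>v t. v \<in> Hs_plus_set (1/2) \<and> sobolev_norm (1/2) (v - u\<^sub>0) < 1 / real (Suc n) \<and> t \<in> {-T..T} \<and>
      e \<le> sobolev_norm (1/2) (szego_flow v t - szego_flow u\<^sub>0 t)" for n
    using neg by (force simp: not_less)
  then obtain v t where v: "\<And>n. v n \<in> Hs_plus_set (1/2)"
    and close: "\<And>n. sobolev_norm (1/2) (v n - u\<^sub>0) < 1 / real (Suc n)" and t: "\<And>n. t n \<in> {-T..T}"
    and far: "\<And>n. e \<le> sobolev_norm (1/2) (szego_flow (v n) (t n) - szego_flow u\<^sub>0 (t n))"
    by metis
  obtain \<tau> \<rho> where \<tau>: "\<tau> \<in> {-T..T}" and \<rho>: "strict_mono \<rho>" and lim: "(t \<circ> \<rho>) \<longlonglongrightarrow> \<tau>"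
    using compact_Icc[of "- T" T, unfolded compact_def] t by meson
  have T: "0 \<le> T" using \<tau> by auto
  obtain M where M: "1 \<le> M" "wbound jap M u\<^sub>0"
    by (rule Hs_plus_half_wbound[OF u0])
  have close0: "(\<lambda>n. 2 * sobolev_norm (1/2) (v n - u\<^sub>0)) \<longlonglongrightarrow> 0"
  proof (rule Lim_null_comparison)
    show "\<forall>\<^sub>F n in sequentially. norm (2 * sobolev_norm (1/2) (v n - u\<^sub>0)) \<le> 2 * (1 / real (Suc n))"
    proof (rule always_eventually, rule allI)
      fix n
      show "norm (2 * sobolev_norm (1/2) (v n - u\<^sub>0)) \<le> 2 * (1 / real (Suc n))"
        using close[of n] sobolev_norm_nonneg[of "1/2" "v n - u\<^sub>0"] by simp
    qed
    show "(\<lambda>n. 2 * (1 / real (Suc n))) \<longlonglongrightarrow> 0" by real_asymp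
  qed
  \<comment> \<open>The \<open>v n\<close> stay within \<open>H^(1/2)\<close> distance 1 of
    \<open>u\<^sub>0\<close>, which is at most 2 in the weight \<open>jap\<close>. A common bound is
    what makes the L2 stability uniform in \<open>n\<close>.\<close>
  have vM: "wbound jap (M + 2) (v n)" for n
  proof -
    have "1 / real (Suc n) \<le> 1" by simp
    then have "2 * sobolev_norm (1/2) (v n - u\<^sub>0) \<le> 2" using close[of n] by linarith
    then have "wbound jap 2 (v n - u\<^sub>0)"
      by (intro wbound_mono_bound[OF norm_le_sobolev_half(2)[OF v u0]]) (simp add: sobolev_norm_nonneg)
    from wbound_triangle[OF M(2) this] M(1) show ?thesis by simp
  qed
  have uM2: "wbound jap (M + 2) u\<^sub>0"
    by (rule wbound_mono_bound[OF M(2)]) (use M(1) in simp)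
  have M2: "1 \<le> M + 2" using M(1) by simp
  have energy_lim: "(\<lambda>n. energy (v n)) \<longlonglongrightarrow> energy u\<^sub>0"
  proof -
    have "(\<lambda>n. sqrt (energy (v n)) - sqrt (energy u\<^sub>0)) \<longlonglongrightarrow> 0"
    proof (rule Lim_null_comparison[OF always_eventually close0], rule allI)
      fix n
      show "norm (sqrt (energy (v n)) - sqrt (energy u\<^sub>0)) \<le> 2 * sobolev_norm (1/2) (v n - u\<^sub>0)"
        using sqrt_energy_diff_le[OF M(2) norm_le_sobolev_half(2)[OF v u0]] by (simp add: sobolev_norm_nonneg)
    qed
    then have "(\<lambda>n. sqrt (energy (v n))) \<longlonglongrightarrow> sqrt (energy u\<^sub>0)"
      by (rule LIM_zero_cancel)
    then have "(\<lambda>n. (sqrt (energy (v n)))\<^sup>2) \<longlonglongrightarrow> (sqrt (energy u\<^sub>0))\<^sup>2"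
      by (rule tendsto_power)
    then show ?thesis by (simp add: energy_nonneg)
  qed
  have flow_lim: "(\<lambda>n. sobolev_norm (1/2) (szego_flow u\<^sub>0 (t (\<rho> n)) - szego_flow u\<^sub>0 \<tau>)) \<longlonglongrightarrow> 0"
  proof -
    have "isCont (\<lambda>x. sobolev_norm (1/2) (szego_flow u\<^sub>0 x - szego_flow u\<^sub>0 \<tau>)) \<tau>"
      using szego_flow_Hs_plus(2)[OF u0, of \<tau>] by (simp add: isCont_def sobolev_norm_def sobolev_term_def)
    from isCont_tendsto_compose[OF this lim] show ?thesis
      by (simp add: o_def sobolev_norm_def sobolev_term_def)
  qed
  define X where "X n = szego_flow (v (\<rho> n)) (t (\<rho> n))" for n
  \<comment> \<open>The flows are compared at the same time by L2 stability, and then the time is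
    moved to \<open>\<tau>\<close> along the flow of \<open>u\<^sub>0\<close>.\<close>
  have X_lim: "X \<longlonglongrightarrow> szego_flow u\<^sub>0 \<tau>"
  proof -
    have "(\<lambda>n. szego_flow (v n) (t n) - szego_flow u\<^sub>0 (t n)) \<longlonglongrightarrow> 0"
    proof (rule LIMSEQ_I)
      fix \<eta> :: real assume \<eta>: "0 < \<eta>"
      obtain r where r: "0 < r" "\<And>u\<^sub>0 v\<^sub>0 t. u\<^sub>0 \<in> Hs_plus_set (1/2) \<Longrightarrow> v\<^sub>0 \<in> Hs_plus_set (1/2) \<Longrightarrow>
          wbound jap (M + 2) u\<^sub>0 \<Longrightarrow> wbound jap (M + 2) v\<^sub>0 \<Longrightarrow> norm (u\<^sub>0 - v\<^sub>0) \<le> r \<Longrightarrow> t \<in> {-T..T} \<Longrightarrow>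
          norm (szego_flow u\<^sub>0 t - szego_flow v\<^sub>0 t) \<le> \<eta> / 2"
        using szego_flow_L2_stable[OF T M2 half_gt_zero[OF \<eta>]] by metis
      have "\<forall>\<^sub>F n in sequentially. 2 * sobolev_norm (1/2) (v n - u\<^sub>0) < r"
        by (rule order_tendstoD(2)[OF close0 r(1)])
      then obtain N where N: "\<And>n. n \<ge> N \<Longrightarrow> 2 * sobolev_norm (1/2) (v n - u\<^sub>0) < r"
        unfolding eventually_sequentially by blast
      have "norm (szego_flow (v n) (t n) - szego_flow u\<^sub>0 (t n)) < \<eta>" if n: "n \<ge> N" for n
      proof -
        have "norm (v n - u\<^sub>0) \<le> r"
          using norm_le_sobolev_half(1)[OF v[of n] u0] N[OF n] by linarith
        then have "norm (szego_flow (v n) (t n) - szego_flow u\<^sub>0 (t n)) \<le> \<eta> / 2"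
          by (rule r(2)[OF v u0 vM uM2 _ t])
        then show ?thesis using \<eta> by linarith
      qed
      then show "\<exists>no. \<forall>n\<ge>no. norm (szego_flow (v n) (t n) - szego_flow u\<^sub>0 (t n) - 0) < \<eta>"
        by (intro exI[of _ N]) simp
    qed
    from LIMSEQ_subseq_LIMSEQ[OF this \<rho>]
    have "(\<lambda>n. X n - szego_flow u\<^sub>0 (t (\<rho> n))) \<longlonglongrightarrow> 0"
      by (simp add: o_def X_def)
    moreover have "(\<lambda>n. szego_flow u\<^sub>0 (t (\<rho> n)) - szego_flow u\<^sub>0 \<tau>) \<longlonglongrightarrow> 0"
    proof (rule Lim_null_comparison)
      show "\<forall>\<^sub>F n in sequentially. norm (szego_flow u\<^sub>0 (t (\<rho> n)) - szego_flow u\<^sub>0 \<tau>)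
          \<le> 2 * sobolev_norm (1/2) (szego_flow u\<^sub>0 (t (\<rho> n)) - szego_flow u\<^sub>0 \<tau>)"
        by (rule always_eventually, rule allI, rule norm_le_sobolev_half(1); rule szego_flow_Hs_plus(1)[OF u0])
      have "(\<lambda>n. 2 * sobolev_norm (1/2) (szego_flow u\<^sub>0 (t (\<rho> n)) - szego_flow u\<^sub>0 \<tau>)) \<longlonglongrightarrow> 2 * 0"
        by (intro tendsto_intros flow_lim)
      then show "(\<lambda>n. 2 * sobolev_norm (1/2) (szego_flow u\<^sub>0 (t (\<rho> n)) - szego_flow u\<^sub>0 \<tau>)) \<longlonglongrightarrow> 0"
        by (simp only: mult_zero_right)
    qed
    ultimately have "(\<lambda>n. (X n - szego_flow u\<^sub>0 (t (\<rho> n))) + (szego_flow u\<^sub>0 (t (\<rho> n)) - szego_flow u\<^sub>0 \<tau>)) \<longlonglongrightarrow> 0 + 0"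
      by (rule tendsto_add)
    then have "(\<lambda>n. X n - szego_flow u\<^sub>0 \<tau>) \<longlonglongrightarrow> 0"
      by simp
    then show ?thesis by (rule LIM_zero_cancel)
  qed
  have "(\<lambda>n. sobolev_norm (1/2) (X n - szego_flow u\<^sub>0 \<tau>)) \<longlonglongrightarrow> 0"
  proof (rule tendsto_sobolev_half[OF X_lim])
    have "(\<lambda>n. energy (v (\<rho> n))) \<longlonglongrightarrow> energy u\<^sub>0"
      using LIMSEQ_subseq_LIMSEQ[OF energy_lim \<rho>] by (simp add: o_def)
    then show "(\<lambda>n. energy (X n)) \<longlonglongrightarrow> energy (szego_flow u\<^sub>0 \<tau>)"
      by (simp add: X_def szego_flow_spec(3)[OF v] szego_flow_spec(3)[OF u0])
    show "wbound jap (M + 2) (X n)" for n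
      unfolding X_def by (rule wbound_szego_flow[OF v vM])
    show "wbound jap M (szego_flow u\<^sub>0 \<tau>)"
      by (rule wbound_szego_flow[OF u0 M(2)])
  qed
  from tendsto_add[OF this flow_lim]
  have sum_lim: "(\<lambda>n. sobolev_norm (1/2) (X n - szego_flow u\<^sub>0 \<tau>)
      + sobolev_norm (1/2) (szego_flow u\<^sub>0 (t (\<rho> n)) - szego_flow u\<^sub>0 \<tau>)) \<longlonglongrightarrow> 0"
    by simp
  have "e \<le> sobolev_norm (1/2) (X n - szego_flow u\<^sub>0 \<tau>)
      + sobolev_norm (1/2) (szego_flow u\<^sub>0 (t (\<rho> n)) - szego_flow u\<^sub>0 \<tau>)" for n
  proof -
    have "e \<le> sobolev_norm (1/2) (X n - szego_flow u\<^sub>0 (t (\<rho> n)))"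
      unfolding X_def by (rule far)
    also have "\<dots> \<le> sobolev_norm (1/2) (X n - szego_flow u\<^sub>0 \<tau>)
        + sobolev_norm (1/2) (szego_flow u\<^sub>0 \<tau> - szego_flow u\<^sub>0 (t (\<rho> n)))"
      unfolding X_def by (intro sobolev_norm_triangle3 szego_flow_Hs_plus v u0)
    finally show ?thesis by (simp only: sobolev_norm_commute[of "1/2" "szego_flow u\<^sub>0 \<tau>"])
  qed
  then have "e \<le> 0"
    by (intro LIMSEQ_le_const[OF sum_lim]) auto
  then show False using e by simp
qed

theorem theorem2p1:
  shows "(\<forall>u0 \<in> mspace (Hs_plus (1/2)). \<exists>!u. szego_solution u \<and> u 0 = u0)
    \<and> (\<forall>T>0. continuous_map (mtopology_of (Hs_plus (1/2)))
          (mtopology_of (cfunspace (top_of_set {-T..T}) (Hs_plus (1/2))))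
          (\<lambda>u0. restrict (szego_flow u0) {-T..T}))
    \<and> (\<forall>s>1/2. \<forall>u0 \<in> mspace (Hs_plus s).
          continuous_map euclideanreal (mtopology_of (Hs_plus s)) (szego_flow u0))"
proof (intro conjI ballI allI impI)
  fix u0 assume "u0 \<in> mspace (Hs_plus (1/2))"
  then have u0: "u0 \<in> Hs_plus_set (1/2)" by simp
  show "\<exists>!u. szego_solution u \<and> u 0 = u0"
    using szego_flow_spec(1,2)[OF u0] szego_solution_unique by (intro ex1I[of _ "szego_flow u0"]) auto
next
  fix T :: real assume T: "0 < T"
  let ?X = "top_of_set {-T..T}"
  let ?r = "\<lambda>u0. restrict (szego_flow u0) {-T..T}"
  have mem: "?r u0 \<in> mspace (cfunspace ?X (Hs_plus (1/2)))" if u0: "u0 \<in> Hs_plus_set (1/2)" for u0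
  proof -
    have "continuous_map euclideanreal (mtopology_of (Hs_plus (1/2))) (szego_flow u0)"
      using szego_flow_spec(1)[OF u0] by (simp add: szego_solution_def)
    then have "continuous_map ?X (mtopology_of (Hs_plus (1/2))) (szego_flow u0)"
      by (rule continuous_map_from_subtopology)
    then have "continuous_map ?X (mtopology_of (Hs_plus (1/2))) (?r u0)"
      by (rule continuous_map_eq) auto
    \<comment> \<open>On a compact interval continuity already provides the boundedness required of
      members of \<open>cfunspace\<close>.\<close>
    moreover have "compactin ?X (topspace ?X)"
      by (simp add: compactin_subtopology)
    ultimately show ?thesis
      using szego_flow_Hs_plus(1)[OF u0] by (subst compactin_mspace_cfunspace) auto
  qed
  show "continuous_map (mtopology_of (Hs_plus (1/2))) (mtopology_of (cfunspace ?X (Hs_plus (1/2)))) ?r"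
    unfolding continuous_map_mtopology_of
  proof (intro conjI ballI allI impI)
    show "?r ` mspace (Hs_plus (1/2)) \<subseteq> mspace (cfunspace ?X (Hs_plus (1/2)))"
      by (intro image_subsetI mem) simp
    fix u0 and e :: real assume "u0 \<in> mspace (Hs_plus (1/2))" and e: "0 < e"
    then have u0: "u0 \<in> Hs_plus_set (1/2)" by simp
    \<comment> \<open>A pointwise bound passes to the supremum only as a weak inequality;
      \<open>e / 2\<close> keeps the final one strict.\<close>
    obtain d where d: "0 < d" "\<And>v0 t. v0 \<in> Hs_plus_set (1/2) \<Longrightarrow> sobolev_norm (1/2) (v0 - u0) < d \<Longrightarrow>
        t \<in> {-T..T} \<Longrightarrow> sobolev_norm (1/2) (szego_flow v0 t - szego_flow u0 t) < e / 2"
      using szego_flow_continuous[OF u0, of "e / 2" T] e by auto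
    show "\<exists>d>0. \<forall>v0. v0 \<in> mspace (Hs_plus (1/2)) \<and> mdist (Hs_plus (1/2)) u0 v0 < d \<longrightarrow>
        mdist (cfunspace ?X (Hs_plus (1/2))) (?r u0) (?r v0) < e"
    proof (intro exI[of _ d] conjI allI impI d(1))
      fix v0 assume "v0 \<in> mspace (Hs_plus (1/2)) \<and> mdist (Hs_plus (1/2)) u0 v0 < d"
      then have v0: "v0 \<in> Hs_plus_set (1/2)" "sobolev_norm (1/2) (v0 - u0) < d"
        by (auto simp: sobolev_norm_commute[of "1/2" u0])
      have "mdist (cfunspace ?X (Hs_plus (1/2))) (?r u0) (?r v0) \<le> e / 2"
      proof (rule mdist_cfunspace_le)
        fix t assume "t \<in> topspace ?X"
        then have "t \<in> {-T..T}" by simp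
        then show "mdist (Hs_plus (1/2)) (?r u0 t) (?r v0 t) \<le> e / 2"
          using d(2)[OF v0, of t] by (simp add: sobolev_norm_commute[of "1/2" "szego_flow u0 t"])
      qed (use e in simp)
      then show "mdist (cfunspace ?X (Hs_plus (1/2))) (?r u0) (?r v0) < e"
        using e by linarith
    qed
  qed
next
  fix s :: real and u0 assume s: "1/2 < s" and "u0 \<in> mspace (Hs_plus s)"
  then have u0: "u0 \<in> Hs_plus_set s" by simp
  then have "u0 \<in> Hs_plus_set (1/2)"
    using Hs_plus_set_subset[of s] s by auto
  then show "continuous_map euclideanreal (mtopology_of (Hs_plus s)) (szego_flow u0)"
    using s u0 by (rule szego_flow_spec(4))
qed

end
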